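(* Let $n\ge 3$, let $p\in(1,n)$, let $\Omega\subset\mathbb{R}^n$ be a nonempty bounded open convex set, and let $u$ be the $p$-capacitary potential function of $\Omega$, i.e. the (classical) solution of $$\operatorname{div}(|\nabla u|^{p-2}\nabla u)=0\ \text{ in }\mathbb{R}^n\setminus\overline{\Omega},\qquad u=1\ \text{ in }\overline{\Omega},\qquad \lim_{|x|\to+\infty}u(x)=0 .$$ For $t\in(0,1]$ let $\Omega(t)=\{x\in\mathbb{R}^n : u(x)\ge t\}$. If $u$ has two homothetic level sets, that is, if there exist $0<r<s\le 1$ such that $\Omega(r)$ and $\Omega(s)$ are homothetic, then $\Omega$ is a ball.
   Context: Two sets $A,B\subset\mathbb{R}^n$ are called homothetic if there exist $\rho>0$ and $\xi\in\mathbb{R}^n$ such that $B=\rho A+\xi$, i.e. if they are a dilate and translate of each other. The solution $u$ is understood as the classical solution, $u\in C(\mathbb{R}^n)\cap C^2(\mathbb{R}^n\setminus\overline{\Omega})$; it is defined on all of $\mathbb{R}^n$ and equals $1$ on $\overline{\Omega}$. A ball is a Euclidean ball $B(x_0,R)$ with $x_0\in\mathbb{R}^n$ and $R>0$. *)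

theory Defs
  imports "HOL-Analysis.Analysis"
begin

definition gradient :: "(real ^ 'n \<Rightarrow> real) \<Rightarrow> real ^ 'n \<Rightarrow> real ^ 'n" where
  "gradient f x = (THE D. GDERIV f x :> D)"

lemma gradient_eqI:
  assumes "GDERIV f x :> D"
  shows "gradient f x = D"
proof -
  have "E = D" if "GDERIV f x :> E" for E
  proof -
    have "(\<lambda>h. inner h E) = (\<lambda>h. inner h D)"
      using that assms unfolding gderiv_def by (rule has_derivative_unique)
    then have "inner (E - D) E = inner (E - D) D"
      by (rule fun_cong)
    then have "inner (E - D) (E - D) = 0"
      by (simp add: inner_diff_right)
    then show ?thesis
      by simp
  qed
  with assms show ?thesis
    unfolding gradient_def by (rule the_equality)
qed

lemma gradient_works:
  assumes "f differentiable (at x)"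
  shows "GDERIV f x :> gradient f x"
proof -
  obtain f' where f': "(f has_derivative f') (at x)"
    using assms unfolding differentiable_def by blast
  have "linear f'"
    using f' by (rule has_derivative_linear)
  define D where "D = adjoint f' 1"
  have "f' h = inner h D" for h
    using adjoint_works[OF \<open>linear f'\<close>, of h 1] by (simp add: D_def)
  then have "f' = (\<lambda>h. inner h D)"
    by (rule ext)
  with f' have "GDERIV f x :> D"
    by (simp add: gderiv_def)
  then show ?thesis
    by (simp add: gradient_eqI)
qed

text \<open>Class \<open>C\<^sup>2\<close> on an open set \<open>S\<close>: the Hessian (the Jacobian matrix of the gradient) exists
  at every point of \<open>S\<close> and is continuous there. Continuity of the gradient follows from its
  differentiability.\<close>

definition C2_on :: "(real ^ 'n \<Rightarrow> real) \<Rightarrow> (real ^ 'n) set \<Rightarrow> bool" where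
  "C2_on f S \<longleftrightarrow>
     (\<forall>x\<in>S. f differentiable (at x) \<and> gradient f differentiable (at x)) \<and>
     continuous_on S (\<lambda>x. jacobian (gradient f) (at x))"

definition divergence :: "(real ^ 'n \<Rightarrow> real ^ 'n) \<Rightarrow> real ^ 'n \<Rightarrow> real" where
  "divergence F x = trace (jacobian F (at x))"

text \<open>At a critical point the flux is \<open>0\<close>, for every \<open>p\<close>: the value at \<open>0\<close> of the continuous
  field \<open>v \<mapsto> |v|\<^sup>p\<^sup>-\<^sup>2 v\<close>, \<open>p > 1\<close>.\<close>

definition p_flux :: "real \<Rightarrow> (real ^ 'n \<Rightarrow> real) \<Rightarrow> real ^ 'n \<Rightarrow> real ^ 'n" where
  "p_flux p u x = norm (gradient u x) powr (p - 2) *\<^sub>R gradient u x"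

text \<open>Differentiability of the flux is demanded explicitly, because \<open>divergence\<close> is meaningless
  without it. It follows from \<open>C\<^sup>2\<close> regularity wherever the gradient does not vanish.\<close>

definition p_capacitary_potential ::
  "real \<Rightarrow> (real ^ 'n) set \<Rightarrow> (real ^ 'n \<Rightarrow> real) \<Rightarrow> bool" where
  "p_capacitary_potential p \<Omega> u \<longleftrightarrow>
     continuous_on UNIV u \<and>
     C2_on u (- closure \<Omega>) \<and>
     (\<forall>x \<in> - closure \<Omega>. p_flux p u differentiable (at x) \<and> divergence (p_flux p u) x = 0) \<and>
     (\<forall>x \<in> closure \<Omega>. u x = 1) \<and>
     (u \<longlongrightarrow> 0) at_infinity"

definition homothetic :: "(real ^ 'n) set \<Rightarrow> (real ^ 'n) set \<Rightarrow> bool" where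
  "homothetic A B \<longleftrightarrow> (\<exists>\<rho> \<xi>. \<rho> > 0 \<and> B = (\<lambda>x. \<rho> *\<^sub>R x + \<xi>) ` A)"

definition level_set :: "(real ^ 'n \<Rightarrow> real) \<Rightarrow> real \<Rightarrow> (real ^ 'n) set" where
  "level_set u t = {x. u x \<ge> t}"

end

theory Submission
  imports Defs
begin

text \<open>
  A homothety with ratio \<open>\<rho> \<noteq> 1\<close> has a fixed point; put it at the origin and write
  \<open>b = (n - p) / (p - 1)\<close>, so that \<open>|x|\<^sup>-\<^sup>b\<close> is \<open>p\<close>-harmonic away from the origin. Let \<open>L\<^sub>t\<close> be the
  set where \<open>u \<ge> t\<close>, so that \<open>L\<^sub>r = \<beta> L\<^sub>s\<close> with \<open>\<beta> = 1 / \<rho> > 1\<close>. The proof shows first that \<open>u\<close> is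
  a multiple of \<open>|x|\<^sup>-\<^sup>b\<close> far away, and then that this formula persists down to the level \<open>1\<close>.

  Far away, everything follows from touching \<open>u\<close> by multiples of \<open>|x|\<^sup>-\<^sup>a\<close>. These functions have no
  critical points and are strict supersolutions for \<open>a < b\<close> and strict subsolutions for \<open>a > b\<close>, so
  at an extremum of the difference the gradient of \<open>u\<close> does not vanish and the first and second
  order conditions suffice for the comparison \<open>comparison_radial_power\<close>; then \<open>a\<close> tends to \<open>b\<close>. Let \<open>m\<close> be the largest
  norm on \<open>L\<^sub>s\<close>, attained at \<open>x\<^sub>m\<close>. Comparison outside the ball of radius \<open>m\<close> gives
  \<open>u \<le> s m\<^sup>b |x|\<^sup>-\<^sup>b\<close>, hence \<open>r \<le> s \<beta>\<^sup>-\<^sup>b\<close> at the point \<open>\<beta> x\<^sub>m\<close> of \<open>L\<^sub>r\<close>. The largest ball inside \<open>L\<^sub>s\<close> gives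
  \<open>r \<ge> s \<beta>\<^sup>-\<^sup>b\<close> in the same way. Thus \<open>u\<close> and \<open>v = s m\<^sup>b |x|\<^sup>-\<^sup>b\<close> agree at \<open>\<beta> x\<^sub>m\<close>, an interior point of
  the region where \<open>u \<le> v\<close> is known, and \<open>strong_maximum_principle\<close> gives \<open>u = v\<close> for \<open>|x| > m\<close>.

  To go inward, note that \<open>w = u - v\<close> satisfies a linear differential inequality with an explicit
  operator: on compact sets avoiding the origin and the closure of \<open>\<Omega>\<close>, \<open>|x|\<^sup>2 \<Delta>w + (p - 2) x \<cdot> D\<^sup>2w x\<close> is bounded by
  a multiple of \<open>|\<nabla>w|\<close> (\<open>p_op_difference_bound\<close>), because the gradient of \<open>v\<close> is a nonzero multiple
  of \<open>x\<close>. In the variables \<open>ln |x|\<close> and \<open>x / |x|\<close> this is, up to a first order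
  term, a cylindrical operator with constant coefficients. A Carleman estimate with a weight depending on \<open>|x|\<close> alone shows that \<open>w\<close>
  continues to vanish across every sphere that the closure of \<open>\<Omega>\<close> does not meet
  (\<open>unique_continuation_spheres\<close>). As long as \<open>v < 1\<close> on a sphere that has been reached, this sphere
  is disjoint from the closure of \<open>\<Omega>\<close>, where \<open>u = 1\<close>; so \<open>u = v\<close> up to the sphere on which \<open>v = 1\<close>.
  A point of this sphere outside the closure of \<open>\<Omega>\<close> would be a maximum of \<open>u \<le> 1\<close> at which the
  radial derivative of \<open>u\<close> is that of \<open>v\<close>, which is not zero. Hence the closure of \<open>\<Omega>\<close>
  contains the sphere and lies inside it, and by convexity it is the closed ball.
\<close>

section \<open>Functions of class \<open>C\<^sup>2\<close> with explicit gradient and Hessian\<close>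

text \<open>The gradient and the Hessian are carried along as functions, so that the product and chain rules
  below compute them instead of asserting their existence.\<close>

definition C2_data ::
  "'a::euclidean_space set \<Rightarrow> ('a \<Rightarrow> real) \<Rightarrow> ('a \<Rightarrow> 'a) \<Rightarrow> ('a \<Rightarrow> 'a \<Rightarrow> 'a) \<Rightarrow> bool" where
  "C2_data S f g H \<longleftrightarrow> open S \<and>
     (\<forall>x\<in>S. (f has_derivative (\<lambda>h. g x \<bullet> h)) (at x) \<and> (g has_derivative H x) (at x)) \<and>
     (\<forall>h. continuous_on S (\<lambda>x. H x h))"

lemma C2_dataD:
  assumes "C2_data S f g H" "x \<in> S"
  shows "(f has_derivative (\<lambda>h. g x \<bullet> h)) (at x)" "(g has_derivative H x) (at x)"
    "linear (H x)"
  using assms unfolding C2_data_def by (auto intro: has_derivative_linear)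

lemma C2_data_open: "C2_data S f g H \<Longrightarrow> open S"
  by (simp add: C2_data_def)

lemma C2_data_cont:
  assumes "C2_data S f g H"
  shows "continuous_on S f" "continuous_on S g" "continuous_on S (\<lambda>x. H x h)"
proof -
  show "continuous_on S f" "continuous_on S g"
    using assms unfolding C2_data_def
    by (meson differentiableI differentiable_imp_continuous_within continuous_at_imp_continuous_on)+
  show "continuous_on S (\<lambda>x. H x h)"
    using assms unfolding C2_data_def by blast
qed

lemma C2_data_subset:
  assumes "C2_data S f g H" "T \<subseteq> S" "open T"
  shows "C2_data T f g H"
  using assms unfolding C2_data_def by (meson continuous_on_subset subsetD)

lemma C2_data_cont_Hess:
  assumes "C2_data S f g H" "continuous_on T k" "T \<subseteq> S"
  shows "continuous_on T (\<lambda>x. H x (k x))"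
proof -
  have eq: "H x (k x) = (\<Sum>i\<in>Basis. (k x \<bullet> i) *\<^sub>R H x i)" if "x \<in> T" for x
  proof -
    have "linear (H x)"
      using C2_dataD(3) assms that by blast
    then have "H x (\<Sum>i\<in>Basis. (k x \<bullet> i) *\<^sub>R i) = (\<Sum>i\<in>Basis. (k x \<bullet> i) *\<^sub>R H x i)"
      by (simp add: linear_sum linear_scale)
    then show ?thesis
      by (simp add: euclidean_representation)
  qed
  have "continuous_on T (\<lambda>x. \<Sum>i\<in>Basis. (k x \<bullet> i) *\<^sub>R H x i)"
    using assms C2_data_cont(3)[OF assms(1)]
    by (intro continuous_intros) (auto intro: continuous_on_subset)
  then show ?thesis
    by (subst continuous_on_cong[OF refl eq])
qed

lemma C2_data_diff:
  assumes "C2_data S f g H" "C2_data S f' g' H'"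
  shows "C2_data S (\<lambda>x. f x - f' x) (\<lambda>x. g x - g' x) (\<lambda>x h. H x h - H' x h)"
  using assms unfolding C2_data_def
  by (auto intro!: derivative_eq_intros continuous_intros simp: inner_diff_left)

lemma C2_data_add:
  assumes "C2_data S f g H" "C2_data S f' g' H'"
  shows "C2_data S (\<lambda>x. f x + f' x) (\<lambda>x. g x + g' x) (\<lambda>x h. H x h + H' x h)"
  using assms unfolding C2_data_def
  by (auto intro!: derivative_eq_intros continuous_intros simp: inner_add_left)

lemma C2_data_cmult:
  assumes "C2_data S f g H"
  shows "C2_data S (\<lambda>x. c * f x) (\<lambda>x. c *\<^sub>R g x) (\<lambda>x h. c *\<^sub>R H x h)"
  using assms unfolding C2_data_def
  by (auto intro!: derivative_eq_intros continuous_intros)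

lemma C2_data_mult:
  assumes "C2_data S f g H" "C2_data S f' g' H'"
  shows "C2_data S (\<lambda>x. f x * f' x) (\<lambda>x. f x *\<^sub>R g' x + f' x *\<^sub>R g x)
     (\<lambda>x h. (g x \<bullet> h) *\<^sub>R g' x + f x *\<^sub>R H' x h + (g' x \<bullet> h) *\<^sub>R g x + f' x *\<^sub>R H x h)"
  unfolding C2_data_def
proof (intro conjI ballI allI)
  show "open S" using assms C2_data_open by blast
  fix x assume x: "x \<in> S"
  note d = C2_dataD[OF assms(1) x] C2_dataD[OF assms(2) x]
  show "((\<lambda>x. f x * f' x) has_derivative (\<lambda>h. (f x *\<^sub>R g' x + f' x *\<^sub>R g x) \<bullet> h)) (at x)"
    using d by (auto intro!: derivative_eq_intros simp: algebra_simps inner_add_left)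
  show "((\<lambda>x. f x *\<^sub>R g' x + f' x *\<^sub>R g x) has_derivative
     (\<lambda>h. (g x \<bullet> h) *\<^sub>R g' x + f x *\<^sub>R H' x h + (g' x \<bullet> h) *\<^sub>R g x + f' x *\<^sub>R H x h)) (at x)"
    using d by (auto intro!: derivative_eq_intros simp: algebra_simps)
next
  fix h
  note c = C2_data_cont[OF assms(1)] C2_data_cont[OF assms(2)]
  show "continuous_on S (\<lambda>x. (g x \<bullet> h) *\<^sub>R g' x + f x *\<^sub>R H' x h + (g' x \<bullet> h) *\<^sub>R g x + f' x *\<^sub>R H x h)"
    by (intro continuous_intros c)
qed

lemma C2_data_comp:
  assumes f: "C2_data S f g H"
    and \<theta>: "\<And>x. x \<in> S \<Longrightarrow> (\<theta> has_real_derivative \<theta>' (f x)) (at (f x))"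
    and \<theta>': "\<And>x. x \<in> S \<Longrightarrow> (\<theta>' has_real_derivative \<theta>'' (f x)) (at (f x))"
    and c: "continuous_on (f ` S) \<theta>''"
  shows "C2_data S (\<lambda>x. \<theta> (f x)) (\<lambda>x. \<theta>' (f x) *\<^sub>R g x)
     (\<lambda>x h. (\<theta>'' (f x) * (g x \<bullet> h)) *\<^sub>R g x + \<theta>' (f x) *\<^sub>R H x h)"
  unfolding C2_data_def
proof (intro conjI ballI allI)
  show "open S" using assms C2_data_open by blast
  fix x assume x: "x \<in> S"
  note d = C2_dataD[OF f x]
  have 1: "((\<lambda>x. \<theta> (f x)) has_derivative (\<lambda>h. (g x \<bullet> h) * \<theta>' (f x))) (at x)"
    using has_derivative_compose[OF d(1) \<theta>[OF x, unfolded has_field_derivative_def]]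
    by (simp add: mult.commute)
  then show "((\<lambda>x. \<theta> (f x)) has_derivative (\<lambda>h. (\<theta>' (f x) *\<^sub>R g x) \<bullet> h)) (at x)"
    by (simp add: mult.commute)
  have 2: "((\<lambda>x. \<theta>' (f x)) has_derivative (\<lambda>h. \<theta>'' (f x) * (g x \<bullet> h))) (at x)"
    using has_derivative_compose[OF d(1) \<theta>'[OF x, unfolded has_field_derivative_def]] by simp
  show "((\<lambda>x. \<theta>' (f x) *\<^sub>R g x) has_derivative
     (\<lambda>h. (\<theta>'' (f x) * (g x \<bullet> h)) *\<^sub>R g x + \<theta>' (f x) *\<^sub>R H x h)) (at x)"
    using has_derivative_scaleR[OF 2 d(2)] by (simp add: add.commute)
next
  fix h
  have 3: "continuous_on S (\<lambda>x. \<theta>'' (f x))"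
    using continuous_on_compose2[OF c C2_data_cont(1)[OF f]] by blast
  have 4: "continuous_on S (\<lambda>x. \<theta>' (f x))"
  proof (rule continuous_on_compose2[OF _ C2_data_cont(1)[OF f] subset_refl])
    show "continuous_on (f ` S) \<theta>'"
      using \<theta>' by (auto intro!: continuous_at_imp_continuous_on dest: DERIV_isCont)
  qed
  show "continuous_on S (\<lambda>x. (\<theta>'' (f x) * (g x \<bullet> h)) *\<^sub>R g x + \<theta>' (f x) *\<^sub>R H x h)"
    by (intro continuous_intros 3 4 C2_data_cont[OF f])
qed

lemma C2_data_norm_square:
  "open S \<Longrightarrow> C2_data S (\<lambda>x. (x - c) \<bullet> (x - c)) (\<lambda>x. 2 *\<^sub>R (x - c)) (\<lambda>x h. 2 *\<^sub>R h)"
  unfolding C2_data_def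
  by (auto intro!: derivative_eq_intros continuous_intros simp: inner_commute)

lemma C2_data_line:
  assumes "C2_data S f g H" "x + t *\<^sub>R e \<in> S"
  shows "((\<lambda>t. f (x + t *\<^sub>R e)) has_real_derivative g (x + t *\<^sub>R e) \<bullet> e) (at t)"
    "((\<lambda>t. a \<bullet> g (x + t *\<^sub>R e)) has_real_derivative a \<bullet> H (x + t *\<^sub>R e) e) (at t)"
proof -
  have l: "((\<lambda>t. x + t *\<^sub>R e) has_derivative (\<lambda>s. s *\<^sub>R e)) (at t)"
    by (auto intro!: derivative_eq_intros)
  note d = C2_dataD[OF assms]
  show "((\<lambda>t. f (x + t *\<^sub>R e)) has_real_derivative g (x + t *\<^sub>R e) \<bullet> e) (at t)"
    using has_derivative_compose[OF l d(1)]
    by (simp add: has_field_derivative_def mult.commute[of _ "g (x + t *\<^sub>R e) \<bullet> e"])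
  have "((\<lambda>t. a \<bullet> g (x + t *\<^sub>R e)) has_derivative (\<lambda>s. a \<bullet> H (x + t *\<^sub>R e) (s *\<^sub>R e))) (at t)"
    by (intro has_derivative_inner_right has_derivative_compose[OF l d(2)])
  then show "((\<lambda>t. a \<bullet> g (x + t *\<^sub>R e)) has_real_derivative a \<bullet> H (x + t *\<^sub>R e) e) (at t)"
    using d(3) by (simp add: has_field_derivative_def linear_scale
        mult.commute[of _ "a \<bullet> H (x + t *\<^sub>R e) e"])
qed

text \<open>The mean value theorem is applied twice to the second difference over a parallelogram. The second
  difference is symmetric in \<open>a\<close> and \<open>b\<close>, which is what makes the Hessian symmetric.\<close>

lemma Hessian_mean_value:
  assumes D: "C2_data S f g H" and s: "s > 0" and r: "s * (norm a + norm b) < r" "ball x r \<subseteq> S"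
  shows "\<exists>y\<in>ball x r. f (x + s *\<^sub>R a + s *\<^sub>R b) - f (x + s *\<^sub>R a) - f (x + s *\<^sub>R b) + f x
     = s^2 * (a \<bullet> H y b)"
proof -
  have inb: "x + t *\<^sub>R a + t' *\<^sub>R b \<in> ball x r" if "0 \<le> t" "t \<le> s" "0 \<le> t'" "t' \<le> s" for t t'
  proof -
    have "norm (t *\<^sub>R a + t' *\<^sub>R b) \<le> t * norm a + t' * norm b"
      using that norm_triangle_ineq[of "t *\<^sub>R a" "t' *\<^sub>R b"] by simp
    also have "\<dots> \<le> s * norm a + s * norm b"
      using that by (intro add_mono mult_right_mono) auto
    also have "\<dots> < r"
      using r by (simp add: algebra_simps)
    finally have "norm (t *\<^sub>R a + t' *\<^sub>R b) < r" .
    moreover have "x - (x + t *\<^sub>R a + t' *\<^sub>R b) = - (t *\<^sub>R a + t' *\<^sub>R b)"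
      by simp
    ultimately show ?thesis
      by (simp only: mem_ball dist_norm norm_minus_cancel)
  qed
  have "\<exists>z>0. z < s \<and> (f ((x + s *\<^sub>R b) + s *\<^sub>R a) - f (x + s *\<^sub>R a)) - (f ((x + s *\<^sub>R b) + 0 *\<^sub>R a) - f (x + 0 *\<^sub>R a))
     = (s - 0) * (g ((x + s *\<^sub>R b) + z *\<^sub>R a) \<bullet> a - g (x + z *\<^sub>R a) \<bullet> a)"
  proof (rule MVT2[OF s])
    fix t assume t: "0 \<le> t" "t \<le> s"
    have 1: "(x + s *\<^sub>R b) + t *\<^sub>R a \<in> S"
      using inb[OF t, of s] s r(2) by (auto simp: algebra_simps)
    have 2: "x + t *\<^sub>R a \<in> S"
      using inb[OF t, of 0] s r(2) by (auto simp: algebra_simps)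
    show "((\<lambda>t. f ((x + s *\<^sub>R b) + t *\<^sub>R a) - f (x + t *\<^sub>R a)) has_real_derivative
      g ((x + s *\<^sub>R b) + t *\<^sub>R a) \<bullet> a - g (x + t *\<^sub>R a) \<bullet> a) (at t)"
      by (intro DERIV_diff C2_data_line[OF D] 1 2)
  qed
  then obtain z where z: "0 < z" "z < s"
    "f (x + s *\<^sub>R a + s *\<^sub>R b) - f (x + s *\<^sub>R a) - f (x + s *\<^sub>R b) + f x
     = s * (a \<bullet> g ((x + z *\<^sub>R a) + s *\<^sub>R b) - a \<bullet> g ((x + z *\<^sub>R a) + 0 *\<^sub>R b))"
    by (auto simp: algebra_simps inner_commute)
  have "\<exists>t>0. t < s \<and> a \<bullet> g ((x + z *\<^sub>R a) + s *\<^sub>R b) - a \<bullet> g ((x + z *\<^sub>R a) + 0 *\<^sub>R b)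
      = (s - 0) * (a \<bullet> H ((x + z *\<^sub>R a) + t *\<^sub>R b) b)"
  proof (rule MVT2[OF s])
    fix t assume t: "0 \<le> t" "t \<le> s"
    have 1: "(x + z *\<^sub>R a) + t *\<^sub>R b \<in> S"
      using inb[of z t] t z r(2) by auto
    show "((\<lambda>t. a \<bullet> g ((x + z *\<^sub>R a) + t *\<^sub>R b)) has_real_derivative
      a \<bullet> H ((x + z *\<^sub>R a) + t *\<^sub>R b) b) (at t)"
      by (intro C2_data_line[OF D] 1)
  qed
  then obtain t where "0 < t" "t < s" "a \<bullet> g ((x + z *\<^sub>R a) + s *\<^sub>R b) - a \<bullet> g ((x + z *\<^sub>R a) + 0 *\<^sub>R b)
      = s * (a \<bullet> H ((x + z *\<^sub>R a) + t *\<^sub>R b) b)"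
    by auto
  with z inb[of z t] show ?thesis
    by (intro bexI[of _ "x + z *\<^sub>R a + t *\<^sub>R b"]) (auto simp: power2_eq_square)
qed

lemma Hessian_symmetric:
  assumes D: "C2_data S f g H" and x: "x \<in> S"
  shows "a \<bullet> H x b = b \<bullet> H x a"
proof (rule ccontr)
  assume ne: "a \<bullet> H x b \<noteq> b \<bullet> H x a"
  define e where "e = \<bar>a \<bullet> H x b - b \<bullet> H x a\<bar> / 2"
  have e: "e > 0" using ne by (simp add: e_def)
  have cont: "isCont (\<lambda>y. p \<bullet> H y q) x" for p q
    using C2_data_cont(3)[OF D, of q] x C2_data_open[OF D]
    by (intro continuous_intros) (simp add: continuous_on_eq_continuous_at)
  obtain r0 where r0: "r0 > 0" "ball x r0 \<subseteq> S"
    using C2_data_open[OF D] x open_contains_ball by blast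
  obtain r1 where r1: "r1 > 0" "\<And>y. dist y x < r1 \<Longrightarrow> \<bar>a \<bullet> H y b - a \<bullet> H x b\<bar> < e"
    using cont[of a b] e unfolding continuous_at_eps_delta dist_real_def by blast
  obtain r2 where r2: "r2 > 0" "\<And>y. dist y x < r2 \<Longrightarrow> \<bar>b \<bullet> H y a - b \<bullet> H x a\<bar> < e"
    using cont[of b a] e unfolding continuous_at_eps_delta dist_real_def by blast
  define r where "r = Min {r0, r1, r2}"
  have r: "r > 0" "r \<le> r0" "r \<le> r1" "r \<le> r2"
    using r0 r1 r2 by (auto simp: r_def)
  define s where "s = r / (norm a + norm b + 1)"
  have n0: "norm a + norm b + 1 > 0"
    by (simp add: add_nonneg_pos)
  have s: "s > 0" using r n0 by (simp add: s_def)
  have "s * (norm a + norm b) < s * (norm a + norm b + 1)"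
    using s by simp
  also have "\<dots> = r"
    using n0 by (simp add: s_def)
  finally have sr: "s * (norm a + norm b) < r" .
  have bS: "ball x r \<subseteq> S"
    using r(2) r0(2) subset_ball by blast
  obtain y where y: "y \<in> ball x r" "f (x + s *\<^sub>R a + s *\<^sub>R b) - f (x + s *\<^sub>R a) - f (x + s *\<^sub>R b) + f x
     = s^2 * (a \<bullet> H y b)"
    using Hessian_mean_value[OF D s sr bS] by blast
  obtain z where z: "z \<in> ball x r" "f (x + s *\<^sub>R b + s *\<^sub>R a) - f (x + s *\<^sub>R b) - f (x + s *\<^sub>R a) + f x
     = s^2 * (b \<bullet> H z a)"
    using Hessian_mean_value[OF D s _ bS, of b a] sr by (auto simp: add.commute)
  have "f (x + s *\<^sub>R b + s *\<^sub>R a) = f (x + s *\<^sub>R a + s *\<^sub>R b)"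
    by (simp add: algebra_simps)
  with y z have "s^2 * (a \<bullet> H y b) = s^2 * (b \<bullet> H z a)"
    by linarith
  then have "a \<bullet> H y b = b \<bullet> H z a"
    using s by simp
  moreover have "\<bar>a \<bullet> H y b - a \<bullet> H x b\<bar> < e" "\<bar>b \<bullet> H z a - b \<bullet> H x a\<bar> < e"
    using y z r r1(2)[of y] r2(2)[of z] by (auto simp: dist_commute)
  ultimately show False
    unfolding e_def by (smt (verit) field_sum_of_halves)
qed

lemma local_max_gradient_Hessian:
  assumes D: "C2_data S f g H" and x: "x \<in> S" and r: "r > 0"
    and mx: "\<And>y. y \<in> ball x r \<Longrightarrow> f y \<le> f x"
  shows "g x = 0" "h \<bullet> H x h \<le> 0"
proof -
  obtain r0 where r0: "r0 > 0" "ball x r0 \<subseteq> S"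
    using C2_data_open[OF D] x open_contains_ball by blast
  have "(\<lambda>h. g x \<bullet> h) = (\<lambda>h. 0)"
    by (rule differential_zero_maxmin[of x "ball x r", OF _ open_ball C2_dataD(1)[OF D x]]) (use r mx in auto)
  then have "g x \<bullet> g x = 0"
    by meson
  then show g0: "g x = 0"
    by simp
  show "h \<bullet> H x h \<le> 0"
  proof (rule ccontr)
    assume "\<not> ?thesis"
    then have pos: "h \<bullet> H (x + 0 *\<^sub>R h) h > 0" by simp
    then have h0: "h \<noteq> 0" by auto
    define s where "s = min r r0 / norm h"
    have s: "s > 0" using r r0 h0 by (simp add: s_def)
    have inb: "x + t *\<^sub>R h \<in> ball x (min r r0)" if "0 \<le> t" "t < s" for t
      using that h0 r r0 by (auto simp: s_def dist_norm field_simps)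
    obtain d where d: "d > 0" "\<And>t. 0 < t \<Longrightarrow> t < d \<Longrightarrow> h \<bullet> g x < h \<bullet> g (x + t *\<^sub>R h)"
      using DERIV_pos_inc_right[OF C2_data_line(2)[OF D, of x 0 h h] pos] x by auto
    define t where "t = min d s / 2"
    have t: "0 < t" "t < d" "t < s" using d s by (auto simp: t_def)
    have "\<exists>z>0. z < t \<and> f (x + t *\<^sub>R h) - f (x + 0 *\<^sub>R h) = (t - 0) * (g (x + z *\<^sub>R h) \<bullet> h)"
    proof (rule MVT2[OF t(1)])
      fix u assume u: "0 \<le> u" "u \<le> t"
      have "x + u *\<^sub>R h \<in> S" using inb[of u] u t r0 by auto
      then show "((\<lambda>t. f (x + t *\<^sub>R h)) has_real_derivative g (x + u *\<^sub>R h) \<bullet> h) (at u)"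
        by (rule C2_data_line[OF D])
    qed
    then obtain z where z: "0 < z" "z < t" "f (x + t *\<^sub>R h) - f x = t * (g (x + z *\<^sub>R h) \<bullet> h)"
      by auto
    have "g (x + z *\<^sub>R h) \<bullet> h > 0"
      using d(2)[of z] z t g0 by (simp add: inner_commute)
    then have "t * (g (x + z *\<^sub>R h) \<bullet> h) > 0"
      using t by simp
    then have "f (x + t *\<^sub>R h) > f x"
      using z by linarith
    moreover have "f (x + t *\<^sub>R h) \<le> f x"
      using mx inb[of t] t by auto
    ultimately show False by simp
  qed
qed

definition tr :: "('a::euclidean_space \<Rightarrow> 'a) \<Rightarrow> real" where
  "tr A = (\<Sum>i\<in>Basis. i \<bullet> A i)"

text \<open>Where \<open>\<xi> = \<nabla>u\<close> is not zero, the \<open>p\<close>-Laplacian of \<open>u\<close> is \<open>|\<xi>|\<^sup>p\<^sup>-\<^sup>4\<close> times this expression with \<open>A = D\<^sup>2u\<close>.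
  Being polynomial in \<open>\<xi>\<close>, it makes sense at critical points too, where it is \<open>0\<close>.\<close>

definition p_op :: "real \<Rightarrow> 'a::euclidean_space \<Rightarrow> ('a \<Rightarrow> 'a) \<Rightarrow> real" where
  "p_op p \<xi> A = (\<xi> \<bullet> \<xi>) * tr A + (p - 2) * (\<xi> \<bullet> A \<xi>)"

lemma tr_add: "tr (\<lambda>h. A h + B h) = tr A + tr B"
  by (simp add: tr_def inner_add_right sum.distrib)

lemma tr_diff: "tr (\<lambda>h. A h - B h) = tr A - tr B"
  by (simp add: tr_def inner_diff_right sum_subtractf)

lemma tr_scale: "tr (\<lambda>h. c *\<^sub>R A h) = c * tr A"
  by (simp add: tr_def sum_distrib_left)

lemma tr_rank_one: "tr (\<lambda>h::'a::euclidean_space. (a \<bullet> h) *\<^sub>R b) = a \<bullet> b"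
proof -
  have "tr (\<lambda>h. (a \<bullet> h) *\<^sub>R b) = (\<Sum>i\<in>Basis. (a \<bullet> i) * (b \<bullet> i))"
    by (simp add: tr_def inner_commute)
  also have "\<dots> = a \<bullet> b"
    by (rule euclidean_inner[symmetric])
  finally show ?thesis .
qed

lemma tr_id: "tr (\<lambda>h::'a::euclidean_space. h) = DIM('a)"
  by (simp add: tr_def)

lemma p_op_diff: "p_op p \<xi> (\<lambda>h. A h - B h) = p_op p \<xi> A - p_op p \<xi> B"
  by (simp add: p_op_def tr_diff inner_diff_right algebra_simps)

lemma p_op_add: "p_op p \<xi> (\<lambda>h. A h + B h) = p_op p \<xi> A + p_op p \<xi> B"
  by (simp add: p_op_def tr_add inner_add_right algebra_simps)

lemma p_op_scale: "p_op p \<xi> (\<lambda>h. c *\<^sub>R A h) = c * p_op p \<xi> A"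
  by (simp add: p_op_def tr_scale algebra_simps)

lemma p_op_scale_vector: "linear A \<Longrightarrow> p_op p (c *\<^sub>R \<xi>) A = c^2 * p_op p \<xi> A"
  by (simp add: p_op_def linear_scale power2_eq_square algebra_simps)

text \<open>For \<open>p < 2\<close> the two terms of \<open>p_op\<close> have opposite signs, so the trace is split: the part
  \<open>(p - 1) (\<xi> \<cdot> A \<xi>)\<close> along \<open>\<xi>\<close>, and \<open>|\<xi>|\<^sup>2\<close> times the trace of \<open>A\<close> compressed to the orthogonal complement of
  \<open>\<xi>\<close>. Both are nonpositive when \<open>A\<close> is negative semidefinite. \<open>P\<close> is the projection to the complement.\<close>

lemma p_op_nonpos:
  assumes A: "linear A" and neg: "\<And>h. h \<bullet> A h \<le> 0" and p: "p > 1"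
  shows "p_op p \<xi> A \<le> 0"
proof (cases "\<xi> = 0")
  case True then show ?thesis by (simp add: p_op_def)
next
  case False
  define P where "P = (\<lambda>i. i - ((\<xi> \<bullet> i) / (\<xi> \<bullet> \<xi>)) *\<^sub>R \<xi>)"
  have nz: "\<xi> \<bullet> \<xi> > 0" using False by simp
  have e: "P i \<bullet> A (P i) = i \<bullet> A i - ((\<xi> \<bullet> i) * (A \<xi> \<bullet> i)) / (\<xi> \<bullet> \<xi>)
      - ((\<xi> \<bullet> i) * (\<xi> \<bullet> A i)) / (\<xi> \<bullet> \<xi>) + (\<xi> \<bullet> i) * (\<xi> \<bullet> i) * ((\<xi> \<bullet> A \<xi>) / (\<xi> \<bullet> \<xi>)^2)" for i
  proof -
    define c where "c = (\<xi> \<bullet> i) / (\<xi> \<bullet> \<xi>)"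
    have "P i \<bullet> A (P i) = (i - c *\<^sub>R \<xi>) \<bullet> (A i - c *\<^sub>R A \<xi>)"
      by (simp add: P_def c_def linear_diff[OF A] linear_scale[OF A])
    also have "\<dots> = i \<bullet> A i - c * (A \<xi> \<bullet> i) - c * (\<xi> \<bullet> A i) + c * c * (\<xi> \<bullet> A \<xi>)"
      by (simp add: inner_diff_left inner_diff_right inner_commute[of _ "A \<xi>"] algebra_simps)
    finally show ?thesis
      by (simp add: c_def power2_eq_square)
  qed
  have s1: "(\<Sum>i\<in>Basis. (\<xi> \<bullet> i) * (v \<bullet> i)) = \<xi> \<bullet> v" for v
    by (rule euclidean_inner[symmetric])
  have s2: "(\<Sum>i\<in>Basis. (\<xi> \<bullet> i) * (\<xi> \<bullet> A i)) = \<xi> \<bullet> A \<xi>"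
  proof -
    have "A \<xi> = A (\<Sum>i\<in>Basis. (\<xi> \<bullet> i) *\<^sub>R i)"
      by (simp add: euclidean_representation)
    also have "\<dots> = (\<Sum>i\<in>Basis. (\<xi> \<bullet> i) *\<^sub>R A i)"
      using A by (simp add: linear_sum linear_scale)
    finally show ?thesis
      by (simp add: inner_sum_right)
  qed
  have "(\<Sum>i\<in>Basis. P i \<bullet> A (P i)) = tr A - (\<xi> \<bullet> A \<xi>) / (\<xi> \<bullet> \<xi>)
      - (\<xi> \<bullet> A \<xi>) / (\<xi> \<bullet> \<xi>) + (\<xi> \<bullet> \<xi>) * ((\<xi> \<bullet> A \<xi>) / (\<xi> \<bullet> \<xi>)^2)"
    by (simp add: e sum.distrib sum_subtractf tr_def flip: sum_divide_distrib sum_distrib_right)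
      (simp add: s1 s2)
  also have "\<dots> = tr A - (\<xi> \<bullet> A \<xi>) / (\<xi> \<bullet> \<xi>)"
    using nz by (simp add: power2_eq_square)
  finally have "tr A - (\<xi> \<bullet> A \<xi>) / (\<xi> \<bullet> \<xi>) \<le> 0"
    using sum_nonpos[of Basis "\<lambda>i. P i \<bullet> A (P i)"] neg by simp
  then have 1: "(\<xi> \<bullet> \<xi>) * tr A - \<xi> \<bullet> A \<xi> \<le> 0"
    using nz by (simp add: field_simps)
  have "(p - 1) * (\<xi> \<bullet> A \<xi>) \<le> 0"
    using p neg by (intro mult_nonneg_nonpos) auto
  with 1 show ?thesis
    by (simp add: p_op_def algebra_simps)
qed

section \<open>Integration by parts against the dilation-invariant measure\<close>

lemma integrable_compact_support:
  fixes f :: "'a::euclidean_space \<Rightarrow> real"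
  assumes "continuous_on UNIV f" "compact K" "\<And>x. x \<notin> K \<Longrightarrow> f x = 0"
  shows "integrable lborel f"
proof -
  have "integrable lborel (\<lambda>x. indicator K x *\<^sub>R f x)"
    using assms by (intro borel_integrable_compact) (auto intro: continuous_on_subset)
  moreover have "(\<lambda>x. indicator K x *\<^sub>R f x) = f"
    using assms by (auto simp: indicator_def fun_eq_iff)
  ultimately show ?thesis by simp
qed

text \<open>The difference quotients of \<open>f\<close> have integral \<open>0\<close> by translation invariance, and they converge to the
  derivative dominatedly, being bounded and supported in the compact set swept out by moving the
  support of \<open>f\<close> by at most \<open>e\<close>.\<close>

lemma integral_derivative_zero:
  fixes f :: "'a::euclidean_space \<Rightarrow> real"
  assumes d: "\<And>x. (f has_derivative f' x) (at x)" and c: "continuous_on UNIV (\<lambda>x. f' x e)"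
    and K: "compact K" and z: "\<And>x. x \<notin> K \<Longrightarrow> f x = 0"
  shows "integral\<^sup>L lborel (\<lambda>x. f' x e) = 0"
proof -
  have fc: "continuous_on UNIV f"
    using d by (auto intro: has_derivative_continuous_on)
  have z': "f' x e = 0" if "x \<notin> K" for x
  proof -
    have "(f has_derivative (\<lambda>h. 0)) (at x)"
      by (rule has_derivative_transform_within_open[of "\<lambda>x. 0" _ x UNIV "- K"])
        (use that K z in \<open>auto intro: compact_imp_closed\<close>)
    then have "f' x = (\<lambda>h. 0)"
      using d has_derivative_unique by blast
    then show ?thesis by simp
  qed
  have "bounded ((\<lambda>x. f' x e) ` K)"
    using c K by (intro compact_imp_bounded compact_continuous_image) (auto intro: continuous_on_subset)
  then obtain B where B: "B > 0" "\<And>x. x \<in> K \<Longrightarrow> \<bar>f' x e\<bar> \<le> B"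
    unfolding bounded_pos by auto
  have B': "\<bar>f' x e\<bar> \<le> B" for x
    using B z'[of x] by (cases "x \<in> K") auto
  define K' where "K' = (\<lambda>(x, t). x - t *\<^sub>R e) ` (K \<times> {0..1})"
  have "compact K'"
    unfolding K'_def using K
    by (intro compact_continuous_image compact_Times continuous_intros)
      (auto simp: case_prod_unfold intro!: continuous_intros)
  define \<delta> where "\<delta> = (\<lambda>n. 1 / real (Suc n))"
  have \<delta>: "0 < \<delta> n" "\<delta> n \<le> 1" for n
    by (auto simp: \<delta>_def)
  define s where "s = (\<lambda>n x. (f (x + \<delta> n *\<^sub>R e) - f x) / \<delta> n)"
  have line: "((\<lambda>t. f (x + t *\<^sub>R e)) has_real_derivative f' (x + t *\<^sub>R e) e) (at t)" for x t
  proof -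
    have l: "((\<lambda>t. x + t *\<^sub>R e) has_derivative (\<lambda>s. s *\<^sub>R e)) (at t)"
      by (auto intro!: derivative_eq_intros)
    have "linear (f' (x + t *\<^sub>R e))" using d has_derivative_linear by blast
    then show ?thesis
      using has_derivative_compose[OF l d]
      by (simp add: has_field_derivative_def linear_scale mult.commute[of _ "f' (x + t *\<^sub>R e) e"])
  qed
  have sb: "\<bar>s n x\<bar> \<le> B" for n x
  proof -
    obtain t where "f (x + \<delta> n *\<^sub>R e) - f (x + 0 *\<^sub>R e) = (\<delta> n - 0) * f' (x + t *\<^sub>R e) e"
      using MVT2[OF \<delta>(1)[of n], of "\<lambda>t. f (x + t *\<^sub>R e)" "\<lambda>t. f' (x + t *\<^sub>R e) e"] line by blast
    then have "s n x = f' (x + t *\<^sub>R e) e"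
      using \<delta>(1)[of n] by (simp add: s_def)
    then show ?thesis using B' by simp
  qed
  have s0: "s n x = 0" if "x \<notin> K'" for n x
  proof -
    have "x + t *\<^sub>R e \<notin> K" if "t \<in> {0..1}" for t
      using \<open>x \<notin> K'\<close> that unfolding K'_def by (force simp: image_iff)
    from this[of 0] this[of "\<delta> n"] show ?thesis
      using \<delta>[of n] z by (simp add: s_def)
  qed
  have fi: "integrable lborel f"
    using integrable_compact_support[OF fc K z] .
  have tr: "distr lborel borel ((+) c) = (lborel :: 'a measure)" for c
    using lborel_distr_plus[of c] by simp
  have fm: "f \<in> borel_measurable borel"
    using fc borel_measurable_continuous_onI by blast
  have fi': "integrable lborel (\<lambda>x. f (x + c))" for c
    using fi integrable_distr[of "(+) c" lborel borel f] tr[of c] by (simp add: add.commute)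
  have ft: "integral\<^sup>L lborel (\<lambda>x. f (x + c)) = integral\<^sup>L lborel f" for c
    using integral_distr[of "(+) c" lborel borel f] fm tr[of c] by (simp add: add.commute)
  have int0: "integral\<^sup>L lborel (s n) = 0" for n
    unfolding s_def using fi fi' ft by (simp add: Bochner_Integration.integral_diff)
  have "(\<lambda>n. integral\<^sup>L lborel (s n)) \<longlonglongrightarrow> integral\<^sup>L lborel (\<lambda>x. f' x e)"
  proof (rule integral_dominated_convergence[where w = "\<lambda>x. indicator K' x *\<^sub>R B"])
    show "(\<lambda>x. f' x e) \<in> borel_measurable lborel"
      using c borel_measurable_continuous_onI by simp
    show "s n \<in> borel_measurable lborel" for n
      using fi' fi unfolding s_def
      by (intro borel_measurable_integrable Bochner_Integration.integrable_divide Bochner_Integration.integrable_diff)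
    show "integrable lborel (\<lambda>x. indicator K' x *\<^sub>R B)"
      using \<open>compact K'\<close> by (intro borel_integrable_compact) auto
    show "AE x in lborel. norm (s n x) \<le> indicator K' x *\<^sub>R B" for n
      using sb s0 by (auto simp: indicator_def)
    have "(\<lambda>n. s n x) \<longlonglongrightarrow> f' x e" for x
    proof -
      have "((\<lambda>h. (f (x + (0 + h) *\<^sub>R e) - f (x + 0 *\<^sub>R e)) / h) \<longlongrightarrow> f' (x + 0 *\<^sub>R e) e) (at 0)"
        using line[of x 0] unfolding DERIV_def .
      moreover have "filterlim \<delta> (at 0) sequentially"
        unfolding filterlim_at \<delta>_def using LIMSEQ_Suc[OF lim_1_over_n] by simp
      ultimately show ?thesis
        unfolding s_def using filterlim_compose by fastforce
    qed
    then show "AE x in lborel. (\<lambda>n. s n x) \<longlonglongrightarrow> f' x e" by simp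
  qed
  then show ?thesis
    unfolding int0 LIMSEQ_const_iff by simp
qed

definition C1_data :: "'a::euclidean_space set \<Rightarrow> ('a \<Rightarrow> 'b::real_normed_vector) \<Rightarrow> ('a \<Rightarrow> 'a \<Rightarrow> 'b) \<Rightarrow> bool"
  where "C1_data S f f' \<longleftrightarrow> (\<forall>x\<in>S. (f has_derivative f' x) (at x)) \<and> (\<forall>h. continuous_on S (\<lambda>x. f' x h))"

lemma C1_data_cont: "C1_data S f f' \<Longrightarrow> continuous_on S f"
  unfolding C1_data_def by (blast intro: has_derivative_continuous_on has_derivative_at_withinI)

lemma C1_data_add: "C1_data S f f' \<Longrightarrow> C1_data S k k' \<Longrightarrow> C1_data S (\<lambda>x. f x + k x) (\<lambda>x h. f' x h + k' x h)"
  unfolding C1_data_def by (auto intro!: has_derivative_add continuous_intros)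

lemma C1_data_diff: "C1_data S f f' \<Longrightarrow> C1_data S k k' \<Longrightarrow> C1_data S (\<lambda>x. f x - k x) (\<lambda>x h. f' x h - k' x h)"
  unfolding C1_data_def by (auto intro!: has_derivative_diff continuous_intros)

lemma C1_data_scaleR:
  assumes "C1_data S f f'" "C1_data S k k'"
  shows "C1_data S (\<lambda>x. f x *\<^sub>R k x) (\<lambda>x h. f x *\<^sub>R k' x h + f' x h *\<^sub>R k x)"
  using assms C1_data_cont[OF assms(1)] C1_data_cont[OF assms(2)]
  unfolding C1_data_def by (auto intro!: has_derivative_scaleR continuous_intros)

lemma C1_data_mult:
  fixes f k :: "'a::euclidean_space \<Rightarrow> real"
  assumes "C1_data S f f'" "C1_data S k k'"
  shows "C1_data S (\<lambda>x. f x * k x) (\<lambda>x h. f x * k' x h + f' x h * k x)"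
  using C1_data_scaleR[OF assms] by simp

lemma C1_data_inner:
  assumes "C1_data S f f'" "C1_data S k k'"
  shows "C1_data S (\<lambda>x. f x \<bullet> k x) (\<lambda>x h. f x \<bullet> k' x h + f' x h \<bullet> k x)"
  using assms C1_data_cont[OF assms(1)] C1_data_cont[OF assms(2)]
  unfolding C1_data_def by (auto intro!: has_derivative_inner continuous_intros)

lemma C1_data_const: "C1_data S (\<lambda>x. c) (\<lambda>x h. 0)"
  unfolding C1_data_def by auto

lemma C1_data_id: "C1_data S (\<lambda>x. x) (\<lambda>x h. h)"
  unfolding C1_data_def by auto

lemma C1_data_C2_data:
  assumes "C2_data S f g H"
  shows "C1_data S f (\<lambda>x h. g x \<bullet> h)" "C1_data S g H"
  using assms C2_data_cont[OF assms]
  unfolding C2_data_def C1_data_def by (auto intro!: continuous_intros)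

lemma divergence_integral_zero:
  fixes F :: "'a::euclidean_space \<Rightarrow> 'a"
  assumes U: "open U" and K: "compact K" "K \<subseteq> U" and F: "C1_data U F F'"
    and z: "\<And>x. x \<in> U - K \<Longrightarrow> F x = 0"
  shows "(LINT x:K|lborel. tr (F' x)) = 0"
proof -
  have nK: "open (- K)" using K by (simp add: compact_imp_closed open_Compl)
  define F0 where "F0 = (\<lambda>x. if x \<in> K then F x else 0)"
  define F0' where "F0' = (\<lambda>x h. if x \<in> K then F' x h else 0)"
  have dU: "(F has_derivative F' x) (at x)" if "x \<in> U" for x
    using F that unfolding C1_data_def by blast
  have z': "F' x h = 0" if "x \<in> U - K" for x h
  proof -
    have "(F has_derivative (\<lambda>h. 0)) (at x)"
      by (rule has_derivative_transform_within_open[of "\<lambda>x. 0" _ x UNIV "U - K"])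
        (use that U K z in \<open>auto intro: compact_imp_closed\<close>)
    then have "F' x = (\<lambda>h. 0)"
      using dU that has_derivative_unique by blast
    then show ?thesis by simp
  qed
  have d0: "(F0 has_derivative F0' x) (at x)" for x
  proof (cases "x \<in> K")
    case True
    then have "F0' x = F' x" by (simp add: F0'_def)
    then show ?thesis
      using has_derivative_transform_within_open[OF dU U, of x F0] True K z
      by (auto simp: F0_def)
  next
    case False
    then have "F0' x = (\<lambda>h. 0)" by (simp add: F0'_def)
    moreover have "(F0 has_derivative (\<lambda>h. 0)) (at x)"
      by (rule has_derivative_transform_within_open[of "\<lambda>x. 0" _ x UNIV "- K"])
        (use nK False in \<open>auto simp: F0_def\<close>)
    ultimately show ?thesis by simp
  qed
  have c0: "continuous_on UNIV (\<lambda>x. F0' x h)" for h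
  proof -
    have "continuous_on U (\<lambda>x. F0' x h)"
      by (subst continuous_on_cong[of U U _ "\<lambda>x. F' x h"])
        (use F z' in \<open>auto simp: F0'_def C1_data_def\<close>)
    moreover have "continuous_on (- K) (\<lambda>x. F0' x h)"
      by (subst continuous_on_cong[of "- K" "- K" _ "\<lambda>x. 0"]) (auto simp: F0'_def)
    ultimately have "continuous_on (U \<union> - K) (\<lambda>x. F0' x h)"
      using U nK continuous_on_open_Un by blast
    moreover have "U \<union> - K = UNIV" using K by auto
    ultimately show ?thesis by simp
  qed
  have c1: "continuous_on UNIV (\<lambda>x. i \<bullet> F0' x i)" for i
    by (intro continuous_intros c0)
  have int: "integrable lborel (\<lambda>x. i \<bullet> F0' x i)" for i
    by (rule integrable_compact_support[OF c1 K(1)]) (simp add: F0'_def)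
  have zero: "integral\<^sup>L lborel (\<lambda>x. i \<bullet> F0' x i) = 0" for i
    by (rule integral_derivative_zero[of "\<lambda>x. i \<bullet> F0 x" "\<lambda>x h. i \<bullet> F0' x h",
          OF has_derivative_inner_right[OF d0] c1 K(1)]) (simp add: F0_def)
  have "integral\<^sup>L lborel (\<lambda>x. tr (F0' x)) = 0"
    unfolding tr_def using int zero by (simp add: Bochner_Integration.integral_sum)
  moreover have "(\<lambda>x. tr (F0' x)) = (\<lambda>x. indicator K x *\<^sub>R tr (F' x))"
    by (auto simp: F0'_def tr_def indicator_def)
  ultimately show ?thesis
    by (simp add: set_lebesgue_integral_def)
qed

lemma set_integral_eq_cong:
  fixes f :: "'a \<Rightarrow> real"
  assumes "(LINT x:K|M. f x) = c" "\<And>x. x \<in> K \<Longrightarrow> f x = k x"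
  shows "(LINT x:K|M. k x) = c"
proof -
  have "(\<lambda>x. indicator K x *\<^sub>R f x) = (\<lambda>x. indicator K x *\<^sub>R k x)"
    using assms(2) by (auto simp: indicator_def)
  then show ?thesis
    using assms(1) by (simp add: set_lebesgue_integral_def)
qed

lemma tr_linear_rank_one:
  fixes b :: "'a::euclidean_space"
  assumes "linear L" shows "tr (\<lambda>h. L h *\<^sub>R b) = L b"
proof -
  have "tr (\<lambda>h. L h *\<^sub>R b) = (\<Sum>i\<in>Basis. (b \<bullet> i) * L i)"
    by (simp add: tr_def inner_commute mult.commute)
  also have "\<dots> = L (\<Sum>i\<in>Basis. (b \<bullet> i) *\<^sub>R i)"
    using assms by (simp add: linear_sum linear_scale)
  finally show ?thesis by (simp add: euclidean_representation)
qed

text \<open>The measure \<open>|x|\<^sup>-\<^sup>n dx\<close> is invariant under dilations: it is the product measure on the cylinder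
  with coordinates \<open>ln |x|\<close> and \<open>x / |x|\<close>, and \<open>x \<cdot> \<nabla>\<close> is skew-adjoint for it.\<close>

definition inv_vol :: "'a::euclidean_space \<Rightarrow> real" where
  "inv_vol x = (x \<bullet> x) powr (- real DIM('a) / 2)"

lemma inv_vol_pos: "x \<noteq> 0 \<Longrightarrow> inv_vol x > 0"
  by (simp add: inv_vol_def)

lemma C1_data_inv_vol:
  assumes "0 \<notin> U"
  shows "C1_data U (inv_vol :: 'a \<Rightarrow> real) (\<lambda>(x::'a::euclidean_space) h. - real DIM('a) * inv_vol x * ((x \<bullet> h) / (x \<bullet> x)))"
  unfolding C1_data_def
proof (intro conjI ballI allI)
  have nz: "x \<noteq> 0" if "x \<in> U" for x using assms that by auto
  fix x assume "x \<in> U"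
  then have p: "x \<bullet> x > 0" using nz by simp
  have d: "((\<lambda>x. x \<bullet> x) has_derivative (\<lambda>h. 2 * (x \<bullet> h))) (at x)"
    by (auto intro!: derivative_eq_intros simp: inner_commute)
  have e: "(x \<bullet> x) powr (- real DIM('a) / 2 - 1) = (x \<bullet> x) powr (- real DIM('a) / 2) / (x \<bullet> x)"
    using p by (simp add: powr_diff)
  have "((\<lambda>t. t powr (- real DIM('a) / 2)) has_real_derivative
      (- real DIM('a) / 2) * (x \<bullet> x) powr (- real DIM('a) / 2 - 1)) (at (x \<bullet> x))"
    by (rule has_real_derivative_powr[OF p])
  from has_derivative_compose[OF d this[unfolded has_field_derivative_def]]
  show "(inv_vol has_derivative (\<lambda>h. - real DIM('a) * inv_vol x * ((x \<bullet> h) / (x \<bullet> x)))) (at x)"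
    unfolding inv_vol_def e by (simp add: field_simps)
next
  have nz: "x \<noteq> 0" if "x \<in> U" for x using assms that by auto
  fix h
  show "continuous_on U (\<lambda>x::'a. - real DIM('a) * inv_vol x * ((x \<bullet> h) / (x \<bullet> x)))"
    unfolding inv_vol_def by (intro continuous_intros) (use nz in auto)
qed

text \<open>The divergence theorem for the field \<open>|x|\<^sup>-\<^sup>n (s x + |x|\<^sup>2 m G)\<close>. These two kinds of fields account for all
  the integrations by parts in the Carleman estimate.\<close>

lemma radial_gradient_integral:
  fixes s m :: "'a::euclidean_space \<Rightarrow> real"
  assumes U: "open U" "0 \<notin> U" and K: "compact K" "K \<subseteq> U"
    and s: "C1_data U s s'" and m: "C1_data U m m'" and G: "C1_data U G H"
    and z: "\<And>x. x \<in> U - K \<Longrightarrow> s x = 0" "\<And>x. x \<in> U - K \<Longrightarrow> G x = 0"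
  shows "(LINT x:K|lborel. inv_vol x * (s' x x +
    (m x * ((x \<bullet> x) * tr (H x) - (real DIM('a) - 2) * (x \<bullet> G x)) + (x \<bullet> x) * m' x (G x)))) = 0"
proof -
  note F1 = C1_data_scaleR[OF C1_data_mult[OF C1_data_inv_vol[OF U(2)] s] C1_data_id]
  note F2 = C1_data_scaleR[OF C1_data_mult[OF C1_data_mult[OF C1_data_inv_vol[OF U(2)]
    C1_data_inner[OF C1_data_id C1_data_id]] m] G]
  let ?T1 = "\<lambda>x h. (inv_vol x * s x) *\<^sub>R h + (inv_vol x * s' x h +
      - real DIM('a) * inv_vol x * ((x \<bullet> h) / (x \<bullet> x)) * s x) *\<^sub>R x"
  let ?T2 = "\<lambda>x h. (inv_vol x * (x \<bullet> x) * m x) *\<^sub>R H x h + (inv_vol x * (x \<bullet> x) * m' x h +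
      (inv_vol x * (x \<bullet> h + h \<bullet> x) +
      - real DIM('a) * inv_vol x * ((x \<bullet> h) / (x \<bullet> x)) * (x \<bullet> x)) * m x) *\<^sub>R G x"
  have "(LINT x:K|lborel. tr (\<lambda>h. ?T1 x h + ?T2 x h)) = 0"
    by (rule divergence_integral_zero[OF U(1) K C1_data_add[OF F1 F2]]) (use z in auto)
  moreover have "tr (\<lambda>h. ?T1 x h + ?T2 x h) = inv_vol x * (s' x x +
    (m x * ((x \<bullet> x) * tr (H x) - (real DIM('a) - 2) * (x \<bullet> G x)) + (x \<bullet> x) * m' x (G x)))"
    if "x \<in> K" for x
  proof -
    have x: "x \<in> U" "x \<noteq> 0" using that K U by auto
    have l: "linear (s' x)" "linear (m' x)"
      using s m x unfolding C1_data_def by (blast intro: has_derivative_linear)+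
    have l1: "linear (\<lambda>h. inv_vol x * s' x h +
      - real DIM('a) * inv_vol x * ((x \<bullet> h) / (x \<bullet> x)) * s x)"
      using l by (auto intro!: linearI simp: linear_add linear_scale inner_add_right algebra_simps add_divide_distrib)
    have t1: "tr (?T1 x) = inv_vol x * s' x x"
      unfolding tr_add tr_scale tr_id tr_linear_rank_one[OF l1] using x by simp
    have l2: "linear (\<lambda>h. inv_vol x * (x \<bullet> x) * m' x h +
      (inv_vol x * (x \<bullet> h + h \<bullet> x) +
      - real DIM('a) * inv_vol x * ((x \<bullet> h) / (x \<bullet> x)) * (x \<bullet> x)) * m x)"
      using l x by (auto intro!: linearI simp: linear_add linear_scale inner_add_right inner_add_left algebra_simps)
    have t2: "tr (?T2 x) = inv_vol x *
      (m x * ((x \<bullet> x) * tr (H x) - (real DIM('a) - 2) * (x \<bullet> G x)) + (x \<bullet> x) * m' x (G x))"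
      unfolding tr_add tr_scale tr_linear_rank_one[OF l2] using x
      by (simp add: algebra_simps inner_commute)
    have "tr (\<lambda>h. ?T1 x h + ?T2 x h) = tr (?T1 x) + tr (?T2 x)"
      by (rule tr_add)
    also note arg_cong2[where f = "(+)", OF t1 t2]
    also note distrib_left[symmetric]
    finally show ?thesis .
  qed
  ultimately show ?thesis
    by (rule set_integral_eq_cong)
qed

lemma C1_data_log_norm:
  assumes "0 \<notin> U"
  shows "C1_data U (\<lambda>x::'a::euclidean_space. ln (x \<bullet> x) / 2 - y0) (\<lambda>x h. (x \<bullet> h) / (x \<bullet> x))"
  unfolding C1_data_def
proof (intro conjI ballI allI)
  fix x assume "x \<in> U"
  then have p: "x \<bullet> x > 0" using assms by (metis inner_gt_zero_iff)
  have d: "((\<lambda>x. x \<bullet> x) has_derivative (\<lambda>h. 2 * (x \<bullet> h))) (at x)"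
    by (auto intro!: derivative_eq_intros simp: inner_commute)
  have "((\<lambda>t. ln t / 2 - y0) has_real_derivative 1 / (x \<bullet> x) / 2) (at (x \<bullet> x))"
    using p by (auto intro!: derivative_eq_intros)
  from has_derivative_compose[OF d this[unfolded has_field_derivative_def]]
  show "((\<lambda>x. ln (x \<bullet> x) / 2 - y0) has_derivative (\<lambda>h. (x \<bullet> h) / (x \<bullet> x))) (at x)"
    by simp
next
  fix h
  have "x \<bullet> x \<noteq> 0" if "x \<in> U" for x using assms that by auto
  then show "continuous_on U (\<lambda>x::'a. (x \<bullet> h) / (x \<bullet> x))"
    by (intro continuous_intros) auto
qed

section \<open>A Carleman estimate with a radial weight\<close>

lemma C2_data_zero:
  assumes D: "C2_data U g G H" and K: "closed K" and z: "\<And>x. x \<in> U - K \<Longrightarrow> g x = 0"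
    and x: "x \<in> U - K"
  shows "G x = 0" "H x h = 0"
proof -
  have o: "open (U - K)" using C2_data_open[OF D] K by auto
  have G0: "G y = 0" if "y \<in> U - K" for y
  proof -
    have "(g has_derivative (\<lambda>h. 0)) (at y)"
      by (rule has_derivative_transform_within_open[of "\<lambda>x. 0" _ y UNIV "U - K"])
        (use that o z in auto)
    then have "(\<lambda>h. G y \<bullet> h) = (\<lambda>h. 0)"
      using C2_dataD(1)[OF D] that has_derivative_unique by blast
    then have "G y \<bullet> G y = 0" by meson
    then show ?thesis by simp
  qed
  then show "G x = 0" using x by blast
  have "(G has_derivative (\<lambda>h. 0)) (at x)"
    by (rule has_derivative_transform_within_open[of "\<lambda>x. 0" _ x UNIV "U - K"])
      (use x o G0 in auto)
  then have "H x = (\<lambda>h. 0)"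
    using C2_dataD(2)[OF D] x has_derivative_unique by blast
  then show "H x h = 0" by simp
qed

lemma C2_data_cont_tr:
  assumes "C2_data S f g H"
  shows "continuous_on S (\<lambda>x. tr (H x))"
  unfolding tr_def by (intro continuous_intros C2_data_cont[OF assms])

lemma set_integrable_compact:
  fixes f :: "'a::euclidean_space \<Rightarrow> real"
  assumes "compact K" "continuous_on K f"
  shows "set_integrable lborel K f"
  using borel_integrable_compact[OF assms] by (simp add: set_integrable_def)

text \<open>In the coordinates \<open>y = ln |x|\<close> and \<open>x / |x|\<close> this is \<open>q \<partial>\<^sub>y\<^sup>2\<close> plus the Laplacian of the unit sphere, applied
  to a function with gradient \<open>\<xi>\<close> and Hessian \<open>A\<close> at \<open>x\<close>.\<close>

definition cyl_op :: "real \<Rightarrow> 'a::euclidean_space \<Rightarrow> 'a \<Rightarrow> ('a \<Rightarrow> 'a) \<Rightarrow> real" where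
  "cyl_op q x \<xi> A = q * (x \<bullet> A x + x \<bullet> \<xi>)
     + ((x \<bullet> x) * tr A - x \<bullet> A x - (real DIM('a) - 1) * (x \<bullet> \<xi>))"

text \<open>In the application \<open>a\<close> and \<open>b\<close> are the first and second \<open>y\<close>-derivatives of \<open>g\<close>, \<open>L\<close> is its spherical
  Laplacian, \<open>M\<close> the square of its spherical gradient, and \<open>Z1\<close>, \<open>Z2\<close>, \<open>Z3\<close> have integral \<open>0\<close>.
  Then \<open>S\<close> and \<open>- q \<tau> m\<close> are the symmetric and the skew part of the conjugated operator. \<open>Z1\<close> expresses
  the positivity of their commutator, which controls \<open>a\<close> and \<open>g\<close> but not \<open>M\<close>; \<open>Z2\<close>, obtained by
  testing \<open>S\<close> with \<open>g\<close>, trades part of this control for \<open>M\<close>.\<close>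

lemma carleman_pointwise:
  fixes q \<tau> \<psi> g a b M L :: real
  assumes "q > 0" "\<tau> \<ge> 4" "\<psi> \<ge> 1/2"
  defines "S \<equiv> q * b + L + q * \<tau>^2 * \<psi>^2 * g" and "m \<equiv> 2 * \<psi> * a + g"
  defines "Z1 \<equiv> S * m + 2 * q * a^2 + 2 * q * \<tau>^2 * \<psi>^2 * g^2"
    and "Z2 \<equiv> S * g + q * a^2 + M - q * \<tau>^2 * \<psi>^2 * g^2" and "Z3 \<equiv> m * g"
  shows "4 * q^2 * \<tau> * a^2 + 2 * q * \<tau> * M + q^2 * \<tau>^3 * \<psi>^2 * g^2
     \<le> 2 * (S - q * \<tau> * m)^2 + (2 * q * \<tau> * (Z1 + Z2) - 2 * q^2 * \<tau>^2 * Z3)"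
proof -
  have "1 \<le> \<tau> * \<psi>^2"
  proof -
    have "(1/2)^2 \<le> \<psi>^2" using assms by (intro power_mono) auto
    then have "4 * (1/2)^2 \<le> \<tau> * \<psi>^2" using assms by (intro mult_mono) auto
    then show ?thesis by (simp add: power2_eq_square)
  qed
  then have "(q * \<tau> * g)^2 * 1 \<le> (q * \<tau> * g)^2 * (\<tau> * \<psi>^2)"
    by (intro mult_left_mono) auto
  moreover have "(q * \<tau> * g)^2 * (\<tau> * \<psi>^2) = q^2 * \<tau>^3 * \<psi>^2 * g^2"
    by (simp add: power2_eq_square power3_eq_cube)
  moreover have "0 \<le> S^2 + (q * \<tau> * m)^2 + (S - q * \<tau> * m + q * \<tau> * g)^2"
    by simp
  moreover have "2 * (S - q * \<tau> * m)^2 + (2 * q * \<tau> * (Z1 + Z2) - 2 * q^2 * \<tau>^2 * Z3)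
     - (4 * q^2 * \<tau> * a^2 + 2 * q * \<tau> * M + q^2 * \<tau>^3 * \<psi>^2 * g^2)
    = (S^2 + (q * \<tau> * m)^2 + (S - q * \<tau> * m + q * \<tau> * g)^2) + q^2 * \<tau>^3 * \<psi>^2 * g^2 - (q * \<tau> * g)^2
      + 2 * q^2 * \<tau> * a^2"
    unfolding Z1_def Z2_def Z3_def by (simp add: power2_eq_square power3_eq_cube algebra_simps)
  moreover have "0 \<le> 2 * q^2 * \<tau> * a^2"
    using assms by simp
  ultimately show ?thesis by linarith
qed

text \<open>All integrations by parts are made at once: the fields \<open>s3\<close> and \<open>mm\<close> are chosen so that the
  divergence is the combination of \<open>Z1\<close>, \<open>Z2\<close>, \<open>Z3\<close> that occurs in \<open>carleman_pointwise\<close>. The symmetry of the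
  Hessian is what makes the terms with \<open>x \<cdot> D\<^sup>2g \<nabla>g\<close> cancel.\<close>

lemma carleman_conjugated:
  fixes g :: "'a::euclidean_space \<Rightarrow> real"
  assumes K: "compact K" "K \<subseteq> U" and U: "0 \<notin> U"
    and D: "C2_data U g G H" and z: "\<And>x. x \<in> U - K \<Longrightarrow> g x = 0"
    and q: "q > 0" and \<tau>: "\<tau> \<ge> 4" and psi: "\<And>x. x \<in> K \<Longrightarrow> \<psi> x \<ge> 1/2"
    and \<psi>_def: "\<psi> = (\<lambda>x. ln (x \<bullet> x) / 2 - y0)"
  shows "(LINT x:K|lborel. inv_vol x * (4 * q^2 * \<tau> * (x \<bullet> G x)^2
        + 2 * q * \<tau> * ((x \<bullet> x) * (G x \<bullet> G x) - (x \<bullet> G x)^2) + q^2 * \<tau>^3 * (\<psi> x)^2 * (g x)^2))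
     \<le> 2 * (LINT x:K|lborel. inv_vol x * (cyl_op q x (G x) (H x) + q * \<tau>^2 * (\<psi> x)^2 * g x
        - q * \<tau> * (2 * \<psi> x * (x \<bullet> G x) + g x))^2)"
proof -
  have oU: "open U" using C2_data_open[OF D] .
  have cK: "closed K" using K compact_imp_closed by blast
  note Gz = C2_data_zero[OF D cK z]
  note g1 = C1_data_C2_data(1)[OF D]
  note G1 = C1_data_C2_data(2)[OF D]
  have p1: "C1_data U \<psi> (\<lambda>x h. (x \<bullet> h) / (x \<bullet> x))"
    unfolding \<psi>_def by (rule C1_data_log_norm[OF U])
  note a1 = C1_data_inner[OF C1_data_id G1]
  note xx1 = C1_data_inner[OF C1_data_id C1_data_id, where S = U]
  note aa1 = C1_data_mult[OF a1 a1]
  note ga1 = C1_data_mult[OF g1 a1]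
  note gg1 = C1_data_mult[OF g1 g1]
  note M1 = C1_data_diff[OF C1_data_mult[OF xx1 C1_data_inner[OF G1 G1]] aa1]
  note pa1 = C1_data_mult[OF p1 a1]
  note m1 = C1_data_add[OF C1_data_mult[OF C1_data_const[of _ 2] pa1] g1]
  note ma1 = C1_data_mult[OF m1 a1]
  note pgg1 = C1_data_mult[OF p1 gg1]
  note p3 = C1_data_mult[OF C1_data_mult[OF p1 p1] pgg1]
  \<comment> \<open>\<open>s1 + s2\<close> is \<open>q \<psi> a\<^sup>2 + q \<tau>\<^sup>2 \<psi>\<^sup>3 g\<^sup>2 + (2 q - 1) g a - \<psi> M - (2 \<psi> a + g) a\<close>, the radial component for \<open>Z1 + Z2\<close>.\<close>
  note s1 = C1_data_add[OF C1_data_mult[OF C1_data_const[of _ q] C1_data_mult[OF p1 aa1]]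
     C1_data_mult[OF C1_data_const[of _ "q * \<tau>^2"] p3]]
  note s2 = C1_data_diff[OF C1_data_mult[OF C1_data_const[of _ "2 * q - 1"] ga1]
     C1_data_add[OF C1_data_mult[OF p1 M1] ma1]]
  note s3 = C1_data_diff[OF C1_data_mult[OF C1_data_const[of _ "2 * q * \<tau>"] C1_data_add[OF s1 s2]]
     C1_data_mult[OF C1_data_const[of _ "2 * q^2 * \<tau>^2"] pgg1]]
  note mm = C1_data_mult[OF C1_data_const[of _ "2 * q * \<tau>"] C1_data_add[OF m1 g1]]
  note int0 = radial_gradient_integral[OF oU U K s3 mm G1]
  define a where "a = (\<lambda>x. x \<bullet> G x)"
  define b where "b = (\<lambda>x. x \<bullet> H x x + x \<bullet> G x)"
  define L where "L = (\<lambda>x. (x \<bullet> x) * tr (H x) - x \<bullet> H x x - (real DIM('a) - 1) * (x \<bullet> G x))"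
  define M where "M = (\<lambda>x. (x \<bullet> x) * (G x \<bullet> G x) - (x \<bullet> G x)^2)"
  define S where "S = (\<lambda>x. q * b x + L x + q * \<tau>^2 * (\<psi> x)^2 * g x)"
  define m where "m = (\<lambda>x. 2 * \<psi> x * a x + g x)"
  define Z where "Z = (\<lambda>x. 2 * q * \<tau> * ((S x * m x + 2 * q * (a x)^2 + 2 * q * \<tau>^2 * (\<psi> x)^2 * (g x)^2)
      + (S x * g x + q * (a x)^2 + M x - q * \<tau>^2 * (\<psi> x)^2 * (g x)^2)) - 2 * q^2 * \<tau>^2 * (m x * g x))"
  have Z0: "(LINT x:K|lborel. inv_vol x * Z x) = 0"
  proof (rule set_integral_eq_cong[OF int0], goal_cases)
    case (3 x)
    then have xU: "x \<in> U" and x0: "x \<noteq> 0" "x \<bullet> x \<noteq> 0" using K U by auto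
    have sym: "x \<bullet> H x (G x) = G x \<bullet> H x x"
      using Hessian_symmetric[OF D xU] .
    have c: "H x x \<bullet> G x = G x \<bullet> H x x" "H x (G x) \<bullet> x = G x \<bullet> H x x" "G x \<bullet> x = x \<bullet> G x"
      using sym by (simp_all add: inner_commute)
    have d: "(x \<bullet> x) * ((x \<bullet> G x) / (x \<bullet> x)) = x \<bullet> G x"
      using x0 by simp
    show ?case
      apply (rule arg_cong[where f = "\<lambda>t. inv_vol x * t"])
      unfolding Z_def S_def m_def M_def L_def a_def b_def sym c
      using d x0
      by (simp add: field_simps power2_eq_square power3_eq_cube)
  qed (use z Gz in auto)
  have nz: "x \<noteq> 0" "x \<bullet> x \<noteq> 0" if "x \<in> K" for x using that K U by auto
  have cont: "continuous_on K g" "continuous_on K G" "continuous_on K (\<lambda>x. tr (H x))"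
    "continuous_on K (\<lambda>x. H x x)" "continuous_on K \<psi>" "continuous_on K inv_vol"
    using C2_data_cont[OF D] C2_data_cont_tr[OF D] K(2) C1_data_cont[OF p1]
      C1_data_cont[OF C1_data_inv_vol[OF U]]
      C2_data_cont_Hess[OF D continuous_on_id K(2)]
    by (auto intro: continuous_on_subset)
  have ca: "continuous_on K a" "continuous_on K b" "continuous_on K L" "continuous_on K M"
    unfolding a_def b_def L_def M_def by (intro continuous_intros cont)+
  have cS: "continuous_on K S" "continuous_on K m"
    unfolding S_def m_def by (intro continuous_intros cont ca)+
  have cZ: "continuous_on K Z"
    unfolding Z_def by (intro continuous_intros cont ca cS)
  define f where "f = (\<lambda>x. S x - q * \<tau> * m x)"
  have cf: "continuous_on K f"
    unfolding f_def by (intro continuous_intros cS)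
  define E where "E = (\<lambda>x. 4 * q^2 * \<tau> * (a x)^2 + 2 * q * \<tau> * M x + q^2 * \<tau>^3 * (\<psi> x)^2 * (g x)^2)"
  have cE: "continuous_on K E"
    unfolding E_def by (intro continuous_intros ca cont)
  have iE: "set_integrable lborel K (\<lambda>x. inv_vol x * E x)"
    and if2: "set_integrable lborel K (\<lambda>x. inv_vol x * (f x)^2)"
    and iZ: "set_integrable lborel K (\<lambda>x. inv_vol x * Z x)"
    by (intro set_integrable_compact K continuous_intros cont cE cf cZ)+
  have "(LINT x:K|lborel. inv_vol x * E x)
      \<le> (LINT x:K|lborel. 2 * (inv_vol x * (f x)^2) + inv_vol x * Z x)"
  proof (rule set_integral_mono[OF iE])
    show "set_integrable lborel K (\<lambda>x. 2 * (inv_vol x * (f x)^2) + inv_vol x * Z x)"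
      by (intro set_integral_add iZ set_integrable_mult_right if2)
    fix x assume x: "x \<in> K"
    have "E x \<le> 2 * (f x)^2 + Z x"
      using carleman_pointwise[OF q \<tau> psi[OF x], of "a x" "M x" "g x" "b x" "L x"]
      unfolding E_def f_def Z_def S_def m_def .
    then have "inv_vol x * E x \<le> inv_vol x * (2 * (f x)^2 + Z x)"
      using inv_vol_pos[OF nz(1)[OF x]] by (intro mult_left_mono) auto
    then show "inv_vol x * E x \<le> 2 * (inv_vol x * (f x)^2) + inv_vol x * Z x"
      by (simp add: algebra_simps)
  qed
  also have "\<dots> = 2 * (LINT x:K|lborel. inv_vol x * (f x)^2)"
    using set_integral_add(2)[OF set_integrable_mult_right[OF if2, of 2] iZ] Z0 by simp
  finally show ?thesis
    unfolding E_def f_def S_def m_def L_def M_def a_def b_def cyl_op_def .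
qed

text \<open>The weight is \<open>exp (\<tau> \<phi>)\<close> with \<open>\<phi> = \<psi>\<^sup>2 / 2\<close> and \<open>\<psi> = ln |x| - c\<close>. It has \<open>\<phi>' = \<psi>\<close> and \<open>\<phi>'' = 1\<close> in the
  variable \<open>ln |x|\<close>; the convexity of \<open>\<phi>\<close> is the source of the gain of the factor \<open>\<tau>\<close>.\<close>

lemma C2_data_carleman_weight:
  fixes \<tau> c :: real
  defines "\<psi> \<equiv> \<lambda>x::'a::euclidean_space. ln (x \<bullet> x) / 2 - c"
  defines "e \<equiv> \<lambda>x. exp (\<tau> * (\<psi> x)^2 / 2)"
  assumes U: "open U" "0 \<notin> U"
  shows "C2_data U e (\<lambda>x. (e x * (\<tau> * \<psi> x) / (x \<bullet> x)) *\<^sub>R x)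
    (\<lambda>x h. (e x * (\<tau>^2 * (\<psi> x)^2 + \<tau> - 2 * \<tau> * \<psi> x) / (x \<bullet> x)^2 * (x \<bullet> h)) *\<^sub>R x
       + (e x * (\<tau> * \<psi> x) / (x \<bullet> x)) *\<^sub>R h)"
proof -
  have nz: "x \<bullet> x > 0" if "x \<in> U" for x using that U by (metis inner_gt_zero_iff)
  define \<theta> where "\<theta> = (\<lambda>t::real. exp (\<tau> * (ln t / 2 - c)^2 / 2))"
  define \<theta>' where "\<theta>' = (\<lambda>t::real. exp (\<tau> * (ln t / 2 - c)^2 / 2) * (\<tau> * (ln t / 2 - c)) / (2 * t))"
  define \<theta>'' where "\<theta>'' = (\<lambda>t::real. exp (\<tau> * (ln t / 2 - c)^2 / 2) * (\<tau>^2 * (ln t / 2 - c)^2 + \<tau>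
         - 2 * \<tau> * (ln t / 2 - c)) / (4 * t^2))"
  have d1: "(\<theta> has_real_derivative \<theta>' t) (at t)" if "t > 0" for t
    unfolding \<theta>_def \<theta>'_def using that
    by (auto intro!: derivative_eq_intros simp: field_simps)
  have d2: "(\<theta>' has_real_derivative \<theta>'' t) (at t)" if "t > 0" for t
    unfolding \<theta>''_def \<theta>'_def using that
    by (auto intro!: derivative_eq_intros simp: field_simps power2_eq_square)
  have q: "C2_data U (\<lambda>x::'a. x \<bullet> x) (\<lambda>x. 2 *\<^sub>R x) (\<lambda>x h. 2 *\<^sub>R h)"
    using C2_data_norm_square[OF U(1), of 0] by simp
  have "C2_data U (\<lambda>x. \<theta> (x \<bullet> x)) (\<lambda>x. \<theta>' (x \<bullet> x) *\<^sub>R 2 *\<^sub>R x)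
     (\<lambda>x h. (\<theta>'' (x \<bullet> x) * (2 *\<^sub>R x \<bullet> h)) *\<^sub>R 2 *\<^sub>R x + \<theta>' (x \<bullet> x) *\<^sub>R 2 *\<^sub>R h)"
  proof (rule C2_data_comp[OF q])
    show "continuous_on ((\<lambda>x. x \<bullet> x) ` U) \<theta>''"
      unfolding \<theta>''_def using nz by (intro continuous_intros) (auto simp: less_imp_neq[symmetric])
  qed (use d1 d2 nz in auto)
  moreover have "\<theta>' t * 2 = exp (\<tau> * (ln t / 2 - c)^2 / 2) * (\<tau> * (ln t / 2 - c)) / t" for t
    by (simp only: \<theta>'_def) (simp del: left_diff_distrib_numeral right_diff_distrib_numeral)
  moreover have "\<theta>'' t * (2 * u) * 2 = exp (\<tau> * (ln t / 2 - c)^2 / 2) * (\<tau>^2 * (ln t / 2 - c)^2 + \<tau>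
         - 2 * \<tau> * (ln t / 2 - c)) / t^2 * u" for t u
    by (simp only: \<theta>''_def) (simp del: left_diff_distrib_numeral right_diff_distrib_numeral)
  ultimately show ?thesis
    unfolding e_def \<psi>_def by (simp only: scaleR_scaleR inner_scaleR_left) (simp only: \<theta>_def)
qed

lemma cyl_op_mult:
  assumes "linear Ae" "linear Aw"
  shows "cyl_op q x (e *\<^sub>R \<omega> + w *\<^sub>R \<xi>) (\<lambda>h. (\<xi> \<bullet> h) *\<^sub>R \<omega> + e *\<^sub>R Aw h + (\<omega> \<bullet> h) *\<^sub>R \<xi> + w *\<^sub>R Ae h)
    = e * cyl_op q x \<omega> Aw + w * cyl_op q x \<xi> Ae
      + 2 * ((x \<bullet> x) * (\<xi> \<bullet> \<omega>) + (q - 1) * (x \<bullet> \<xi>) * (x \<bullet> \<omega>))"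
proof -
  have t: "tr (\<lambda>h. (\<xi> \<bullet> h) *\<^sub>R \<omega> + e *\<^sub>R Aw h + (\<omega> \<bullet> h) *\<^sub>R \<xi> + w *\<^sub>R Ae h)
    = 2 * (\<xi> \<bullet> \<omega>) + e * tr Aw + w * tr Ae"
    by (simp add: tr_add tr_scale tr_rank_one inner_commute[of \<omega> \<xi>])
  show ?thesis
    unfolding cyl_op_def t by (simp add: inner_add_right inner_commute algebra_simps)
qed

text \<open>Apply \<open>carleman_conjugated\<close> to \<open>g = exp (\<tau> \<phi>) w\<close> and return to \<open>w\<close>. Returning costs a term
  \<open>\<tau>\<^sup>2 \<psi>\<^sup>2 w\<^sup>2\<close>, which the zeroth order term on the left absorbs; as \<open>\<psi> \<ge> 1/2\<close>, that term also
  controls \<open>w\<^sup>2\<close>.\<close>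

lemma carleman_estimate:
  fixes w :: "'a::euclidean_space \<Rightarrow> real"
  assumes K: "compact K" "K \<subseteq> U" and U: "0 \<notin> U"
    and D: "C2_data U w G H" and z: "\<And>x. x \<in> U - K \<Longrightarrow> w x = 0"
    and q: "q > 0" and \<tau>: "\<tau> \<ge> 4" and psi: "\<And>x. x \<in> K \<Longrightarrow> \<psi> x \<ge> 1/2"
    and \<psi>_def: "\<psi> = (\<lambda>x. ln (x \<bullet> x) / 2 - y0)"
    and c: "c \<le> q^2 / 8" "c \<le> 2 * q"
  shows "c * \<tau> * (LINT x:K|lborel. inv_vol x * exp (\<tau> * (\<psi> x)^2) * ((x \<bullet> x) * (G x \<bullet> G x) + (w x)^2))
     \<le> 2 * (LINT x:K|lborel. inv_vol x * exp (\<tau> * (\<psi> x)^2) * (cyl_op q x (G x) (H x))^2)"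
proof -
  have oU: "open U" using C2_data_open[OF D] .
  define e where "e = (\<lambda>x. exp (\<tau> * (\<psi> x)^2 / 2))"
  define ge where "ge = (\<lambda>x. (e x * (\<tau> * \<psi> x) / (x \<bullet> x)) *\<^sub>R x)"
  define He where "He = (\<lambda>x h. (e x * (\<tau>^2 * (\<psi> x)^2 + \<tau> - 2 * \<tau> * \<psi> x) / (x \<bullet> x)^2 * (x \<bullet> h)) *\<^sub>R x
       + (e x * (\<tau> * \<psi> x) / (x \<bullet> x)) *\<^sub>R h)"
  have De: "C2_data U e ge He"
    using C2_data_carleman_weight[OF oU U, where \<tau> = \<tau> and c = y0]
    unfolding e_def ge_def He_def \<psi>_def .
  define g where "g = (\<lambda>x. e x * w x)"
  define Gg where "Gg = (\<lambda>x. e x *\<^sub>R G x + w x *\<^sub>R ge x)"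
  define Hg where "Hg = (\<lambda>x h. (ge x \<bullet> h) *\<^sub>R G x + e x *\<^sub>R H x h + (G x \<bullet> h) *\<^sub>R ge x + w x *\<^sub>R He x h)"
  have Dg: "C2_data U g Gg Hg"
    unfolding g_def Gg_def Hg_def by (rule C2_data_mult[OF De D])
  have gz: "g x = 0" if "x \<in> U - K" for x
    using z[OF that] by (simp add: g_def)
  have nz: "x \<noteq> 0" "x \<bullet> x \<noteq> 0" if "x \<in> K" for x using that K U by auto
  have p1: "C1_data U \<psi> (\<lambda>x h. (x \<bullet> h) / (x \<bullet> x))"
    unfolding \<psi>_def by (rule C1_data_log_norm[OF U])
  have cont: "continuous_on K w" "continuous_on K G" "continuous_on K (\<lambda>x. tr (H x))"
    "continuous_on K (\<lambda>x. H x x)" "continuous_on K \<psi>" "continuous_on K inv_vol"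
    using C2_data_cont[OF D] C2_data_cont_tr[OF D] K(2) C1_data_cont[OF p1]
      C1_data_cont[OF C1_data_inv_vol[OF U]]
      C2_data_cont_Hess[OF D continuous_on_id K(2)]
    by (auto intro: continuous_on_subset)
  have cont2: "continuous_on K g" "continuous_on K Gg"
    using C2_data_cont[OF Dg] K(2) by (auto intro: continuous_on_subset)
  define E where "E = (\<lambda>x. 4 * q^2 * \<tau> * (x \<bullet> Gg x)^2
        + 2 * q * \<tau> * ((x \<bullet> x) * (Gg x \<bullet> Gg x) - (x \<bullet> Gg x)^2) + q^2 * \<tau>^3 * (\<psi> x)^2 * (g x)^2)"
  have e2: "exp (\<tau> * (\<psi> x)^2) = (e x)^2" for x
    by (simp add: e_def power2_eq_square flip: exp_add)
  have f: "cyl_op q x (Gg x) (Hg x) + q * \<tau>^2 * (\<psi> x)^2 * g x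
        - q * \<tau> * (2 * \<psi> x * (x \<bullet> Gg x) + g x) = e x * cyl_op q x (G x) (H x)" if x: "x \<in> K" for x
  proof -
    have xU: "x \<in> U" using x K by auto
    have t: "tr (He x) = e x * (\<tau>^2 * (\<psi> x)^2 + \<tau> - 2 * \<tau> * \<psi> x) / (x \<bullet> x)
       + (e x * (\<tau> * \<psi> x) / (x \<bullet> x)) * real DIM('a)"
    proof -
      have "He x = (\<lambda>h. (e x * (\<tau>^2 * (\<psi> x)^2 + \<tau> - 2 * \<tau> * \<psi> x) / (x \<bullet> x)^2) *\<^sub>R ((x \<bullet> h) *\<^sub>R x)
         + (e x * (\<tau> * \<psi> x) / (x \<bullet> x)) *\<^sub>R h)"
        by (auto simp: He_def)
      then show ?thesis
        using nz[OF x] by (simp only: tr_add tr_scale tr_rank_one tr_id) (simp add: power2_eq_square)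
    qed
    have ce: "cyl_op q x (ge x) (He x) = q * (e x * (\<tau>^2 * (\<psi> x)^2 + \<tau>))"
    proof -
      have 1: "x \<bullet> He x x = e x * (\<tau>^2 * (\<psi> x)^2 + \<tau> - \<tau> * \<psi> x)"
        using nz[OF x] by (simp add: He_def inner_add_right power2_eq_square) (simp add: algebra_simps)
      have 2: "x \<bullet> ge x = e x * (\<tau> * \<psi> x)"
        using nz[OF x] by (simp add: ge_def)
      show ?thesis
        unfolding cyl_op_def 1 2 t using nz[OF x] by (simp add: field_simps)
    qed
    have xge: "x \<bullet> ge x = e x * (\<tau> * \<psi> x)" "(x \<bullet> x) * (ge x \<bullet> G x) = e x * (\<tau> * \<psi> x) * (x \<bullet> G x)"
      using nz[OF x] by (simp_all add: ge_def)
    show ?thesis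
      unfolding Hg_def Gg_def g_def cyl_op_mult[OF C2_dataD(3)[OF De xU] C2_dataD(3)[OF D xU]] ce
      using xge by (simp add: inner_add_right power2_eq_square algebra_simps)
  qed
  have low: "c * \<tau> * ((e x)^2 * ((x \<bullet> x) * (G x \<bullet> G x) + (w x)^2)) \<le> E x" if x: "x \<in> K" for x
  proof -
    define a where "a = x \<bullet> G x"
    define M where "M = (x \<bullet> x) * (G x \<bullet> G x) - a^2"
    have M: "M \<ge> 0"
      using Cauchy_Schwarz_ineq[of x "G x"] by (simp add: M_def a_def)
    have xGg: "x \<bullet> Gg x = e x * (a + \<tau> * \<psi> x * w x)"
      using nz[OF x] by (simp add: Gg_def ge_def a_def inner_add_right algebra_simps)
    have Mg: "(x \<bullet> x) * (Gg x \<bullet> Gg x) - (x \<bullet> Gg x)^2 = (e x)^2 * M"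
      using nz[OF x] unfolding xGg
      by (simp add: Gg_def ge_def M_def a_def inner_add_right inner_add_left inner_commute[of "G x" x]
          power2_eq_square field_simps)
    have E: "E x = (e x)^2 * \<tau> * (4 * q^2 * (a + \<tau> * \<psi> x * w x)^2 + 2 * q * M + q^2 * (\<tau> * \<psi> x * w x)^2)"
      unfolding E_def Mg unfolding xGg g_def by (simp add: power2_eq_square power3_eq_cube algebra_simps)
    have *: "c * (a^2 + M + (w x)^2)
       \<le> 4 * q^2 * (a + \<tau> * \<psi> x * w x)^2 + 2 * q * M + q^2 * (\<tau> * \<psi> x * w x)^2"
    proof -
      define B where "B = \<tau> * \<psi> x * w x"
      have "2 \<le> \<tau> * \<psi> x"
        using mult_mono[of 4 \<tau> "1/2" "\<psi> x"] \<tau> psi[OF x] by simp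
      then have "1 \<le> (\<tau> * \<psi> x)^2"
        using power_mono[of 1 "\<tau> * \<psi> x" 2] by simp
      then have wB: "(w x)^2 \<le> B^2"
        using mult_right_mono[of 1 "(\<tau> * \<psi> x)^2" "(w x)^2"] by (simp add: B_def power_mult_distrib)
      have aB: "a^2 + B^2 \<le> 8 * (4 * (a + B)^2 + B^2)"
      proof -
        have "8 * (4 * (a + B)^2 + B^2) - (a^2 + B^2) = (a + B)^2 * 30 + (a + 2 * B)^2 + 5 * B^2"
          by (simp add: power2_eq_square algebra_simps)
        then show ?thesis
          by (smt (verit) zero_le_power2)
      qed
      have "c * (a^2 + (w x)^2) \<le> q^2 / 8 * (a^2 + B^2)"
        using wB c(1) by (intro mult_mono) auto
      also have "\<dots> \<le> q^2 / 8 * (8 * (4 * (a + B)^2 + B^2))"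
        using aB by (intro mult_left_mono) auto
      also have "q^2 / 8 * (8 * Z) = q^2 * Z" for Z
        by simp
      finally have 1: "c * (a^2 + (w x)^2) \<le> q^2 * (4 * (a + B)^2 + B^2)" .
      have 2: "c * M \<le> 2 * q * M"
        using c(2) M by (intro mult_right_mono)
      show ?thesis
        using 1 2 unfolding B_def[symmetric] by (simp add: algebra_simps)
    qed
    have "(e x)^2 * \<tau> * (c * (a^2 + M + (w x)^2)) \<le> E x"
      unfolding E using * \<tau> by (intro mult_left_mono) auto
    moreover have "a^2 + M = (x \<bullet> x) * (G x \<bullet> G x)"
      by (simp add: M_def)
    ultimately show ?thesis
      by (simp add: mult_ac)
  qed
  have i1: "set_integrable lborel K (\<lambda>x. inv_vol x * (e x)^2 * ((x \<bullet> x) * (G x \<bullet> G x) + (w x)^2))"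
    unfolding e_def by (intro set_integrable_compact K continuous_intros cont) auto
  have i2: "set_integrable lborel K (\<lambda>x. inv_vol x * E x)"
    unfolding E_def by (intro set_integrable_compact K continuous_intros cont cont2)
  have "c * \<tau> * (LINT x:K|lborel. inv_vol x * (e x)^2 * ((x \<bullet> x) * (G x \<bullet> G x) + (w x)^2))
     = (LINT x:K|lborel. c * \<tau> * (inv_vol x * (e x)^2 * ((x \<bullet> x) * (G x \<bullet> G x) + (w x)^2)))"
    by simp
  also have "\<dots> \<le> (LINT x:K|lborel. inv_vol x * E x)"
  proof (rule set_integral_mono[OF set_integrable_mult_right[OF i1] i2])
    fix x assume x: "x \<in> K"
    have "inv_vol x * (c * \<tau> * ((e x)^2 * ((x \<bullet> x) * (G x \<bullet> G x) + (w x)^2))) \<le> inv_vol x * E x"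
      using low[OF x] inv_vol_pos[OF nz(1)[OF x]] by (intro mult_left_mono) auto
    then show "c * \<tau> * (inv_vol x * (e x)^2 * ((x \<bullet> x) * (G x \<bullet> G x) + (w x)^2)) \<le> inv_vol x * E x"
      by (simp add: mult_ac)
  qed
  also have "\<dots> \<le> 2 * (LINT x:K|lborel. inv_vol x * (cyl_op q x (Gg x) (Hg x) + q * \<tau>^2 * (\<psi> x)^2 * g x
        - q * \<tau> * (2 * \<psi> x * (x \<bullet> Gg x) + g x))^2)"
    unfolding E_def by (rule carleman_conjugated[OF K U Dg gz q \<tau> psi \<psi>_def])
  also have "(LINT x:K|lborel. inv_vol x * (cyl_op q x (Gg x) (Hg x) + q * \<tau>^2 * (\<psi> x)^2 * g x
        - q * \<tau> * (2 * \<psi> x * (x \<bullet> Gg x) + g x))^2)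
      = (LINT x:K|lborel. inv_vol x * (e x)^2 * (cyl_op q x (G x) (H x))^2)"
    by (rule set_integral_eq_cong[OF refl]) (simp add: f power_mult_distrib)
  finally show ?thesis
    unfolding e2 .
qed

section \<open>Unique continuation across concentric spheres\<close>

lemma DERIV_max_zero_power:
  "((\<lambda>t::real. (max 0 t) ^ (k + 2)) has_real_derivative real (k + 2) * (max 0 t) ^ (k + 1)) (at t)"
proof (cases "t = 0")
  case False
  show ?thesis
  proof (cases "t > 0")
    case True
    have "((\<lambda>t. t ^ (k + 2)) has_real_derivative real (k + 2) * t ^ (k + 1)) (at t)"
      using DERIV_pow[of "k + 2" t] by simp
    then have "((\<lambda>t::real. (max 0 t) ^ (k + 2)) has_real_derivative real (k + 2) * t ^ (k + 1)) (at t)"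
      by (rule has_field_derivative_transform_within_open[of _ _ _ "{0<..}"]) (use True in auto)
    then show ?thesis using True by simp
  next
    case f: False
    have "((\<lambda>t. 0) has_real_derivative 0) (at t)" by simp
    then have "((\<lambda>t::real. (max 0 t) ^ (k + 2)) has_real_derivative 0) (at t)"
      by (rule has_field_derivative_transform_within_open[of _ _ _ "{..<0}"]) (use False f in auto)
    then show ?thesis using False f by simp
  qed
next
  case True
  have "((\<lambda>h. (max 0 h) ^ (k + 2) / h) \<longlongrightarrow> 0) (at (0::real))"
  proof (rule Lim_null_comparison)
    show "\<forall>\<^sub>F h in at (0::real). norm ((max 0 h) ^ (k + 2) / h) \<le> \<bar>h\<bar> ^ (k + 1)"
    proof (rule always_eventually, rule allI)
      fix h :: real
      show "norm ((max 0 h) ^ (k + 2) / h) \<le> \<bar>h\<bar> ^ (k + 1)"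
      proof (cases "h > 0")
        case False
        then have "max 0 h = 0" by simp
        then have "norm ((max 0 h) ^ (k + 2) / h) = 0" by simp
        also have "\<dots> \<le> \<bar>h\<bar> ^ (k + 1)" by (rule zero_le_power) simp
        finally show ?thesis .
      qed auto
    qed
    have "((\<lambda>h::real. \<bar>h\<bar> ^ (k + 1)) \<longlongrightarrow> \<bar>0\<bar> ^ (k + 1)) (at 0)"
      by (intro tendsto_intros)
    then show "((\<lambda>h::real. \<bar>h\<bar> ^ (k + 1)) \<longlongrightarrow> 0) (at 0)" by simp
  qed
  then show ?thesis
    using True by (simp add: DERIV_def)
qed

text \<open>The third power of a positive part is the simplest cutoff of class \<open>C\<^sup>2\<close>. It never becomes constant,
  but where it is bounded below the error terms that it produces are of the kind that the Carleman
  estimate absorbs.\<close>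

lemma C2_data_cutoff:
  assumes "open U"
  shows "C2_data U (\<lambda>x::'a::euclidean_space. (max 0 (x \<bullet> x - A))^3)
    (\<lambda>x. (6 * (max 0 (x \<bullet> x - A))^2) *\<^sub>R x)
    (\<lambda>x h. (24 * max 0 (x \<bullet> x - A) * (x \<bullet> h)) *\<^sub>R x + (6 * (max 0 (x \<bullet> x - A))^2) *\<^sub>R h)"
proof -
  have q: "C2_data U (\<lambda>x::'a. x \<bullet> x) (\<lambda>x. 2 *\<^sub>R x) (\<lambda>x h. 2 *\<^sub>R h)"
    using C2_data_norm_square[OF assms, of 0] by simp
  have d: "((\<lambda>t. (max 0 (t - A)) ^ (k + 2)) has_real_derivative real (k + 2) * (max 0 (t - A)) ^ (k + 1)) (at t)"
    for k t
  proof -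
    have g: "((\<lambda>t. t - A) has_real_derivative 1) (at t)"
      by (auto intro!: derivative_eq_intros)
    show ?thesis
      using DERIV_chain2[where f = "\<lambda>t. (max 0 t) ^ (k + 2)" and g = "\<lambda>t. t - A" and x = t and s = UNIV,
        OF DERIV_max_zero_power[of k "t - A"] g] by simp
  qed
  have "C2_data U (\<lambda>x. (max 0 (x \<bullet> x - A))^3) (\<lambda>x. (3 * (max 0 (x \<bullet> x - A))^2) *\<^sub>R 2 *\<^sub>R x)
    (\<lambda>x h. (6 * max 0 (x \<bullet> x - A) * (2 *\<^sub>R x \<bullet> h)) *\<^sub>R 2 *\<^sub>R x + (3 * (max 0 (x \<bullet> x - A))^2) *\<^sub>R 2 *\<^sub>R h)"
  proof (rule C2_data_comp[OF q])
    fix t :: real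
    show "((\<lambda>t. (max 0 (t - A))^3) has_real_derivative 3 * (max 0 (t - A))^2) (at t)"
      using d[of 1 t] by (simp add: numeral_eq_Suc)
    show "((\<lambda>t. 3 * (max 0 (t - A))^2) has_real_derivative 6 * max 0 (t - A)) (at t)"
      using DERIV_cmult[OF d[of 0 t], of 3] by (simp add: numeral_eq_Suc)
    show "continuous_on ((\<lambda>x. x \<bullet> x) ` U) (\<lambda>t. 6 * max 0 (t - A))"
      by (intro continuous_intros)
  qed
  then show ?thesis by (simp add: mult_ac)
qed

lemma compact_abs_bound:
  fixes f :: "'a::euclidean_space \<Rightarrow> real"
  assumes "compact K" "continuous_on K f"
  obtains B where "B \<ge> 1" "\<And>x. x \<in> K \<Longrightarrow> \<bar>f x\<bar> \<le> B"
proof -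
  have "bounded (f ` K)"
    using assms by (intro compact_imp_bounded compact_continuous_image)
  then obtain B where "\<And>x. x \<in> K \<Longrightarrow> \<bar>f x\<bar> \<le> B"
    unfolding bounded_iff by auto
  then have "max B 1 \<ge> 1" "\<And>x. x \<in> K \<Longrightarrow> \<bar>f x\<bar> \<le> max B 1"
    by (auto intro: le_max_iff_disj[THEN iffD2])
  then show ?thesis using that by blast
qed

text \<open>Where the cutoff \<open>e\<close> is bounded below, the first order differential inequality for \<open>w\<close> passes to \<open>e w\<close>.
  The power of \<open>B\<close> is immaterial, as \<open>B\<close> does not depend on \<open>\<tau>\<close>.\<close>

lemma cutoff_estimate:
  fixes \<omega> \<xi> x :: "'a::euclidean_space"
  assumes l: "linear Ae" "linear Aw" and B: "B \<ge> 1"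
    and b: "\<bar>e\<bar> \<le> B" "norm \<xi> \<le> B" "\<bar>cyl_op q x \<xi> Ae\<bar> \<le> B" "norm x \<le> B" "\<bar>q - 1\<bar> \<le> B"
    and w: "\<bar>cyl_op q x \<omega> Aw\<bar> \<le> B * norm \<omega>"
    and low: "1 \<le> B * e" "1 \<le> B * norm x"
  shows "(cyl_op q x (e *\<^sub>R \<omega> + w *\<^sub>R \<xi>) (\<lambda>h. (\<xi> \<bullet> h) *\<^sub>R \<omega> + e *\<^sub>R Aw h + (\<omega> \<bullet> h) *\<^sub>R \<xi> + w *\<^sub>R Ae h))^2
    \<le> 2 * (18 * B ^ 7)^2 * ((x \<bullet> x) * ((e *\<^sub>R \<omega> + w *\<^sub>R \<xi>) \<bullet> (e *\<^sub>R \<omega> + w *\<^sub>R \<xi>)) + (e * w)^2)"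
proof -
  let ?\<Omega> = "e *\<^sub>R \<omega> + w *\<^sub>R \<xi>"
  have B0: "B \<ge> 0" using B by simp
  have up: "B ^ i \<le> B ^ j" if "i \<le> j" for i j
    using B that by (rule power_increasing[rotated])
  have e0: "e > 0" using low(1) B0 by (smt (verit) mult_nonneg_nonpos)
  have w1: "\<bar>w\<bar> \<le> B * \<bar>e * w\<bar>"
  proof -
    have "1 * \<bar>w\<bar> \<le> (B * e) * \<bar>w\<bar>" using low(1) by (intro mult_right_mono) auto
    then show ?thesis using e0 by (simp add: abs_mult mult.assoc)
  qed
  have o1: "norm \<omega> \<le> B * (norm ?\<Omega> + B * \<bar>w\<bar>)"
  proof -
    have "1 * norm \<omega> \<le> (B * e) * norm \<omega>" using low(1) by (intro mult_right_mono) auto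
    also have "\<dots> = B * norm (e *\<^sub>R \<omega>)" using e0 by simp
    also have "norm (e *\<^sub>R \<omega>) \<le> norm ?\<Omega> + norm (w *\<^sub>R \<xi>)"
      by (metis add_diff_cancel_right' norm_triangle_ineq4)
    also have "norm (w *\<^sub>R \<xi>) \<le> B * \<bar>w\<bar>"
      using mult_right_mono[OF b(2), of "\<bar>w\<bar>"] by (simp add: mult.commute)
    finally show ?thesis using B0 by (simp add: mult_left_mono)
  qed
  have q1: "\<bar>(x \<bullet> x) * (\<xi> \<bullet> \<omega>)\<bar> \<le> B ^ 3 * norm \<omega>"
  proof -
    have "\<bar>\<xi> \<bullet> \<omega>\<bar> \<le> B * norm \<omega>"
      using Cauchy_Schwarz_ineq2[of \<xi> \<omega>] mult_right_mono[OF b(2), of "norm \<omega>"] by simp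
    moreover have "\<bar>x \<bullet> x\<bar> \<le> B^2"
      using b(4) by (simp add: dot_square_norm power_mono)
    ultimately have "\<bar>x \<bullet> x\<bar> * \<bar>\<xi> \<bullet> \<omega>\<bar> \<le> B^2 * (B * norm \<omega>)"
      by (intro mult_mono) auto
    then show ?thesis by (simp add: abs_mult power3_eq_cube power2_eq_square mult_ac)
  qed
  have q2: "\<bar>(q - 1) * (x \<bullet> \<xi>) * (x \<bullet> \<omega>)\<bar> \<le> B ^ 4 * norm \<omega>"
  proof -
    have 1: "\<bar>x \<bullet> \<xi>\<bar> \<le> B * B"
      using Cauchy_Schwarz_ineq2[of x \<xi>] mult_mono[OF b(4) b(2)] B0 by simp
    have 2: "\<bar>x \<bullet> \<omega>\<bar> \<le> B * norm \<omega>"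
      using Cauchy_Schwarz_ineq2[of x \<omega>] mult_right_mono[OF b(4), of "norm \<omega>"] by simp
    have "\<bar>q - 1\<bar> * \<bar>x \<bullet> \<xi>\<bar> * \<bar>x \<bullet> \<omega>\<bar> \<le> B * (B * B) * (B * norm \<omega>)"
      using b(5) 1 2 B0 by (intro mult_mono) auto
    then show ?thesis by (simp add: abs_mult power4_eq_xxxx mult_ac)
  qed
  have q3: "\<bar>e * cyl_op q x \<omega> Aw\<bar> \<le> B^2 * norm \<omega>"
  proof -
    have "\<bar>e\<bar> * \<bar>cyl_op q x \<omega> Aw\<bar> \<le> B * (B * norm \<omega>)"
      using b(1) w B0 by (intro mult_mono) auto
    then show ?thesis by (simp add: abs_mult power2_eq_square)
  qed
  have q4: "\<bar>w * cyl_op q x \<xi> Ae\<bar> \<le> B * \<bar>w\<bar>"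
    using b(3) mult_right_mono[OF b(3), of "\<bar>w\<bar>"] by (simp add: abs_mult mult.commute)
  define Q where "Q = cyl_op q x ?\<Omega> (\<lambda>h. (\<xi> \<bullet> h) *\<^sub>R \<omega> + e *\<^sub>R Aw h + (\<omega> \<bullet> h) *\<^sub>R \<xi> + w *\<^sub>R Ae h)"
  have "\<bar>Q\<bar> \<le> B^2 * norm \<omega> + B * \<bar>w\<bar> + 2 * (B ^ 3 * norm \<omega> + B ^ 4 * norm \<omega>)"
  proof -
    have "\<bar>a1 + a2 + 2 * (a3 + a4)\<bar> \<le> b1 + b2 + 2 * (b3 + b4)"
      if "\<bar>a1\<bar> \<le> b1" "\<bar>a2\<bar> \<le> b2" "\<bar>a3\<bar> \<le> b3" "\<bar>a4\<bar> \<le> b4" for a1 a2 a3 a4 b1 b2 b3 b4 :: real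
      using that by (auto simp: abs_le_iff)
    from this[OF q3 q4 q1 q2] show ?thesis
      unfolding Q_def cyl_op_mult[OF l] .
  qed
  also have "\<dots> \<le> B^4 * norm \<omega> + B^4 * \<bar>w\<bar> + 2 * (B ^ 4 * norm \<omega> + B ^ 4 * norm \<omega>)"
    using up[of 2 4] up[of 1 4] up[of 3 4]
    by (intro add_mono mult_left_mono mult_right_mono) auto
  also have "\<dots> \<le> 5 * B^4 * (norm \<omega> + \<bar>w\<bar>)"
    using B0 by (simp add: algebra_simps)
  also have "\<dots> \<le> 5 * B^4 * (B * (norm ?\<Omega> + B * (B * \<bar>e * w\<bar>)) + B * \<bar>e * w\<bar>)"
    using o1 w1 B0 by (intro mult_left_mono add_mono order_trans[OF o1]) auto
  also have "B * (norm ?\<Omega> + B * (B * \<bar>e * w\<bar>)) + B * \<bar>e * w\<bar> = B * norm ?\<Omega> + B^3 * \<bar>e * w\<bar> + B * \<bar>e * w\<bar>"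
    by (simp add: power3_eq_cube algebra_simps)
  also have "5 * B^4 * (B * norm ?\<Omega> + B^3 * \<bar>e * w\<bar> + B * \<bar>e * w\<bar>)
    \<le> 5 * B^4 * (B^2 * (norm x * norm ?\<Omega>) + B^3 * \<bar>e * w\<bar> + B^3 * \<bar>e * w\<bar>)"
  proof -
    have "B * norm ?\<Omega> \<le> B^2 * (norm x * norm ?\<Omega>)"
      using mult_right_mono[OF low(2), of "B * norm ?\<Omega>"] B0 by (simp add: power2_eq_square mult_ac)
    moreover have "B * \<bar>e * w\<bar> \<le> B^3 * \<bar>e * w\<bar>"
      using up[of 1 3] by (intro mult_right_mono) auto
    ultimately show ?thesis using B0 by (intro mult_left_mono add_mono) auto
  qed
  also have "\<dots> \<le> 5 * B^4 * (B^3 * (norm x * norm ?\<Omega>) + B^3 * \<bar>e * w\<bar> + B^3 * \<bar>e * w\<bar>)"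
    using up[of 2 3] B0 by (intro mult_left_mono add_mono mult_right_mono) auto
  also have "\<dots> = 5 * B^7 * (norm x * norm ?\<Omega> + 2 * \<bar>e * w\<bar>)"
    by (simp add: algebra_simps power_add[symmetric])
  also have "\<dots> \<le> 18 * B^7 * (norm x * norm ?\<Omega> + \<bar>e * w\<bar>)"
    using B0 by (simp add: algebra_simps)
  finally have "\<bar>Q\<bar> \<le> 18 * B^7 * (norm x * norm ?\<Omega> + \<bar>e * w\<bar>)" .
  then have "Q^2 \<le> (18 * B^7)^2 * (norm x * norm ?\<Omega> + \<bar>e * w\<bar>)^2"
    using power_mono[of "\<bar>Q\<bar>" _ 2] by (fastforce simp: power_mult_distrib)
  also have "\<dots> \<le> (18 * B^7)^2 * (2 * ((norm x * norm ?\<Omega>)^2 + (e * w)^2))"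
    using zero_le_power2[of "norm x * norm ?\<Omega> - \<bar>e * w\<bar>"]
    by (intro mult_left_mono) (simp_all add: power2_sum power2_diff)
  also have "(norm x * norm ?\<Omega>)^2 = (x \<bullet> x) * (?\<Omega> \<bullet> ?\<Omega>)"
    by (simp add: power_mult_distrib dot_square_norm)
  finally show ?thesis
    unfolding Q_def by (simp only: mult_ac)
qed

text \<open>The weight of the Carleman estimate increases with \<open>|x|\<close>, and a solution vanishing for \<open>|x| > \<rho>\<close> only
  has to be cut off on the inner side. The region \<open>|x| \<le> a1\<close>, where the cutoff spoils the
  inequality, carries a weight of at most \<open>E0\<close>, while the region \<open>|x| \<ge> a1\<close> carries at least \<open>E0\<close>. So
  the integral of \<open>w\<close> over the latter is at most a constant divided by \<open>\<tau>\<close>.\<close>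

lemma unique_continuation_spheres:
  fixes w :: "'a::euclidean_space \<Rightarrow> real"
  assumes D: "C2_data {x. a0 < norm x} w G H" and a0: "a0 \<ge> 0" and q: "q > 0"
    and ineq: "\<And>K. compact K \<Longrightarrow> K \<subseteq> {x. a0 < norm x}
       \<Longrightarrow> \<exists>C. \<forall>x\<in>K. \<bar>cyl_op q x (G x) (H x)\<bar> \<le> C * norm (G x)"
    and far: "\<And>x. \<rho> < norm x \<Longrightarrow> w x = 0"
    and x0: "a0 < norm x0"
  shows "w x0 = 0"
proof (rule ccontr)
  assume w0: "w x0 \<noteq> 0"
  define U where "U = {x::'a. a0 < norm x}"
  have U0: "0 \<notin> U" and oU: "open U" using a0 C2_data_open[OF D] by (auto simp: U_def)
  define a1 where "a1 = (a0 + norm x0) / 2"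
  define a where "a = (a0 + a1) / 2"
  have "a0 < a1" "a1 < norm x0"
    using x0 by (auto simp: a1_def)
  moreover from this have "a0 < a" "a < a1"
    by (auto simp: a_def)
  ultimately have a: "a0 < a" "a < a1" "a1 < norm x0" "a > 0"
    using a0 by linarith+
  define K where "K = {x::'a. a \<le> norm x \<and> norm x \<le> \<rho>}"
  have "K = cball 0 \<rho> - ball 0 a" by (auto simp: K_def)
  then have K: "compact K" by (simp add: compact_diff)
  have KU: "K \<subseteq> U" using a by (auto simp: K_def U_def)
  have nz: "x \<noteq> 0" if "x \<in> K" for x using that KU U0 by auto
  define cut where "cut = (\<lambda>x::'a. (max 0 (x \<bullet> x - a^2))^3)"
  define gc where "gc = (\<lambda>x::'a. (6 * (max 0 (x \<bullet> x - a^2))^2) *\<^sub>R x)"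
  define Hc where "Hc = (\<lambda>x h::'a. (24 * max 0 (x \<bullet> x - a^2) * (x \<bullet> h)) *\<^sub>R x + (6 * (max 0 (x \<bullet> x - a^2))^2) *\<^sub>R h)"
  have Dc: "C2_data U cut gc Hc"
    unfolding cut_def gc_def Hc_def by (rule C2_data_cutoff[OF oU])
  define v where "v = (\<lambda>x. cut x * w x)"
  define Gv where "Gv = (\<lambda>x. cut x *\<^sub>R G x + w x *\<^sub>R gc x)"
  define Hv where "Hv = (\<lambda>x h. (gc x \<bullet> h) *\<^sub>R G x + cut x *\<^sub>R H x h + (G x \<bullet> h) *\<^sub>R gc x + w x *\<^sub>R Hc x h)"
  have Dw: "C2_data U w G H" using D by (simp add: U_def)
  have Dv: "C2_data U v Gv Hv"
    unfolding v_def Gv_def Hv_def by (rule C2_data_mult[OF Dc Dw])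
  have vz: "v x = 0" if "x \<in> U - K" for x
  proof (cases "norm x < a")
    case True
    then have "x \<bullet> x < a^2" by (simp add: dot_square_norm power_strict_mono)
    then show ?thesis by (simp add: v_def cut_def)
  next
    case False
    then have "\<rho> < norm x" using that by (auto simp: K_def)
    then show ?thesis using far by (simp add: v_def)
  qed
  \<comment> \<open>This normalization makes \<open>\<psi> \<ge> 1/2\<close> for \<open>|x| \<ge> a\<close>.\<close>
  define y0 where "y0 = ln a - 1/2"
  define \<psi> where "\<psi> = (\<lambda>x::'a. ln (x \<bullet> x) / 2 - y0)"
  have \<psi>_eq: "\<psi> x = ln (norm x) - y0" if "x \<noteq> 0" for x
    using that by (simp add: \<psi>_def dot_square_norm ln_realpow)
  have psi: "1/2 \<le> \<psi> x" if "x \<in> K" for x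
    using that a nz[OF that] by (simp add: \<psi>_eq y0_def K_def)
  define c where "c = min (q^2 / 8) (2 * q)"
  have c: "c \<le> q^2 / 8" "c \<le> 2 * q" "c > 0" using q by (auto simp: c_def)
  note carl = carleman_estimate[OF K KU U0 Dv vz q _ psi \<psi>_def c(1,2)]
  define Z where "Z = (\<lambda>x. (x \<bullet> x) * (Gv x \<bullet> Gv x) + (v x)^2)"
  define Q where "Q = (\<lambda>x. cyl_op q x (Gv x) (Hv x))"
  have p1: "C1_data U \<psi> (\<lambda>x h. (x \<bullet> h) / (x \<bullet> x))"
    unfolding \<psi>_def by (rule C1_data_log_norm[OF U0])
  have cont: "continuous_on K v" "continuous_on K Gv" "continuous_on K (\<lambda>x. tr (Hv x))"
    "continuous_on K (\<lambda>x. Hv x x)" "continuous_on K \<psi>" "continuous_on K inv_vol"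
    "continuous_on K cut" "continuous_on K gc" "continuous_on K (\<lambda>x. tr (Hc x))"
    "continuous_on K (\<lambda>x. Hc x x)"
    using C2_data_cont[OF Dv] C2_data_cont_tr[OF Dv] KU C1_data_cont[OF p1]
      C1_data_cont[OF C1_data_inv_vol[OF U0]]
      C2_data_cont_Hess[OF Dv continuous_on_id KU]
      C2_data_cont[OF Dc] C2_data_cont_tr[OF Dc]
      C2_data_cont_Hess[OF Dc continuous_on_id KU]
    by (auto intro: continuous_on_subset)
  have cQ: "continuous_on K Q" "continuous_on K (\<lambda>x. cyl_op q x (gc x) (Hc x))"
    unfolding Q_def cyl_op_def by (intro continuous_intros cont)+
  have cZ: "continuous_on K Z"
    unfolding Z_def by (intro continuous_intros cont)
  define K1 where "K1 = {x \<in> K. a1 \<le> norm x}"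
  have K1K: "K1 \<subseteq> K" by (auto simp: K1_def)
  obtain C1 where C1: "C1 \<ge> 0" "\<And>x. x \<in> K1 \<Longrightarrow> (Q x)^2 \<le> C1 * Z x"
  proof -
    obtain C where C: "\<And>x. x \<in> K \<Longrightarrow> \<bar>cyl_op q x (G x) (H x)\<bar> \<le> C * norm (G x)"
      using ineq[OF K] KU unfolding U_def by blast
    obtain B1 where B1: "\<And>x. x \<in> K \<Longrightarrow> \<bar>cut x\<bar> \<le> B1" "B1 \<ge> 1"
      using compact_abs_bound[OF K cont(7)] by blast
    obtain B2 where B2: "\<And>x. x \<in> K \<Longrightarrow> \<bar>norm (gc x)\<bar> \<le> B2" "B2 \<ge> 1"
      using compact_abs_bound[OF K continuous_on_norm[OF cont(8)]] by blast
    obtain B3 where B3: "\<And>x. x \<in> K \<Longrightarrow> \<bar>cyl_op q x (gc x) (Hc x)\<bar> \<le> B3" "B3 \<ge> 1"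
      using compact_abs_bound[OF K cQ(2)] by blast
    have pos: "(a1^2 - a^2)^3 > 0"
      using a by (simp add: power_strict_mono)
    \<comment> \<open>One constant for all upper bounds, and for the lower bounds of the cutoff and of \<open>|x|\<close>.\<close>
    define B where "B = Max {B1, B2, B3, \<rho>, \<bar>q - 1\<bar>, C, 1 / (a1^2 - a^2)^3, 1 / a}"
    have B: "B1 \<le> B" "B2 \<le> B" "B3 \<le> B" "\<rho> \<le> B" "\<bar>q - 1\<bar> \<le> B" "C \<le> B" "1 / (a1^2 - a^2)^3 \<le> B" "1 / a \<le> B"
      unfolding B_def by (rule Max_ge; simp)+
    have Bge: "B \<ge> 1" using B B1 by linarith
    have "(Q x)^2 \<le> 2 * (18 * B ^ 7)^2 * Z x" if x: "x \<in> K1" for x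
    proof -
      have xK: "x \<in> K" and xU: "x \<in> U" using x K1K KU by auto
      have "a1^2 \<le> x \<bullet> x"
        using x a by (simp add: K1_def dot_square_norm power_mono)
      moreover have "a^2 < a1^2" using a by (simp add: power_strict_mono)
      ultimately have "(a1^2 - a^2)^3 \<le> cut x"
        unfolding cut_def by (intro power_mono) auto
      then have "B * (a1^2 - a^2)^3 \<le> B * cut x"
        using Bge by (intro mult_left_mono) auto
      moreover have "1 \<le> B * (a1^2 - a^2)^3"
        using B(7) pos by (simp add: divide_le_eq)
      ultimately have l1: "1 \<le> B * cut x" by linarith
      have "B * a \<le> B * norm x"
        using Bge xK by (intro mult_left_mono) (auto simp: K_def)
      moreover have "1 \<le> B * a" using B(8) a by (simp add: divide_le_eq)
      ultimately have l2: "1 \<le> B * norm x" by linarith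
      have "C * norm (G x) \<le> B * norm (G x)"
        using B by (intro mult_right_mono) auto
      then have 1: "\<bar>cyl_op q x (G x) (H x)\<bar> \<le> B * norm (G x)"
        using C[OF xK] by linarith
      have "norm x \<le> B" using xK B by (simp add: K_def)
      then show ?thesis
        unfolding Q_def Gv_def Hv_def Z_def v_def
        using B1(1)[OF xK] B2(1)[OF xK] B3(1)[OF xK] B 1 l1 l2
        by (intro cutoff_estimate[OF C2_dataD(3)[OF Dc xU] C2_dataD(3)[OF Dw xU] Bge]) auto
    qed
    then show ?thesis using that[of "2 * (18 * B ^ 7)^2"] by auto
  qed
  obtain C2 where C2: "C2 \<ge> 1" "\<And>x. x \<in> K \<Longrightarrow> \<bar>(Q x)^2\<bar> \<le> C2"
    using compact_abs_bound[OF K continuous_on_power[OF cQ(1)]] by blast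
  have "norm x0 \<le> \<rho>"
    using far[of x0] w0 by (meson not_le)
  then have xK: "x0 \<in> K"
    using a by (simp add: K_def)
  have "a^2 < x0 \<bullet> x0"
    using a by (simp add: dot_square_norm power_strict_mono)
  then have v0: "v x0 \<noteq> 0" using w0 by (auto simp: v_def cut_def)
  have ivp: "inv_vol x > 0" if "x \<in> K" for x using inv_vol_pos nz[OF that] by blast
  define \<eta> where "\<eta> = inv_vol x0 * (v x0)^2 / 2"
  have \<eta>: "\<eta> > 0" using ivp[OF xK] v0 by (simp add: \<eta>_def)
  define W where "W = {x \<in> U. inv_vol x * (v x)^2 > \<eta>} \<inter> {x. a1 < norm x}"
  have "open W"
  proof -
    have "continuous_on U (\<lambda>x. inv_vol x * (v x)^2)"
      by (intro continuous_intros C1_data_cont[OF C1_data_inv_vol[OF U0]] C2_data_cont[OF Dv])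
    then have "open (U \<inter> (\<lambda>x. inv_vol x * (v x)^2) -` {\<eta><..})"
      using oU by (intro continuous_open_preimage) auto
    moreover have "W = (U \<inter> (\<lambda>x. inv_vol x * (v x)^2) -` {\<eta><..}) \<inter> {x. a1 < norm x}"
      by (auto simp: W_def)
    moreover have "open {x::'a. a1 < norm x}"
      by (intro open_Collect_less continuous_intros)
    ultimately show ?thesis by auto
  qed
  moreover have "x0 \<in> W"
    using xK KU a \<eta> by (auto simp: W_def \<eta>_def)
  ultimately obtain r where r: "r > 0" "cball x0 r \<subseteq> W"
    using open_contains_cball by blast
  have WK: "W \<subseteq> K1"
  proof
    fix x assume x: "x \<in> W"
    then have "v x \<noteq> 0" using \<eta> by (auto simp: W_def)
    then show "x \<in> K1" using x vz[of x] by (auto simp: W_def K1_def)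
  qed
  define I where "I = \<eta> * measure lborel (cball x0 r)"
  have I: "I > 0"
    using \<eta> r content_cball_pos[of r x0] by (simp add: I_def)
  define V where "V = (LINT x:K|lborel. inv_vol x)"
  have main: "(c * \<tau> - 2 * C1) * I \<le> 2 * C2 * V" if \<tau>: "\<tau> \<ge> 4" "c * \<tau> \<ge> 2 * C1" for \<tau>
  proof -
    define wt where "wt = (\<lambda>x. exp (\<tau> * (\<psi> x)^2))"
    have wtp: "wt x \<ge> 0" for x by (simp add: wt_def)
    have cwt: "continuous_on K wt" unfolding wt_def by (intro continuous_intros cont)
    define E0 where "E0 = exp (\<tau> * (ln a1 - y0)^2)"
    have \<psi>1: "0 \<le> ln a1 - y0" using a by (simp add: y0_def ln_mono order_trans[of _ "ln a"])
    define J where "J = (LINT x:K|lborel. inv_vol x * wt x * Z x)"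
    have iJ: "set_integrable lborel K (\<lambda>x. inv_vol x * wt x * Z x)"
      and iQ: "set_integrable lborel K (\<lambda>x. inv_vol x * wt x * (Q x)^2)"
      and iV: "set_integrable lborel K inv_vol"
      by (intro set_integrable_compact K continuous_intros cont cwt cZ cQ)+
    have E1: "E0 \<le> wt x" if "x \<in> K1" for x
    proof -
      have "ln a1 - y0 \<le> \<psi> x"
        using that a K1K nz[of x] by (auto simp: \<psi>_eq K1_def)
      then show ?thesis using \<psi>1 \<tau> by (auto simp: E0_def wt_def intro!: mult_left_mono power_mono)
    qed
    have E2: "wt x \<le> E0" if "x \<in> K - K1" for x
    proof -
      have x0: "x \<noteq> 0" using that nz by auto
      have "norm x \<le> a1" using that by (auto simp: K1_def)
      then have "\<psi> x \<le> ln a1 - y0"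
        using that a x0 by (simp add: \<psi>_eq)
      then show ?thesis using psi[of x] that \<tau> by (auto simp: E0_def wt_def intro!: mult_left_mono power_mono)
    qed
    have Zn: "Z x \<ge> 0" for x by (simp add: Z_def)
    have E0p: "E0 > 0" by (simp add: E0_def)
    have "c * \<tau> * J \<le> 2 * (LINT x:K|lborel. inv_vol x * wt x * (Q x)^2)"
      unfolding J_def Z_def Q_def wt_def by (rule carl) (use \<tau> in auto)
    also have "(LINT x:K|lborel. inv_vol x * wt x * (Q x)^2)
       \<le> (LINT x:K|lborel. C1 * (inv_vol x * wt x * Z x) + C2 * E0 * inv_vol x)"
    proof (rule set_integral_mono[OF iQ])
      show "set_integrable lborel K (\<lambda>x. C1 * (inv_vol x * wt x * Z x) + C2 * E0 * inv_vol x)"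
        by (intro set_integral_add set_integrable_mult_right iJ iV)
      fix x assume x: "x \<in> K"
      have "wt x * (Q x)^2 \<le> C1 * (wt x * Z x) + C2 * E0"
      proof (cases "x \<in> K1")
        case True
        have "wt x * (Q x)^2 \<le> wt x * (C1 * Z x)"
          using C1(2)[OF True] wtp by (intro mult_left_mono) auto
        also have "\<dots> = C1 * (wt x * Z x)"
          by (rule mult.left_commute)
        finally show ?thesis using mult_nonneg_nonneg[of C2 E0] C2 E0p by linarith
      next
        case False
        have "wt x * (Q x)^2 \<le> E0 * C2"
          using E2[of x] C2(2)[OF x] False x E0p by (intro mult_mono) auto
        moreover have "0 \<le> C1 * (wt x * Z x)" using C1 Zn[of x] wtp[of x] by simp
        ultimately show ?thesis by (simp add: mult.commute[of E0 C2])
      qed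
      then have "inv_vol x * (wt x * (Q x)^2) \<le> inv_vol x * (C1 * (wt x * Z x) + C2 * E0)"
        using ivp[OF x] by (intro mult_left_mono) auto
      then show "inv_vol x * wt x * (Q x)^2 \<le> C1 * (inv_vol x * wt x * Z x) + C2 * E0 * inv_vol x"
        by (simp add: algebra_simps)
    qed
    also have "\<dots> = C1 * J + C2 * E0 * V"
      using set_integral_add(2)[OF set_integrable_mult_right[OF iJ, of C1] set_integrable_mult_right[OF iV, of "C2 * E0"]]
      by (simp add: J_def V_def)
    finally have 1: "(c * \<tau> - 2 * C1) * J \<le> 2 * C2 * E0 * V"
      by (simp add: algebra_simps)
    have "E0 * I \<le> J"
    proof -
      have cb: "cball x0 r \<subseteq> K" using r WK K1K by auto
      have ii: "set_integrable lborel (cball x0 r) (\<lambda>x. E0 * \<eta>)"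
        by (intro set_integrable_compact continuous_intros) auto
      have "E0 * I = (LINT x:cball x0 r|lborel. E0 * \<eta>)"
        by (simp add: I_def set_lebesgue_integral_def)
      also have "\<dots> = (LINT x:K|lborel. indicator (cball x0 r) x * (E0 * \<eta>))"
        unfolding set_lebesgue_integral_def
        by (rule Bochner_Integration.integral_cong) (use cb in \<open>auto simp: indicator_def\<close>)
      also have "\<dots> \<le> J"
        unfolding J_def
      proof (rule set_integral_mono[OF _ iJ])
        have "(\<lambda>x. indicator K x *\<^sub>R (indicator (cball x0 r) x * (E0 * \<eta>))) = (\<lambda>x. indicator (cball x0 r) x *\<^sub>R (E0 * \<eta>))"
          using cb by (auto simp: indicator_def fun_eq_iff)
        then show "set_integrable lborel K (\<lambda>x. indicator (cball x0 r) x * (E0 * \<eta>))"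
          using ii by (simp add: set_integrable_def)
        fix x assume x: "x \<in> K"
        show "indicator (cball x0 r) x * (E0 * \<eta>) \<le> inv_vol x * wt x * Z x"
        proof (cases "x \<in> cball x0 r")
          case True
          then have xW: "x \<in> W" using r by auto
          have "\<eta> \<le> inv_vol x * (v x)^2" using xW by (auto simp: W_def)
          also have "\<dots> \<le> inv_vol x * Z x"
            using ivp[OF x] by (intro mult_left_mono) (auto simp: Z_def)
          finally have "E0 * \<eta> \<le> wt x * (inv_vol x * Z x)"
            using E1[of x] xW WK \<eta> wtp[of x] by (intro mult_mono) auto
          then show ?thesis using True by (simp add: mult_ac)
        next
          case False
          then show ?thesis using ivp[OF x] Zn[of x] wtp[of x] by simp
        qed
      qed
      finally show ?thesis .
    qed
    then have "(c * \<tau> - 2 * C1) * (E0 * I) \<le> (c * \<tau> - 2 * C1) * J"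
      using \<tau> by (intro mult_left_mono) auto
    then have "E0 * ((c * \<tau> - 2 * C1) * I) \<le> E0 * (2 * C2 * V)"
      using 1 by (simp add: algebra_simps)
    then show ?thesis using E0p by simp
  qed
  define \<tau> where "\<tau> = max 4 ((2 * C1 + (\<bar>2 * C2 * V\<bar> + 1) / I) / c)"
  have "c * ((2 * C1 + (\<bar>2 * C2 * V\<bar> + 1) / I) / c) \<le> c * \<tau>"
    using c by (intro mult_left_mono) (auto simp: \<tau>_def)
  then have t: "2 * C1 + (\<bar>2 * C2 * V\<bar> + 1) / I \<le> c * \<tau>" using c by simp
  moreover have "(\<bar>2 * C2 * V\<bar> + 1) / I > 0" using I by (intro divide_pos_pos) auto
  ultimately have "(c * \<tau> - 2 * C1) * I \<le> 2 * C2 * V"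
    using main[of \<tau>] by (auto simp: \<tau>_def)
  moreover have "(\<bar>2 * C2 * V\<bar> + 1) / I * I \<le> (c * \<tau> - 2 * C1) * I"
    using t I by (intro mult_right_mono) auto
  ultimately show False using I by simp
qed

section \<open>The strong maximum principle\<close>

lemma cyl_op_p_op:
  "cyl_op (p - 1) x \<xi> A = p_op p (x :: 'a::euclidean_space) A + (p - real DIM('a)) * (x \<bullet> \<xi>)"
  by (simp add: cyl_op_def p_op_def algebra_simps)

text \<open>Both functions solve the nonlinear equation, and the difference of the two equations, with the
  coefficients frozen at \<open>\<nabla>v = k x\<close>, is \<open>(\<nabla>v - \<nabla>u) \<cdot> f\<close> where \<open>f\<close> involves only \<open>\<nabla>u\<close>, \<open>\<nabla>v\<close> and \<open>D\<^sup>2u\<close>.\<close>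

lemma p_op_difference_bound:
  assumes Du: "C2_data S u Gu Hu" and Dv: "C2_data S v Gv Hv"
    and pu: "\<And>x. x \<in> S \<Longrightarrow> p_op p (Gu x) (Hu x) = 0"
    and pv: "\<And>x. x \<in> S \<Longrightarrow> p_op p (Gv x) (Hv x) = 0"
    and k: "\<And>x. x \<in> S \<Longrightarrow> Gv x = k x *\<^sub>R x" "\<And>x. x \<in> S \<Longrightarrow> k x \<noteq> 0" "continuous_on S k"
    and K: "compact K" "K \<subseteq> S"
  shows "\<exists>C. \<forall>x\<in>K. \<bar>p_op p x (\<lambda>h. Hu x h - Hv x h)\<bar> \<le> C * norm (Gu x - Gv x)"
proof -
  define f where "f = (\<lambda>x. tr (Hu x) *\<^sub>R (Gu x + Gv x) + (p - 2) *\<^sub>R (Hu x (Gu x) + Hu x (Gv x)))"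
  have c: "continuous_on K Gu" "continuous_on K Gv" "continuous_on K k" "continuous_on K (\<lambda>x. tr (Hu x))"
    using C2_data_cont(2)[OF Du] C2_data_cont(2)[OF Dv] C2_data_cont_tr[OF Du] k(3) K(2)
    by (blast intro: continuous_on_subset)+
  have "continuous_on K f"
    unfolding f_def by (intro continuous_intros c C2_data_cont_Hess[OF Du _ K(2)])
  then have "continuous_on K (\<lambda>x. norm (f x) / (k x)^2)"
    using k K by (intro continuous_intros c) auto
  then obtain C where C: "\<And>x. x \<in> K \<Longrightarrow> \<bar>norm (f x) / (k x)^2\<bar> \<le> C"
    using compact_abs_bound[OF K(1)] by blast
  have "\<bar>p_op p x (\<lambda>h. Hu x h - Hv x h)\<bar> \<le> C * norm (Gu x - Gv x)" if x: "x \<in> K" for x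
  proof -
    have xS: "x \<in> S" using x K by auto
    have l: "linear (Hu x)" "linear (Hv x)" using C2_dataD(3)[OF Du xS] C2_dataD(3)[OF Dv xS] .
    have k2: "(k x)^2 > 0" using k(2)[OF xS] by simp
    have "(k x)^2 * p_op p x (\<lambda>h. Hu x h - Hv x h) = p_op p (Gv x) (\<lambda>h. Hu x h - Hv x h)"
      unfolding k(1)[OF xS] by (rule p_op_scale_vector[symmetric]) (intro linear_compose_sub l)
    also have "\<dots> = p_op p (Gv x) (Hu x) - p_op p (Gu x) (Hu x)"
      using pu[OF xS] pv[OF xS] by (simp add: p_op_diff)
    also have "\<dots> = (Gv x - Gu x) \<bullet> f x"
      using Hessian_symmetric[OF Du xS, of "Gu x" "Gv x"]
      by (simp add: p_op_def f_def inner_diff_left inner_add_right algebra_simps inner_commute[of "Gv x" "Gu x"])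
    finally have "(k x)^2 * \<bar>p_op p x (\<lambda>h. Hu x h - Hv x h)\<bar> = \<bar>(Gv x - Gu x) \<bullet> f x\<bar>"
      using k2 by (metis abs_mult abs_of_pos)
    also have "\<dots> \<le> norm (Gu x - Gv x) * norm (f x)"
      by (metis Cauchy_Schwarz_ineq2 norm_minus_commute)
    finally have "\<bar>p_op p x (\<lambda>h. Hu x h - Hv x h)\<bar> \<le> norm (f x) / (k x)^2 * norm (Gu x - Gv x)"
      using k2 by (simp add: field_simps)
    also have "\<dots> \<le> C * norm (Gu x - Gv x)"
      using C[OF x] by (intro mult_right_mono) auto
    finally show ?thesis .
  qed
  then show ?thesis by blast
qed

lemma C2_data_gaussian:
  fixes \<alpha> :: real and y :: "'a::euclidean_space"
  defines "e \<equiv> \<lambda>x. exp (- \<alpha> * ((x - y) \<bullet> (x - y)))"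
  assumes "open U"
  shows "C2_data U (\<lambda>x. e x - B)
    (\<lambda>x. (- 2 * \<alpha> * e x) *\<^sub>R (x - y))
    (\<lambda>x h. e x *\<^sub>R ((4 * \<alpha>^2) *\<^sub>R (((x - y) \<bullet> h) *\<^sub>R (x - y)) - (2 * \<alpha>) *\<^sub>R h))"
proof -
  have "C2_data U (\<lambda>x. e x - B)
    (\<lambda>x. (- \<alpha> * e x) *\<^sub>R 2 *\<^sub>R (x - y))
    (\<lambda>x h. (\<alpha>^2 * e x * (2 *\<^sub>R (x - y) \<bullet> h)) *\<^sub>R 2 *\<^sub>R (x - y)
       + (- \<alpha> * e x) *\<^sub>R 2 *\<^sub>R h)"
    unfolding e_def
  proof (rule C2_data_comp[OF C2_data_norm_square[OF assms(2)]])
    fix t :: real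
    show "((\<lambda>t. exp (- \<alpha> * t) - B) has_real_derivative - \<alpha> * exp (- \<alpha> * t)) (at t)"
      by (auto intro!: derivative_eq_intros)
    show "((\<lambda>t. - \<alpha> * exp (- \<alpha> * t)) has_real_derivative \<alpha>^2 * exp (- \<alpha> * t)) (at t)"
      by (auto intro!: derivative_eq_intros simp: power2_eq_square)
    show "continuous_on ((\<lambda>x. (x - y) \<bullet> (x - y)) ` U) (\<lambda>t. \<alpha>^2 * exp (- \<alpha> * t))"
      by (intro continuous_intros)
  qed
  moreover have "(\<alpha>^2 * E * (2 *\<^sub>R d \<bullet> h)) *\<^sub>R 2 *\<^sub>R d + (- \<alpha> * E) *\<^sub>R 2 *\<^sub>R h
      = E *\<^sub>R ((4 * \<alpha>^2) *\<^sub>R ((d \<bullet> h) *\<^sub>R d) - (2 * \<alpha>) *\<^sub>R h)"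
    "(- \<alpha> * E) *\<^sub>R 2 *\<^sub>R d = (- 2 * \<alpha> * E) *\<^sub>R d" for E and d h :: 'a
    by (simp_all add: scaleR_diff_right mult_ac)
  ultimately show ?thesis by (simp only:)
qed

lemma p_op_rank_one: "p_op p \<xi> (\<lambda>h. (d \<bullet> h) *\<^sub>R d) = (\<xi> \<bullet> \<xi>) * (d \<bullet> d) + (p - 2) * (\<xi> \<bullet> d)^2"
  by (simp add: p_op_def tr_rank_one power2_eq_square inner_commute[of d \<xi>])

lemma p_op_id: "p_op p \<xi> (\<lambda>h::'a::euclidean_space. h) = (real DIM('a) + p - 2) * (\<xi> \<bullet> \<xi>)"
  by (simp add: p_op_def tr_id algebra_simps)

lemma p_op_rank_one_lower:
  assumes "p > 1"
  shows "min 1 (p - 1) * ((\<xi> \<bullet> \<xi>) * (d \<bullet> d)) \<le> p_op p \<xi> (\<lambda>h. (d \<bullet> h) *\<^sub>R d)"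
proof -
  have cs: "(\<xi> \<bullet> d)^2 \<le> (\<xi> \<bullet> \<xi>) * (d \<bullet> d)" by (rule Cauchy_Schwarz_ineq)
  show ?thesis
  proof (cases "p \<ge> 2")
    case True
    then have "0 \<le> (p - 2) * (\<xi> \<bullet> d)^2" by simp
    then show ?thesis using True by (simp add: p_op_rank_one)
  next
    case False
    then have "(2 - p) * (\<xi> \<bullet> d)^2 \<le> (2 - p) * ((\<xi> \<bullet> \<xi>) * (d \<bullet> d))"
      using cs by (intro mult_left_mono) auto
    then show ?thesis using False by (simp add: p_op_rank_one algebra_simps)
  qed
qed

text \<open>The rank one part of the Hessian is of order \<open>\<alpha>^2\<close>; all other terms are of order \<open>\<alpha>\<close>.\<close>

lemma barrier_subsolution:
  fixes x y :: "'a::euclidean_space"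
  assumes p: "p > 1" and m: "0 < m" "m \<le> norm x" "norm x \<le> B" and R: "0 < R" "R / 2 \<le> norm (x - y)" "norm (x - y) \<le> R"
    and C: "C \<ge> 0"
    and \<alpha>: "\<alpha> > 0" "\<alpha> * (min 1 (p - 1) * m^2 * R^2) > 2 * (real DIM('a) + p) * B^2 + 2 * C * R"
  defines "e \<equiv> exp (- \<alpha> * ((x - y) \<bullet> (x - y)))"
  shows "C * norm ((- 2 * \<alpha> * e) *\<^sub>R (x - y))
    < p_op p x (\<lambda>h. e *\<^sub>R ((4 * \<alpha>^2) *\<^sub>R (((x - y) \<bullet> h) *\<^sub>R (x - y)) - (2 * \<alpha>) *\<^sub>R h))"
proof -
  define d where "d = x - y"
  have e: "e > 0" by (simp add: e_def)
  define l where "l = min 1 (p - 1)"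
  have l: "l > 0" using p by (simp add: l_def)
  have dd: "R^2 / 4 \<le> d \<bullet> d"
    using R power_mono[of "R/2" "norm d" 2] by (simp add: d_def dot_square_norm power_divide)
  have xx: "m^2 \<le> x \<bullet> x" "x \<bullet> x \<le> B^2"
    using m by (auto simp: dot_square_norm intro!: power_mono)
  have "l * (m^2 * (R^2 / 4)) \<le> l * ((x \<bullet> x) * (d \<bullet> d))"
    using l xx dd by (intro mult_left_mono mult_mono) auto
  then have 1: "l * (m^2 * (R^2 / 4)) \<le> p_op p x (\<lambda>h. (d \<bullet> h) *\<^sub>R d)"
    using p_op_rank_one_lower[OF p, of x d] unfolding l_def by linarith
  have 2: "p_op p x (\<lambda>h. h) \<le> (real DIM('a) + p) * B^2"
    unfolding p_op_id using xx p by (intro mult_mono) (auto simp: DIM_positive Suc_leI)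
  have "C * norm ((- 2 * \<alpha> * e) *\<^sub>R d) \<le> C * (2 * \<alpha> * e * R)"
    using R \<alpha> e C by (intro mult_left_mono) (auto simp: d_def)
  also have "\<dots> = \<alpha> * e * (2 * C * R)" by simp
  also have "\<dots> < \<alpha> * e * (\<alpha> * (l * m^2 * R^2) - 2 * (real DIM('a) + p) * B^2)"
    using \<alpha> e unfolding l_def by (intro mult_strict_left_mono) auto
  also have "\<dots> = e * (4 * \<alpha>^2 * (l * (m^2 * (R^2 / 4))) - 2 * \<alpha> * ((real DIM('a) + p) * B^2))"
    by (simp add: algebra_simps power2_eq_square)
  also have "\<dots> \<le> e * (4 * \<alpha>^2 * p_op p x (\<lambda>h. (d \<bullet> h) *\<^sub>R d) - 2 * \<alpha> * p_op p x (\<lambda>h. h))"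
    using e \<alpha> 1 2 by (intro mult_left_mono diff_mono) auto
  also have "\<dots> = p_op p x (\<lambda>h. e *\<^sub>R ((4 * \<alpha>^2) *\<^sub>R ((d \<bullet> h) *\<^sub>R d) - (2 * \<alpha>) *\<^sub>R h))"
    by (simp only: p_op_scale p_op_diff)
  finally show ?thesis unfolding d_def .
qed

text \<open>The boundary point argument of Hopf. In the annulus \<open>A\<close> the function \<open>w + \<epsilon> h\<close> cannot have a positive
  interior maximum, since there the gradients of \<open>w\<close> and \<open>- \<epsilon> h\<close> agree and the differential inequality
  for \<open>w\<close> would contradict \<open>barrier_subsolution\<close>. So \<open>w \<le> - \<epsilon> h\<close>, and \<open>w\<close> leaves the value \<open>0\<close> at \<open>z\<close> with a
  nonzero slope, although \<open>z\<close> is an interior maximum.\<close>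

lemma hopf_no_touching:
  fixes w :: "'a::euclidean_space \<Rightarrow> real"
  assumes D: "C2_data S w G H" and S0: "0 \<notin> S" and p: "p > 1"
    and bound: "\<And>K. compact K \<Longrightarrow> K \<subseteq> S \<Longrightarrow> \<exists>C. \<forall>x\<in>K. \<bar>p_op p x (H x)\<bar> \<le> C * norm (G x)"
    and R: "R > 0" "cball y R \<subseteq> S" and neg: "\<And>x. x \<in> ball y R \<Longrightarrow> w x < 0"
    and le: "\<And>x. x \<in> S \<Longrightarrow> w x \<le> 0" and z: "norm (z - y) = R" "w z = 0"
  shows False
proof -
  have oS: "open S" using C2_data_open[OF D] .
  define A where "A = {x. R / 2 \<le> norm (x - y) \<and> norm (x - y) \<le> R}"
  have "A = cball y R - ball y (R / 2)"
    by (auto simp: A_def dist_norm norm_minus_commute)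
  then have A: "compact A" by (simp add: compact_diff)
  have AS: "A \<subseteq> S" using R(2) by (auto simp: A_def dist_norm norm_minus_commute)
  obtain C0 where C0: "\<And>x. x \<in> A \<Longrightarrow> \<bar>p_op p x (H x)\<bar> \<le> C0 * norm (G x)"
    using bound[OF A AS] by blast
  define C where "C = max C0 0"
  have C: "C \<ge> 0" "\<And>x. x \<in> A \<Longrightarrow> \<bar>p_op p x (H x)\<bar> \<le> C * norm (G x)"
  proof -
    show "C \<ge> 0" by (simp add: C_def)
    fix x assume "x \<in> A"
    have "C0 * norm (G x) \<le> C * norm (G x)" unfolding C_def by (intro mult_right_mono) auto
    then show "\<bar>p_op p x (H x)\<bar> \<le> C * norm (G x)" using C0[OF \<open>x \<in> A\<close>] by linarith
  qed
  have zA: "z \<in> A" using z R by (simp add: A_def)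
  obtain B where B: "B \<ge> 1" "\<And>x. x \<in> A \<Longrightarrow> \<bar>norm x\<bar> \<le> B"
    using compact_abs_bound[OF A continuous_on_norm[OF continuous_on_id]] by blast
  obtain xm where xm: "xm \<in> A" "\<And>x. x \<in> A \<Longrightarrow> norm xm \<le> norm x"
    using continuous_attains_inf[OF A _ continuous_on_norm[OF continuous_on_id]] zA by blast
  define m where "m = norm xm"
  have m: "m > 0" using xm AS S0 by (auto simp: m_def)
  define D0 where "D0 = min 1 (p - 1) * m^2 * R^2"
  have D0: "D0 > 0" using p m R by (simp add: D0_def)
  define \<alpha> where "\<alpha> = (2 * (real DIM('a) + p) * B^2 + 2 * C * R + 1) / D0"
  have num: "2 * (real DIM('a) + p) * B^2 + 2 * C * R \<ge> 0" using p C R by simp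
  have \<alpha>: "\<alpha> > 0" "\<alpha> * (min 1 (p - 1) * m^2 * R^2) > 2 * (real DIM('a) + p) * B^2 + 2 * C * R"
    using num D0 unfolding D0_def[symmetric] by (simp_all add: \<alpha>_def)
  define h where "h = (\<lambda>x. exp (- \<alpha> * ((x - y) \<bullet> (x - y))) - exp (- \<alpha> * R^2))"
  define Gh where "Gh = (\<lambda>x. (- 2 * \<alpha> * exp (- \<alpha> * ((x - y) \<bullet> (x - y)))) *\<^sub>R (x - y))"
  define Hh where "Hh = (\<lambda>x h. exp (- \<alpha> * ((x - y) \<bullet> (x - y))) *\<^sub>R ((4 * \<alpha>^2) *\<^sub>R (((x - y) \<bullet> h) *\<^sub>R (x - y)) - (2 * \<alpha>) *\<^sub>R h))"
  have Dh: "C2_data S h Gh Hh"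
    unfolding h_def Gh_def Hh_def by (rule C2_data_gaussian[OF oS])
  have sub: "C * norm (Gh x) < p_op p x (Hh x)" if x: "x \<in> A" for x
    unfolding Gh_def Hh_def
    by (rule barrier_subsolution[OF p m _ _ R(1) _ _ C(1) \<alpha>]) (use x xm B in \<open>auto simp: m_def A_def\<close>)
  have h1: "h x \<le> 1" for x
  proof -
    have "exp (- \<alpha> * ((x - y) \<bullet> (x - y))) \<le> 1" using \<alpha> by simp
    then show ?thesis unfolding h_def using exp_gt_zero[of "- \<alpha> * R^2"] by linarith
  qed
  define A0 where "A0 = {x. norm (x - y) = R / 2}"
  have A0: "compact A0" "A0 \<noteq> {}"
  proof -
    have "A0 = sphere y (R / 2)" by (auto simp: A0_def dist_norm norm_minus_commute)
    then show "compact A0" "A0 \<noteq> {}" using R by auto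
  qed
  have A0b: "A0 \<subseteq> ball y R" using R by (auto simp: A0_def dist_norm norm_minus_commute)
  have A0S: "A0 \<subseteq> S" using A0b R(2) ball_subset_cball by blast
  obtain x1 where x1: "x1 \<in> A0" "\<And>x. x \<in> A0 \<Longrightarrow> w x \<le> w x1"
    using continuous_attains_sup[OF A0, of w] C2_data_cont(1)[OF D] A0S continuous_on_subset by blast
  define \<epsilon> where "\<epsilon> = - w x1"
  have \<epsilon>: "\<epsilon> > 0" using neg[of x1] x1 A0b by (auto simp: \<epsilon>_def)
  define f where "f = (\<lambda>x. w x + \<epsilon> * h x)"
  have Df: "C2_data S f (\<lambda>x. G x + \<epsilon> *\<^sub>R Gh x) (\<lambda>x k. H x k + \<epsilon> *\<^sub>R Hh x k)"
    unfolding f_def by (rule C2_data_add[OF D C2_data_cmult[OF Dh]])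
  have fle: "f x \<le> 0" if x: "x \<in> A" for x
  proof (rule ccontr)
    assume "\<not> f x \<le> 0"
    obtain x2 where x2: "x2 \<in> A" "\<And>x. x \<in> A \<Longrightarrow> f x \<le> f x2"
      using continuous_attains_sup[OF A, of f] x C2_data_cont(1)[OF Df] AS continuous_on_subset by blast
    have f2: "f x2 > 0" using x2(2)[OF x] \<open>\<not> f x \<le> 0\<close> by linarith
    have x2S: "x2 \<in> S" using x2 AS by auto
    have n1: "norm (x2 - y) \<noteq> R / 2"
    proof
      assume "norm (x2 - y) = R / 2"
      then have "w x2 \<le> - \<epsilon>" using x1(2)[of x2] by (simp add: A0_def \<epsilon>_def)
      moreover have "\<epsilon> * h x2 \<le> \<epsilon>" using \<epsilon> h1[of x2] by simp
      ultimately show False using f2 by (simp add: f_def)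
    qed
    have n2: "norm (x2 - y) \<noteq> R"
    proof
      assume "norm (x2 - y) = R"
      then have "h x2 = 0" by (simp add: h_def dot_square_norm)
      then show False using f2 le[OF x2S] by (simp add: f_def)
    qed
    \<comment> \<open>The maximum lies on neither boundary sphere of \<open>A\<close>: on the inner one \<open>w \<le> - \<epsilon>\<close>, on the outer one \<open>h = 0\<close>.\<close>
    define r where "r = min (norm (x2 - y) - R / 2) (R - norm (x2 - y))"
    have r: "r > 0" using n1 n2 x2(1) by (simp add: r_def A_def)
    have mx: "f x' \<le> f x2" if "x' \<in> ball x2 r" for x'
    proof (rule x2(2))
      have "norm (x' - x2) < r" using that by (simp add: dist_norm norm_minus_commute)
      moreover have "norm (x' - y) \<le> norm (x' - x2) + norm (x2 - y)"
        "norm (x2 - y) \<le> norm (x' - x2) + norm (x' - y)"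
        using norm_triangle_ineq[of "x' - x2" "x2 - y"] norm_triangle_ineq[of "x2 - x'" "x' - y"]
        by (simp_all add: norm_minus_commute)
      ultimately show "x' \<in> A" unfolding A_def r_def by auto
    qed
    note t = local_max_gradient_Hessian[OF Df x2S r mx]
    have "p_op p x2 (\<lambda>k. H x2 k + \<epsilon> *\<^sub>R Hh x2 k) \<le> 0"
      by (rule p_op_nonpos[OF C2_dataD(3)[OF Df x2S] t(2) p])
    then have "p_op p x2 (H x2) + \<epsilon> * p_op p x2 (Hh x2) \<le> 0"
      by (simp add: p_op_add p_op_scale)
    moreover have "norm (G x2) = \<epsilon> * norm (Gh x2)"
    proof -
      have "G x2 = - (\<epsilon> *\<^sub>R Gh x2)" using t(1) by (simp add: eq_neg_iff_add_eq_0)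
      then show ?thesis using \<epsilon> by simp
    qed
    moreover have "\<epsilon> * (C * norm (Gh x2)) < \<epsilon> * p_op p x2 (Hh x2)"
      using sub[OF x2(1)] \<epsilon> by simp
    ultimately show False using C(2)[OF x2(1)] by (simp add: mult_ac)
  qed
  have zS: "z \<in> S" using zA AS by auto
  obtain r where r: "r > 0" "ball z r \<subseteq> S" using oS zS open_contains_ball by blast
  have Gz: "G z = 0"
    by (rule local_max_gradient_Hessian(1)[OF D zS r(1)]) (use r le z in auto)
  define \<phi> where "\<phi> = (\<lambda>t. f (z + t *\<^sub>R (y - z)))"
  have "(\<phi> has_real_derivative (G (z + 0 *\<^sub>R (y - z)) + \<epsilon> *\<^sub>R Gh (z + 0 *\<^sub>R (y - z))) \<bullet> (y - z)) (at 0)"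
    unfolding \<phi>_def by (rule C2_data_line(1)[OF Df]) (use zS in simp)
  moreover have "(G (z + 0 *\<^sub>R (y - z)) + \<epsilon> *\<^sub>R Gh (z + 0 *\<^sub>R (y - z))) \<bullet> (y - z)
     = \<epsilon> * (2 * \<alpha> * exp (- \<alpha> * R^2) * R^2)"
  proof -
    have 1: "(z - y) \<bullet> (z - y) = R^2" using z by (simp add: dot_square_norm)
    have 2: "(z - y) \<bullet> (y - z) = - (R^2)"
      using 1 by (metis inner_minus_right minus_diff_eq)
    show ?thesis using Gz by (simp add: Gh_def 1 2)
  qed
  moreover have "\<epsilon> * (2 * \<alpha> * exp (- \<alpha> * R^2) * R^2) > 0" using \<epsilon> \<alpha> R by simp
  ultimately obtain d where d: "d > 0" "\<And>t. 0 < t \<Longrightarrow> t < d \<Longrightarrow> \<phi> 0 < \<phi> (0 + t)"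
    using DERIV_pos_inc_right[of \<phi> _ 0] by metis
  define t where "t = min (d / 2) (1 / 2)"
  have t: "0 < t" "t < d" "t \<le> 1 / 2" using d by (auto simp: t_def)
  have "z + t *\<^sub>R (y - z) - y = (1 - t) *\<^sub>R (z - y)" by (simp add: algebra_simps)
  then have "norm (z + t *\<^sub>R (y - z) - y) = (1 - t) * R" using t z by simp
  moreover have "R / 2 \<le> (1 - t) * R" "(1 - t) * R \<le> R"
    using t R mult_right_mono[of "1/2" "1 - t" R] by auto
  ultimately have "z + t *\<^sub>R (y - z) \<in> A" by (simp add: A_def)
  then have "\<phi> t \<le> 0" using fle by (simp add: \<phi>_def)
  moreover have "\<phi> 0 = 0" using z by (simp add: \<phi>_def f_def h_def dot_square_norm)
  ultimately show False using d(2)[of t] t by simp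
qed

text \<open>If the zero set were not open, a ball contained in the set where \<open>w < 0\<close> could be grown around a nearby
  point until it touches the zero set, which \<open>hopf_no_touching\<close> excludes.\<close>

lemma strong_maximum_principle:
  fixes w :: "'a::euclidean_space \<Rightarrow> real"
  assumes D: "C2_data S w G H" and S0: "0 \<notin> S" and p: "p > 1"
    and bound: "\<And>K. compact K \<Longrightarrow> K \<subseteq> S \<Longrightarrow> \<exists>C. \<forall>x\<in>K. \<bar>p_op p x (H x)\<bar> \<le> C * norm (G x)"
    and le: "\<And>x. x \<in> S \<Longrightarrow> w x \<le> 0" and z: "z \<in> S" "w z = 0" and conn: "connected S" and x: "x \<in> S"
  shows "w x = 0"
proof -
  have oS: "open S" using C2_data_open[OF D] .
  define Z where "Z = {x \<in> S. w x = 0}"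
  have "open Z"
    unfolding open_contains_ball
  proof
    fix q assume q: "q \<in> Z"
    then have "q \<in> S" by (simp add: Z_def)
    then obtain r0 where r0: "r0 > 0" "cball q r0 \<subseteq> S" using oS open_contains_cball by blast
    define r where "r = r0 / 2"
    have r: "r > 0" "r0 = 2 * r" using r0 by (auto simp: r_def)
    have "y \<in> Z" if y: "y \<in> ball q r" for y
    proof (rule ccontr)
      assume "y \<notin> Z"
      have yS: "y \<in> S" using y r r0(2) by auto
      define T where "T = {x \<in> cball q r0. w x = 0}"
      have "closed T"
      proof -
        have "continuous_on (cball q r0) w"
          using C2_data_cont(1)[OF D] r0 continuous_on_subset by blast
        then have "closed (cball q r0 \<inter> w -` {0})" by (intro continuous_closed_preimage) auto
        then show ?thesis unfolding T_def by (simp add: Int_def vimage_def)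
      qed
      moreover have qT: "q \<in> T" using q r0 by (simp add: T_def Z_def)
      ultimately obtain z' where z': "z' \<in> T" "\<And>t. t \<in> T \<Longrightarrow> dist y z' \<le> dist y t"
        using distance_attains_inf[of T y] by blast
      define R where "R = dist y z'"
      have "R \<le> dist y q" using z'(2)[OF qT] by (simp add: R_def)
      then have Rr: "R < r" using y by (simp add: dist_commute)
      have "z' \<noteq> y" using z' \<open>y \<notin> Z\<close> yS by (auto simp: T_def Z_def)
      then have R0: "R > 0" by (simp add: R_def)
      have cb: "cball y R \<subseteq> cball q r0"
      proof
        fix t assume "t \<in> cball y R"
        then show "t \<in> cball q r0"
          using dist_triangle[of q t y] y Rr r by (auto simp: dist_commute)
      qed
      have neg: "w t < 0" if t: "t \<in> ball y R" for t
      proof -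
        have "t \<in> cball q r0" using t cb ball_subset_cball by blast
        moreover have "t \<notin> T" using z'(2)[of t] t by (auto simp: R_def)
        ultimately have "w t \<noteq> 0" "t \<in> S" using r0 by (auto simp: T_def)
        then show ?thesis using le[of t] by simp
      qed
      show False
        by (rule hopf_no_touching[OF D S0 p bound R0 _ neg le, where z = z'])
          (use cb r0 z' in \<open>auto simp: T_def R_def dist_norm norm_minus_commute\<close>)
    qed
    then show "\<exists>e>0. ball q e \<subseteq> Z" using r by blast
  qed
  moreover have "open (S - Z)"
  proof -
    have "open (S \<inter> w -` (- {0}))"
      using C2_data_cont(1)[OF D] oS by (intro continuous_open_preimage) auto
    moreover have "S - Z = S \<inter> w -` (- {0})" by (auto simp: Z_def)
    ultimately show ?thesis by simp
  qed
  moreover have "Z \<union> (S - Z) = S" "Z \<inter> (S - Z) = {}" "Z \<noteq> {}" by (use z in \<open>auto simp: Z_def\<close>)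
  ultimately have "S - Z = {}"
    using conn unfolding connected_def by blast
  then show ?thesis using x by (auto simp: Z_def)
qed

section \<open>Comparison with powers of the distance to a point\<close>

definition radial_power :: "'a::euclidean_space \<Rightarrow> real \<Rightarrow> real \<Rightarrow> 'a \<Rightarrow> real" where
  "radial_power c M a x = M * norm (x - c) powr (- a)"

definition radial_slope :: "'a::euclidean_space \<Rightarrow> real \<Rightarrow> real \<Rightarrow> 'a \<Rightarrow> real" where
  "radial_slope c M a x = - (a * M * ((x - c) \<bullet> (x - c)) powr (- a / 2 - 1))"

definition radial_Hessian :: "'a::euclidean_space \<Rightarrow> real \<Rightarrow> real \<Rightarrow> 'a \<Rightarrow> 'a \<Rightarrow> 'a" where
  "radial_Hessian c M a x h = (a * (a + 2) * M * ((x - c) \<bullet> (x - c)) powr (- a / 2 - 2)) *\<^sub>R (((x - c) \<bullet> h) *\<^sub>R (x - c))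
     + radial_slope c M a x *\<^sub>R h"

lemma C2_data_radial_power:
  assumes "open U" "c \<notin> U"
  shows "C2_data U (radial_power c M a) (\<lambda>x. radial_slope c M a x *\<^sub>R (x - c)) (radial_Hessian c M a)"
proof -
  have pos: "(x - c) \<bullet> (x - c) > 0" if "x \<in> U" for x
    using that assms by (metis inner_gt_zero_iff right_minus_eq)
  have "C2_data U (\<lambda>x. M * ((x - c) \<bullet> (x - c)) powr (- a / 2))
     (\<lambda>x. (- (a / 2 * M * ((x - c) \<bullet> (x - c)) powr (- a / 2 - 1))) *\<^sub>R 2 *\<^sub>R (x - c))
     (\<lambda>x h. (a / 2 * (a / 2 + 1) * M * ((x - c) \<bullet> (x - c)) powr (- a / 2 - 2) * (2 *\<^sub>R (x - c) \<bullet> h)) *\<^sub>R 2 *\<^sub>R (x - c)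
       + (- (a / 2 * M * ((x - c) \<bullet> (x - c)) powr (- a / 2 - 1))) *\<^sub>R 2 *\<^sub>R h)"
  proof (rule C2_data_comp[OF C2_data_norm_square[OF assms(1)]])
    fix x assume "x \<in> U"
    then have t: "(x - c) \<bullet> (x - c) > 0" by (rule pos)
    show "((\<lambda>t. M * t powr (- a / 2)) has_real_derivative
        - (a / 2 * M * ((x - c) \<bullet> (x - c)) powr (- a / 2 - 1))) (at ((x - c) \<bullet> (x - c)))"
      using DERIV_cmult[OF has_real_derivative_powr[OF t, of "- a / 2"], of M] by (simp add: mult_ac)
    have d1: "((\<lambda>t. (- (a / 2 * M)) * t powr (- a / 2 - 1)) has_real_derivative
        (- (a / 2 * M)) * ((- a / 2 - 1) * ((x - c) \<bullet> (x - c)) powr (- a / 2 - 1 - 1))) (at ((x - c) \<bullet> (x - c)))"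
      by (rule DERIV_cmult[OF has_real_derivative_powr[OF t, of "- a / 2 - 1"], of "- (a / 2 * M)"])
    have e1: "(\<lambda>t. (- (a / 2 * M)) * t powr (- a / 2 - 1)) = (\<lambda>t. - (a / 2 * M * t powr (- a / 2 - 1)))"
      by (simp only: mult_minus_left)
    have e2: "(- (a / 2 * M)) * ((- a / 2 - 1) * ((x - c) \<bullet> (x - c)) powr (- a / 2 - 1 - 1))
        = a / 2 * (a / 2 + 1) * M * ((x - c) \<bullet> (x - c)) powr (- a / 2 - 2)"
    proof -
      have 1: "(- (a / 2 * M)) * ((- a / 2 - 1) * T) = a / 2 * (a / 2 + 1) * M * T" for T
        by (simp add: field_simps)
      have 2: "- a / 2 - 1 - 1 = - a / 2 - 2" by simp
      show ?thesis unfolding 1 2 ..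
    qed
    show "((\<lambda>t. - (a / 2 * M * t powr (- a / 2 - 1))) has_real_derivative
        a / 2 * (a / 2 + 1) * M * ((x - c) \<bullet> (x - c)) powr (- a / 2 - 2)) (at ((x - c) \<bullet> (x - c)))"
      using d1 unfolding e1 e2 .
  next
    have "t \<noteq> 0" if "t \<in> (\<lambda>x. (x - c) \<bullet> (x - c)) ` U" for t
      using that by (auto dest!: pos)
    then show "continuous_on ((\<lambda>x. (x - c) \<bullet> (x - c)) ` U) (\<lambda>t. a / 2 * (a / 2 + 1) * M * t powr (- a / 2 - 2))"
      by (intro continuous_intros) auto
  qed
  moreover have "radial_power c M a = (\<lambda>x. M * ((x - c) \<bullet> (x - c)) powr (- a / 2))"
  proof
    fix x
    show "radial_power c M a x = M * ((x - c) \<bullet> (x - c)) powr (- a / 2)"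
    proof (cases "x = c")
      case False
      then have "(x - c) \<bullet> (x - c) = norm (x - c) powr 2"
        by (simp add: dot_square_norm powr_numeral)
      then show ?thesis by (simp only: radial_power_def powr_powr) simp
    qed (simp add: radial_power_def)
  qed
  moreover have "(- (a / 2 * M * ((x - c) \<bullet> (x - c)) powr (- a / 2 - 1))) *\<^sub>R 2 *\<^sub>R h = radial_slope c M a x *\<^sub>R h" for x h :: 'a
  proof -
    have "(- (a / 2 * M * T)) * 2 = - (a * M * T)" for T by simp
    then show ?thesis by (simp only: radial_slope_def scaleR_scaleR)
  qed
  moreover have "(a / 2 * (a / 2 + 1) * M * T * (2 *\<^sub>R d \<bullet> h)) *\<^sub>R 2 *\<^sub>R d = (a * (a + 2) * M * T) *\<^sub>R ((d \<bullet> h) *\<^sub>R d)" for T and d h :: 'a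
  proof -
    have "a / 2 * (a / 2 + 1) * M * T * (2 * (d \<bullet> h)) * 2 = a * (a + 2) * M * T * (d \<bullet> h)"
      by (simp add: field_simps)
    then show ?thesis by (simp only: scaleR_scaleR inner_scaleR_left)
  qed
  ultimately show ?thesis
    by (simp only: radial_Hessian_def[abs_def])
qed

text \<open>The last factor vanishes exactly for the decay exponent \<open>a = (n - p) / (p - 1)\<close>: smaller
  exponents give strict supersolutions, larger ones strict subsolutions.\<close>

lemma p_op_radial_power:
  fixes x c :: "'a::euclidean_space"
  assumes "x \<noteq> c"
  shows "p_op p (radial_slope c M a x *\<^sub>R (x - c)) (radial_Hessian c M a x)
    = (radial_slope c M a x)^2 * (a * M * norm (x - c) powr (- a)) * (a * (p - 1) - (real DIM('a) - p))"
proof -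
  define d where "d = x - c"
  define t where "t = d \<bullet> d"
  have t: "t > 0" using assms by (simp add: t_def d_def)
  have l: "linear (radial_Hessian c M a x)"
    unfolding radial_Hessian_def
    by (intro linearI) (simp_all add: inner_add_right algebra_simps)
  have nt: "norm d powr (- a) = t powr (- a / 2)"
  proof -
    have "t = norm d powr 2"
      using assms by (simp add: t_def d_def dot_square_norm powr_numeral)
    then show ?thesis by (simp only: powr_powr) simp
  qed
  have p1: "t powr (- a / 2 - 1) = t powr (- a / 2) / t"
    using t by (simp add: powr_diff)
  have p2: "t powr (- a / 2 - 2) = t powr (- a / 2) / t^2"
    using t by (simp add: powr_diff powr_numeral)
  have H: "radial_Hessian c M a x = (\<lambda>h. (a * (a + 2) * M * t powr (- a / 2 - 2)) *\<^sub>R ((d \<bullet> h) *\<^sub>R d) + radial_slope c M a x *\<^sub>R h)"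
    by (simp add: radial_Hessian_def d_def t_def fun_eq_iff)
  have "p_op p d (radial_Hessian c M a x) = a * (a + 2) * M * t powr (- a / 2 - 2) * (t * t + (p - 2) * t^2)
      + radial_slope c M a x * ((real DIM('a) + p - 2) * t)"
    unfolding H by (simp only: p_op_add p_op_scale p_op_rank_one p_op_id t_def)
  also have "\<dots> = a * M * t powr (- a / 2) * (a * (p - 1) - (real DIM('a) - p))"
    unfolding p2 radial_slope_def d_def[symmetric] t_def[symmetric] p1 using t
    by (simp add: power2_eq_square field_simps)
  finally show ?thesis
    unfolding d_def[symmetric] p_op_scale_vector[OF l] nt by simp
qed

lemma radial_power_at_infinity:
  assumes "a > 0" shows "(radial_power c M a \<longlongrightarrow> 0) at_infinity"
proof -
  have "filterlim (\<lambda>x. norm (x - c)) at_top at_infinity"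
  proof (rule filterlim_at_top_mono[where f = "\<lambda>x. norm x - norm c"])
    show "filterlim (\<lambda>x::'a. norm x - norm c) at_top at_infinity"
      using filterlim_tendsto_add_at_top[OF tendsto_const filterlim_norm_at_top, of "- norm c"] by simp
    show "\<forall>\<^sub>F x in at_infinity. norm x - norm c \<le> norm (x - c)"
      by (simp add: norm_triangle_ineq2)
  qed
  then have "((\<lambda>x. norm (x - c) powr (- a)) \<longlongrightarrow> 0) at_infinity"
    using tendsto_neg_powr[of "- a" "\<lambda>x. norm (x - c)" at_infinity] assms by simp
  then show ?thesis
    using tendsto_mult_right_zero unfolding radial_power_def[abs_def] by blast
qed

text \<open>At a positive interior extremum of the difference the gradient of \<open>u\<close> is that of the radial power, so
  it is not zero, and the strict inequality for the radial power contradicts the second order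
  condition. The sign \<open>\<sigma>\<close> covers upper and lower bounds together. The points of \<open>E\<close> outside \<open>D\<close>, where
  \<open>u\<close> need not solve the equation, are treated like boundary points.\<close>

lemma comparison_radial_power:
  fixes u :: "'a::euclidean_space \<Rightarrow> real"
  assumes D: "C2_data D u G H" and pu: "\<And>x. x \<in> D \<Longrightarrow> p_op p (G x) (H x) = 0"
    and cu: "continuous_on UNIV u" and inf: "(u \<longlongrightarrow> 0) at_infinity"
    and p: "p > 1" and a: "a > 0" and M: "M > 0"
    and \<sigma>: "\<sigma> = 1 \<or> \<sigma> = -1" "\<sigma> * (a * (p - 1) - (real DIM('a) - p)) < 0"
    and E: "open E" "c \<notin> closure E"
    and bd: "\<And>x. x \<in> closure E \<Longrightarrow> x \<notin> E \<inter> D \<Longrightarrow> \<sigma> * (u x - radial_power c M a x) \<le> 0"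
    and x: "x \<in> E"
  shows "\<sigma> * (u x - radial_power c M a x) \<le> 0"
proof (rule ccontr)
  let ?V = "radial_power c M a"
  define f where "f = (\<lambda>x. \<sigma> * (u x - ?V x))"
  assume "\<not> ?thesis"
  then have fx: "f x > 0" by (simp add: f_def)
  have "(f \<longlongrightarrow> \<sigma> * (0 - 0)) at_infinity"
    unfolding f_def by (intro tendsto_intros inf radial_power_at_infinity a)
  then have "\<forall>\<^sub>F y in at_infinity. f y < f x"
    using fx by (intro order_tendstoD(2)) auto
  then obtain B where B: "\<And>y. B \<le> norm y \<Longrightarrow> f y < f x"
    unfolding eventually_at_infinity by blast
  have cf: "continuous_on (closure E) f"
    unfolding f_def radial_power_def
    using E(2) cu by (intro continuous_intros) (auto intro: continuous_on_subset)
  define T where "T = closure E \<inter> f -` {f x..}"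
  have "closed T"
    unfolding T_def by (intro continuous_closed_preimage cf) auto
  moreover have "T \<subseteq> ball 0 B"
    using B by (force simp: T_def not_le[symmetric])
  ultimately have "compact T"
    using bounded_subset[OF bounded_ball] compact_eq_bounded_closed by blast
  moreover have xT: "x \<in> T" using x closure_subset by (auto simp: T_def)
  moreover have "continuous_on T f" using cf by (rule continuous_on_subset) (auto simp: T_def)
  ultimately obtain y where y: "y \<in> T" "\<And>t. t \<in> T \<Longrightarrow> f t \<le> f y"
    using continuous_attains_sup[of T f] by blast
  have fy: "f y > 0" using y(1) fx by (auto simp: T_def)
  have mx: "f t \<le> f y" if "t \<in> closure E" for t
    using that y(1) y(2)[of t] by (cases "f x \<le> f t") (auto simp: T_def)
  define W where "W = E \<inter> D"
  have yW: "y \<in> W"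
    using bd[of y] fy y(1) by (force simp: T_def f_def W_def)
  have oW: "open W" using E C2_data_open[OF D] by (auto simp: W_def)
  have cW: "c \<notin> W" using E closure_subset by (auto simp: W_def)
  have "C2_data W u G H" by (rule C2_data_subset[OF D _ oW]) (auto simp: W_def)
  note Df = C2_data_cmult[OF C2_data_diff[OF this C2_data_radial_power[OF oW cW, of M a]], of \<sigma>, folded f_def]
  obtain r where r: "r > 0" "ball y r \<subseteq> W" using oW yW open_contains_ball by blast
  have mr: "f t \<le> f y" if "t \<in> ball y r" for t
  proof (rule mx)
    have "t \<in> W" using that r(2) by blast
    then show "t \<in> closure E" using closure_subset[of E] by (auto simp: W_def)
  qed
  note L = local_max_gradient_Hessian[OF Df yW r(1) mr]
  have Gy: "G y = radial_slope c M a y *\<^sub>R (y - c)" using L(1) \<sigma>(1) by auto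
  have yc: "y \<noteq> c" using yW cW by auto
  have "p_op p (G y) (\<lambda>h. \<sigma> *\<^sub>R (H y h - radial_Hessian c M a y h)) \<le> 0"
    by (rule p_op_nonpos[OF C2_dataD(3)[OF Df yW] L(2) p])
  then have "\<sigma> * (p_op p (G y) (H y) - p_op p (G y) (radial_Hessian c M a y)) \<le> 0"
    by (simp only: p_op_scale p_op_diff)
  then have le: "0 \<le> \<sigma> * p_op p (G y) (radial_Hessian c M a y)"
    using pu[of y] yW by (simp add: W_def)
  have "(radial_slope c M a y)^2 > 0"
    using a M yc by (simp add: radial_slope_def)
  then have pos: "(radial_slope c M a y)^2 * (a * M * norm (y - c) powr (- a)) > 0"
    using a M yc by simp
  have "\<sigma> * p_op p (G y) (radial_Hessian c M a y)
     = (radial_slope c M a y)^2 * (a * M * norm (y - c) powr (- a)) * (\<sigma> * (a * (p - 1) - (real DIM('a) - p)))"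
    unfolding Gy p_op_radial_power[OF yc] by (simp add: mult_ac)
  also have "\<dots> < 0" using pos \<sigma>(2) by (rule mult_pos_neg)
  finally show False using le by simp
qed

section \<open>Potentials with two homothetic level sets\<close>

text \<open>The set \<open>K\<close> is the closure of \<open>\<Omega>\<close>, moved so that the fixed point of the homothety is the origin.\<close>

locale p_potential =
  fixes p :: real and K :: "'a::euclidean_space set"
    and u :: "'a \<Rightarrow> real" and G :: "'a \<Rightarrow> 'a" and H :: "'a \<Rightarrow> 'a \<Rightarrow> 'a"
  assumes dim: "2 \<le> DIM('a)" and p: "1 < p" "p < real DIM('a)"
    and K: "compact K" "interior K \<noteq> {}"
    and data: "C2_data (- K) u G H"
    and harmonic: "\<And>x. x \<notin> K \<Longrightarrow> p_op p (G x) (H x) = 0"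
    and cont: "continuous_on UNIV u"
    and one: "\<And>x. x \<in> K \<Longrightarrow> u x = 1"
    and at_inf: "(u \<longlongrightarrow> 0) at_infinity"
begin

definition decay :: real where "decay = (real DIM('a) - p) / (p - 1)"

lemma decay_pos: "decay > 0"
  using p by (simp add: decay_def)

lemma decay_sign:
  "a < decay \<Longrightarrow> a * (p - 1) - (real DIM('a) - p) < 0"
  "decay < a \<Longrightarrow> 0 < a * (p - 1) - (real DIM('a) - p)"
  "decay * (p - 1) - (real DIM('a) - p) = 0"
  using p by (simp_all add: decay_def field_simps)

abbreviation radial :: "real \<Rightarrow> 'a \<Rightarrow> real" where
  "radial C \<equiv> radial_power 0 C decay"

abbreviation radial_grad :: "real \<Rightarrow> 'a \<Rightarrow> 'a" where
  "radial_grad C x \<equiv> radial_slope 0 C decay x *\<^sub>R (x - 0)"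

lemma closure_outside_ball:
  fixes x :: 'a
  assumes "x \<in> closure {x. m < norm x}"
  shows "m \<le> norm x"
proof -
  have "closure {x::'a. m < norm x} \<subseteq> {x. m \<le> norm x}"
    by (rule closure_minimal) (auto intro!: closed_Collect_le continuous_intros)
  then show ?thesis using assms by auto
qed

lemma tendsto_ratio_powr: "t > 0 \<Longrightarrow> ((\<lambda>a. s * t powr a) \<longlongrightarrow> s * t powr decay) (at decay within A)"
  by (intro tendsto_intros) auto

lemma radial_power_ratio:
  assumes "m > 0" "x \<noteq> 0"
  shows "radial_power 0 (s * m powr a) a x = s * (m / norm x) powr a"
  using assms by (simp add: radial_power_def powr_divide powr_minus_divide)

text \<open>Comparison with the strict supersolutions \<open>s (m / |x|)\<^sup>a\<close>, \<open>a < decay\<close>, all of which equal \<open>s\<close> on the sphere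
  of radius \<open>m\<close>; then let \<open>a\<close> increase to \<open>decay\<close>.\<close>

lemma upper_bound:
  assumes m: "m > 0" "{x. m < norm x} \<subseteq> - K" and s: "s > 0" "\<And>x. norm x = m \<Longrightarrow> u x \<le> s"
    and x: "m < norm x"
  shows "u x \<le> radial_power 0 (s * m powr decay) decay x"
proof -
  have x0: "x \<noteq> 0" using x m by auto
  have bound: "u x \<le> s * (m / norm x) powr a" if a: "0 < a" "a < decay" for a
  proof -
    have "1 * (u x - radial_power 0 (s * m powr a) a x) \<le> 0"
    proof (rule comparison_radial_power[OF data _ cont at_inf p(1) a(1)])
      show "open {x::'a. m < norm x}" by (intro open_Collect_less continuous_intros)
      show "0 \<notin> closure {x::'a. m < norm x}" using closure_outside_ball[of 0 m] m by auto
      fix y assume y: "y \<in> closure {x. m < norm x}" "y \<notin> {x. m < norm x} \<inter> - K"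
      then have "\<not> m < norm y" using m(2) by blast
      then have "norm y = m" using closure_outside_ball[OF y(1)] by linarith
      moreover from this have "y \<noteq> 0" using m by auto
      ultimately show "1 * (u y - radial_power 0 (s * m powr a) a y) \<le> 0"
        using s(2)[of y] m by (simp add: radial_power_ratio)
    qed (use a m s x decay_sign(1)[of a] harmonic in auto)
    then show ?thesis using radial_power_ratio[OF m(1) x0] by simp
  qed
  have "u x \<le> s * (m / norm x) powr decay"
  proof (rule tendsto_lowerbound[OF tendsto_ratio_powr])
    show "m / norm x > 0" using m x0 by simp
    show "\<forall>\<^sub>F a in at_left decay. u x \<le> s * (m / norm x) powr a"
      using eventually_at_left_real[OF decay_pos] by eventually_elim (use bound in auto)
  qed simp
  then show ?thesis using radial_power_ratio[OF m(1) x0] by simp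
qed

text \<open>As for \<open>upper_bound\<close>, with \<open>a\<close> decreasing to \<open>decay\<close>. The region \<open>|x| > m\<close> may meet \<open>K\<close> here, which is
  harmless since \<open>u = 1 \<ge> s\<close> on \<open>K\<close>.\<close>

lemma lower_bound:
  assumes m: "m > 0" and s: "0 < s" "s \<le> 1" "\<And>x. norm x = m \<Longrightarrow> s \<le> u x"
    and x: "m < norm x"
  shows "radial_power 0 (s * m powr decay) decay x \<le> u x"
proof -
  have x0: "x \<noteq> 0" using x m by auto
  have bound: "s * (m / norm x) powr a \<le> u x" if a: "decay < a" for a
  proof -
    have a0: "a > 0" using a decay_pos by simp
    have "-1 * (u x - radial_power 0 (s * m powr a) a x) \<le> 0"
    proof (rule comparison_radial_power[OF data _ cont at_inf p(1) a0])
      show "open {x::'a. m < norm x}" by (intro open_Collect_less continuous_intros)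
      show "0 \<notin> closure {x::'a. m < norm x}" using closure_outside_ball[of 0 m] m by auto
      fix y assume y: "y \<in> closure {x. m < norm x}" "y \<notin> {x. m < norm x} \<inter> - K"
      have my: "m \<le> norm y" using closure_outside_ball[OF y(1)] .
      then have y0: "y \<noteq> 0" using m by auto
      have "(m / norm y) powr a \<le> 1"
        using my m y0 a0 by (intro powr_le1) auto
      then have "s * (m / norm y) powr a \<le> s"
        using s by (simp add: mult_left_le)
      moreover have "s \<le> u y"
        using y my s(2,3) one[of y] by (cases "y \<in> K") auto
      ultimately show "-1 * (u y - radial_power 0 (s * m powr a) a y) \<le> 0"
        using m y0 by (simp add: radial_power_ratio)
    qed (use a m s x decay_sign(2)[of a] harmonic in auto)
    then show ?thesis using radial_power_ratio[OF m(1) x0] by simp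
  qed
  have "s * (m / norm x) powr decay \<le> u x"
  proof (rule tendsto_upperbound[OF tendsto_ratio_powr])
    show "m / norm x > 0" using m x0 by simp
    show "\<forall>\<^sub>F a in at_right decay. s * (m / norm x) powr a \<le> u x"
      using eventually_at_right_less[of decay] by eventually_elim (use bound in auto)
  qed simp
  then show ?thesis using radial_power_ratio[OF m(1) x0] by simp
qed

text \<open>Comparison with \<open>(d / |x - y|)\<^sup>a\<close> for a point \<open>y\<close> in the interior of \<open>K\<close>. These functions are at least \<open>1\<close> on
  \<open>K\<close> and tend to \<open>1\<close> as \<open>a\<close> tends to \<open>0\<close>.\<close>

lemma le_one: "u x \<le> 1"
proof (cases "x \<in> K")
  case False
  obtain y where y: "y \<in> interior K" using K(2) by auto
  have yK: "y \<in> K" using y interior_subset by auto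
  obtain d where d: "d > 0" "\<And>z. z \<in> K \<Longrightarrow> norm (z - y) \<le> d"
  proof -
    have "bounded ((\<lambda>z. z - y) ` K)"
      using K(1) by (intro compact_imp_bounded compact_continuous_image continuous_intros)
    then show ?thesis using that unfolding bounded_pos by auto
  qed
  have xy: "x \<noteq> y" using False yK by auto
  have eq: "radial_power y (d powr a) a z = (d / norm (z - y)) powr a" if "z \<noteq> y" for z a
    using that d by (simp add: radial_power_def powr_divide powr_minus_divide)
  have ycl: "y \<notin> closure (- K)" using y by (simp add: closure_complement)
  have bound: "u x \<le> (d / norm (x - y)) powr a" if a: "0 < a" "a < decay" for a
  proof -
    have "1 * (u x - radial_power y (d powr a) a x) \<le> 0"
    proof (rule comparison_radial_power[OF data _ cont at_inf p(1) a(1)])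
      show "open (- K)" using K by (simp add: compact_imp_closed open_Compl)
      fix z assume z: "z \<in> closure (- K)" "z \<notin> - K \<inter> - K"
      then have zK: "z \<in> K" and zy: "z \<noteq> y" using ycl by auto
      have "1 \<le> d / norm (z - y)" using d(2)[OF zK] zy by simp
      then have "1 \<le> (d / norm (z - y)) powr a" using a by (simp add: ge_one_powr_ge_zero)
      then show "1 * (u z - radial_power y (d powr a) a z) \<le> 0"
        using one[OF zK] eq[OF zy] by simp
    qed (use a d False ycl decay_sign(1)[of a] harmonic in auto)
    then show ?thesis using eq[OF xy] by simp
  qed
  have "((\<lambda>a. (d / norm (x - y)) powr a) \<longlongrightarrow> (d / norm (x - y)) powr 0) (at_right 0)"
    using d xy by (intro tendsto_intros) auto
  moreover have "\<forall>\<^sub>F a in at_right 0. u x \<le> (d / norm (x - y)) powr a"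
    using eventually_at_right_real[OF decay_pos] by eventually_elim (use bound in auto)
  ultimately have "u x \<le> (d / norm (x - y)) powr 0"
    by (rule tendsto_lowerbound) simp
  then show ?thesis using d xy by simp
qed (simp add: one)

lemma radial_slope_nonzero: "C > 0 \<Longrightarrow> x \<noteq> 0 \<Longrightarrow> radial_slope 0 C decay x \<noteq> 0"
  using decay_pos by (simp add: radial_slope_def)

text \<open>The difference between \<open>u\<close> and the \<open>p\<close>-harmonic radial power satisfies the differential inequality
  required by the strong maximum principle and by unique continuation.\<close>

lemma difference_data:
  assumes "open S" "S \<subseteq> - K" "0 \<notin> S" and C: "C > 0"
  shows "C2_data S (\<lambda>x. u x - radial C x)
      (\<lambda>x. G x - radial_grad C x) (\<lambda>x h. H x h - radial_Hessian 0 C decay x h)"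
    and "\<And>A. compact A \<Longrightarrow> A \<subseteq> S \<Longrightarrow>
      \<exists>B. \<forall>x\<in>A. \<bar>p_op p x (\<lambda>h. H x h - radial_Hessian 0 C decay x h)\<bar> \<le> B * norm (G x - radial_grad C x)"
proof -
  note Du = C2_data_subset[OF data assms(2,1)]
  note Dv = C2_data_radial_power[OF assms(1,3), of C decay]
  show "C2_data S (\<lambda>x. u x - radial C x)
      (\<lambda>x. G x - radial_grad C x) (\<lambda>x h. H x h - radial_Hessian 0 C decay x h)"
    by (rule C2_data_diff[OF Du Dv])
  fix A assume A: "compact A" "A \<subseteq> S"
  show "\<exists>B. \<forall>x\<in>A. \<bar>p_op p x (\<lambda>h. H x h - radial_Hessian 0 C decay x h)\<bar> \<le> B * norm (G x - radial_grad C x)"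
  proof (rule p_op_difference_bound[OF Du Dv _ _ _ _ _ A])
    show "p_op p (G x) (H x) = 0" if "x \<in> S" for x using that assms harmonic by auto
    show "p_op p (radial_grad C x) (radial_Hessian 0 C decay x) = 0" if "x \<in> S" for x
      using that assms(3) by (subst p_op_radial_power) (auto simp: decay_sign(3))
    show "radial_slope 0 C decay x \<noteq> 0" if "x \<in> S" for x
      using that assms(3) by (intro radial_slope_nonzero C) auto
    show "continuous_on S (radial_slope 0 C decay)"
      unfolding radial_slope_def using assms(3) by (intro continuous_intros) auto
  qed simp
qed

lemma radial_continuation:
  assumes C: "C > 0" and a0: "a0 \<ge> 0" "{x. a0 < norm x} \<subseteq> - K"
    and eq: "\<And>x. \<rho> < norm x \<Longrightarrow> u x = radial C x" and x: "a0 < norm x"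
  shows "u x = radial C x"
proof -
  define S where "S = {x::'a. a0 < norm x}"
  have S: "open S" "S \<subseteq> - K" "0 \<notin> S"
    using a0 by (auto simp: S_def intro!: open_Collect_less continuous_intros)
  note D = difference_data[OF S C]
  have "u x - radial C x = 0"
  proof (rule unique_continuation_spheres[OF D(1)[unfolded S_def] a0(1), of "p - 1"])
    fix A :: "'a set" assume A: "compact A" "A \<subseteq> {x. a0 < norm x}"
    define g where "g = (\<lambda>x. G x - radial_grad C x)"
    obtain B1 where B1: "\<And>x. x \<in> A \<Longrightarrow> \<bar>p_op p x (\<lambda>h. H x h - radial_Hessian 0 C decay x h)\<bar> \<le> B1 * norm (g x)"
      using D(2)[OF A[folded S_def]] unfolding g_def by blast
    obtain B2 where B2: "\<And>x. x \<in> A \<Longrightarrow> \<bar>norm x\<bar> \<le> B2"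
      using compact_abs_bound[OF A(1) continuous_on_norm[OF continuous_on_id]] by blast
    have "\<bar>cyl_op (p - 1) x (g x) (\<lambda>h. H x h - radial_Hessian 0 C decay x h)\<bar>
        \<le> (B1 + \<bar>p - real DIM('a)\<bar> * B2) * norm (g x)" if x: "x \<in> A" for x
    proof -
      have "\<bar>x \<bullet> g x\<bar> \<le> B2 * norm (g x)"
        using Cauchy_Schwarz_ineq2[of x "g x"] mult_right_mono[of "norm x" B2 "norm (g x)"] B2[OF x] by auto
      then have "\<bar>(p - real DIM('a)) * (x \<bullet> g x)\<bar> \<le> \<bar>p - real DIM('a)\<bar> * (B2 * norm (g x))"
        unfolding abs_mult by (intro mult_left_mono) auto
      then show ?thesis
        using B1[OF x] unfolding cyl_op_p_op by (simp add: algebra_simps)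
    qed
    then show "\<exists>C'. \<forall>x\<in>A. \<bar>cyl_op (p - 1) x (G x - radial_grad C x) (\<lambda>h. H x h - radial_Hessian 0 C decay x h)\<bar>
      \<le> C' * norm (G x - radial_grad C x)"
      unfolding g_def by blast
  qed (use p eq x in auto)
  then show ?thesis by simp
qed

lemma tendsto_along_ray: "((\<lambda>t. u (t *\<^sub>R x)) \<longlongrightarrow> u x) (at 1 within A)"
proof -
  have "continuous_on UNIV (\<lambda>t. u (t *\<^sub>R x))"
    by (rule continuous_on_compose2[OF cont]) (auto intro!: continuous_intros)
  then have "isCont (\<lambda>t. u (t *\<^sub>R x)) 1"
    by (simp add: continuous_on_eq_continuous_at)
  then have "((\<lambda>t. u (t *\<^sub>R x)) \<longlongrightarrow> u (1 *\<^sub>R x)) (at 1)"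
    unfolding isCont_def .
  then show ?thesis by (simp add: Lim_at_imp_Lim_at_within)
qed

lemma radial_far_eq_closed:
  assumes \<rho>: "\<rho> > 0" and eq: "\<And>x. \<rho> < norm x \<Longrightarrow> u x = radial C x" and x: "\<rho> \<le> norm x"
  shows "u x = radial C x"
proof -
  have x0: "x \<noteq> 0" using \<rho> x by auto
  define f where "f = (\<lambda>t. u (t *\<^sub>R x) - radial C (t *\<^sub>R x))"
  have "(f \<longlongrightarrow> f 1) (at_right 1)"
    unfolding f_def radial_power_def
  proof (intro tendsto_intros)
    show "((\<lambda>t. u (t *\<^sub>R x)) \<longlongrightarrow> u (1 *\<^sub>R x)) (at_right 1)"
      using tendsto_along_ray by simp
  qed (use x0 in auto)
  moreover have "\<forall>\<^sub>F t in at_right 1. f t = 0"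
    using eventually_at_right_less[of 1]
  proof eventually_elim
    case (elim t)
    then have "1 * norm x < t * norm x" using x0 by (intro mult_strict_right_mono) auto
    then have "\<rho> < norm (t *\<^sub>R x)" using x elim by simp
    then show ?case using eq by (simp add: f_def)
  qed
  ultimately have "f 1 = 0"
    using tendsto_eventually tendsto_unique trivial_limit_at_right_real by metis
  then show ?thesis by (simp add: f_def)
qed

text \<open>\<open>R\<close> is the radius at which the radial power takes the value \<open>1\<close>. Let \<open>\<rho>\<close> be the smallest radius \<open>\<ge> R\<close> outside which
  \<open>u\<close> is the radial power. If \<open>\<rho> > R\<close>, then \<open>u < 1\<close> for \<open>|x| \<ge> \<rho>\<close>, so \<open>K\<close> has positive distance from this region
  and \<open>radial_continuation\<close> yields a smaller radius.\<close>

lemma sphere_subset: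
  assumes C: "C > 0" and m: "m \<ge> C powr (1 / decay)" and eq: "\<And>x. m < norm x \<Longrightarrow> u x = radial C x"
  shows "sphere 0 (C powr (1 / decay)) \<subseteq> K" "K \<subseteq> cball 0 (C powr (1 / decay))"
proof -
  define R where "R = C powr (1 / decay)"
  have R: "R > 0" using C by (simp add: R_def)
  have CR: "C = R powr decay" using decay_pos C by (simp add: R_def powr_powr)
  have v1: "radial C x = (R / norm x) powr decay" if "x \<noteq> 0" for x
    using radial_power_ratio[OF R that, of 1 decay] CR by simp
  have vlt: "radial C x < 1" if "R < norm x" for x
  proof -
    have "x \<noteq> 0" using that R by auto
    then have "(R / norm x) powr decay < 1 powr decay"
      using that R decay_pos by (intro powr_less_mono2) auto
    then show ?thesis using v1[OF \<open>x \<noteq> 0\<close>] by simp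
  qed
  define P where "P = {\<rho>. R \<le> \<rho> \<and> (\<forall>x. \<rho> < norm x \<longrightarrow> u x = radial C x)}"
  have mP: "m \<in> P" using m eq by (auto simp: P_def R_def)
  have Pb: "bdd_below P" by (auto simp: P_def)
  define \<rho> where "\<rho> = Inf P"
  have R\<rho>: "R \<le> \<rho>" unfolding \<rho>_def using mP by (intro cInf_greatest) (auto simp: P_def)
  have e1: "u x = radial C x" if "\<rho> < norm x" for x
  proof -
    have "P \<noteq> {}" using mP by auto
    from cInf_lessD[OF this that[unfolded \<rho>_def]] obtain t where "t \<in> P" "t < norm x" ..
    then show ?thesis by (auto simp: P_def)
  qed
  have \<rho>0: "\<rho> > 0" using R R\<rho> by simp
  note e2 = radial_far_eq_closed[OF \<rho>0 e1]
  have "\<rho> = R"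
  proof (rule ccontr)
    assume "\<rho> \<noteq> R"
    then have lt: "R < \<rho>" using R\<rho> by simp
    have Kb: "norm x < \<rho>" if "x \<in> K" for x
    proof (rule ccontr)
      assume "\<not> norm x < \<rho>"
      then have "u x < 1" using e2[of x] vlt[of x] lt by auto
      then show False using one[OF that] by simp
    qed
    obtain xk where xk: "xk \<in> K" "\<And>x. x \<in> K \<Longrightarrow> norm x \<le> norm xk"
      using continuous_attains_sup[OF K(1) _ continuous_on_norm[OF continuous_on_id]] K(2) interior_subset by blast
    define a0 where "a0 = max R (norm xk)"
    have a0: "a0 < \<rho>" "R \<le> a0" using Kb[OF xk(1)] lt by (auto simp: a0_def)
    have "a0 \<in> P"
      unfolding P_def
    proof (intro CollectI conjI allI impI a0(2))
      fix x :: 'a assume x: "a0 < norm x"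
      show "u x = radial C x"
      proof (rule radial_continuation[OF C _ _ e1 x])
        show "a0 \<ge> 0" using a0 R by simp
        show "{x. a0 < norm x} \<subseteq> - K" using xk(2) by (force simp: a0_def not_less)
      qed
    qed
    then have "\<rho> \<le> a0" unfolding \<rho>_def using Pb by (rule cInf_lower)
    then show False using a0 by simp
  qed
  note e3 = e2[unfolded \<open>\<rho> = R\<close>]
  have "K \<subseteq> cball 0 R"
  proof
    fix x assume "x \<in> K"
    then have "\<not> R < norm x" using one[of x] e3[of x] vlt[of x] by auto
    then show "x \<in> cball 0 R" by simp
  qed
  then show "K \<subseteq> cball 0 (C powr (1 / decay))" by (simp add: R_def)
  have "sphere 0 R \<subseteq> K"
  proof
    fix z :: 'a assume "z \<in> sphere 0 R"
    then have z: "norm z = R" by simp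
    then have z0: "z \<noteq> 0" using R by auto
    show "z \<in> K"
    proof (rule ccontr)
      assume zK: "z \<notin> K"
      have uz: "u z = 1" using e3[of z] v1[OF z0] z R z0 by simp
      define S where "S = - K - {0}"
      have S: "open S" "S \<subseteq> - K" "0 \<notin> S"
        using K compact_imp_closed by (auto simp: S_def)
      have zS: "z \<in> S" using zK z0 by (simp add: S_def)
      \<comment> \<open>\<open>z\<close> is a maximum of \<open>u \<le> 1\<close>, whereas \<open>u\<close> equals the strictly decreasing radial power on the ray beyond \<open>z\<close>.\<close>
      have Gz: "G z = 0"
        by (rule local_max_gradient_Hessian(1)[OF data _ zero_less_one]) (use zK uz le_one in auto)
      note D = difference_data(1)[OF S C]
      define f where "f = (\<lambda>t. u (z + t *\<^sub>R z) - radial C (z + t *\<^sub>R z))"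
      have "(f has_real_derivative (G (z + 0 *\<^sub>R z) - radial_slope 0 C decay (z + 0 *\<^sub>R z) *\<^sub>R (z + 0 *\<^sub>R z - 0)) \<bullet> z) (at 0)"
        unfolding f_def by (rule C2_data_line(1)[OF D]) (use zS in simp)
      then have df: "(f has_real_derivative (- radial_slope 0 C decay z * (z \<bullet> z))) (at 0)"
        using Gz by simp
      have "- radial_slope 0 C decay z * (z \<bullet> z) > 0"
        using decay_pos C z0 by (simp add: radial_slope_def)
      then obtain d where d: "d > 0" "\<And>t. 0 < t \<Longrightarrow> t < d \<Longrightarrow> f 0 < f (0 + t)"
        using DERIV_pos_inc_right[OF df] by metis
      have f0: "f t = 0" if "t \<ge> 0" for t
      proof -
        have "z + t *\<^sub>R z = (1 + t) *\<^sub>R z" by (simp add: scaleR_add_left)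
        then have "norm (z + t *\<^sub>R z) = (1 + t) * R" using that z by simp
        moreover have "1 * R \<le> (1 + t) * R" using that R by (intro mult_right_mono) auto
        ultimately show ?thesis using e3 by (simp add: f_def)
      qed
      show False using d(2)[of "d / 2"] d(1) f0[of 0] f0[of "d / 2"] by simp
    qed
  qed
  then show "sphere 0 (C powr (1 / decay)) \<subseteq> K" by (simp add: R_def)
qed

text \<open>The circumscribed and the inscribed ball of \<open>L\<^sub>s\<close> around the origin give \<open>r \<le> s \<beta>\<^sup>-\<^sup>b\<close> and \<open>r \<ge> s \<beta>\<^sup>-\<^sup>b\<close>, with
  \<open>b = decay\<close>. By the equality, the upper bound is attained at \<open>z = \<beta> x\<^sub>m\<close>, a point with \<open>|z| > m\<close>.\<close>

lemma homothetic_imp_sphere: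
  assumes rs: "0 < r" "r < s" "s \<le> 1" and lam: "0 < lam" "lam < 1"
    and hom: "{x. s \<le> u x} = (\<lambda>x. lam *\<^sub>R x) ` {x. r \<le> u x}"
  shows "\<exists>R>0. sphere 0 R \<subseteq> K \<and> K \<subseteq> cball 0 R"
proof -
  define Ls where "Ls = {x. s \<le> u x}"
  define \<beta> where "\<beta> = 1 / lam"
  have \<beta>: "\<beta> > 1" "\<beta> * lam = 1" using lam by (auto simp: \<beta>_def)
  have hom1: "lam *\<^sub>R x \<in> Ls \<longleftrightarrow> r \<le> u x" for x
    using hom lam by (auto simp: Ls_def)
  have hom2: "s \<le> u x \<longleftrightarrow> r \<le> u (\<beta> *\<^sub>R x)" for x
    using hom1[of "\<beta> *\<^sub>R x"] \<beta> by (simp add: Ls_def mult.commute)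
  have KLs: "K \<subseteq> Ls" using one rs by (auto simp: Ls_def)
  have clLs: "closed Ls"
    unfolding Ls_def using cont by (intro closed_Collect_le continuous_intros)
  have "bounded Ls"
  proof -
    have "\<forall>\<^sub>F x in at_infinity. u x < s" using rs by (intro order_tendstoD(2)[OF at_inf]) auto
    then obtain B where "\<And>x. B \<le> norm x \<Longrightarrow> u x < s" unfolding eventually_at_infinity by blast
    then have "Ls \<subseteq> ball 0 B" by (force simp: Ls_def not_le[symmetric])
    then show ?thesis using bounded_subset bounded_ball by blast
  qed
  then have coLs: "compact Ls" using clLs compact_eq_bounded_closed by blast
  obtain xK where xK: "xK \<in> Ls" using K(2) KLs interior_subset by blast
  \<comment> \<open>The contraction maps \<open>Ls\<close> into itself, so its fixed point is in \<open>Ls\<close>; there \<open>u \<ge> s > r\<close>, and rescaling a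
      neighbourhood on which \<open>u > r\<close> gives a ball inside \<open>Ls\<close>.\<close>
  have zero: "0 \<in> Ls"
  proof -
    have it: "(lam ^ k) *\<^sub>R xK \<in> Ls" for k
    proof (induction k)
      case (Suc k)
      then have "r \<le> u ((lam ^ k) *\<^sub>R xK)" using rs by (simp add: Ls_def)
      then show ?case using hom1[of "(lam ^ k) *\<^sub>R xK"] by simp
    qed (use xK in simp)
    have "(\<lambda>k. (lam ^ k) *\<^sub>R xK) \<longlonglongrightarrow> 0 *\<^sub>R xK"
      using lam by (intro tendsto_intros LIMSEQ_realpow_zero) auto
    then show ?thesis using closed_sequentially[OF clLs it] by (simp only: scaleR_zero_left)
  qed
  obtain \<epsilon> where \<epsilon>: "\<epsilon> > 0" "ball 0 \<epsilon> \<subseteq> Ls"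
  proof -
    have "open {x. r < u x}" using cont by (intro open_Collect_less continuous_intros)
    moreover have "0 \<in> {x. r < u x}" using zero rs by (simp add: Ls_def)
    ultimately obtain e where e: "e > 0" "ball 0 e \<subseteq> {x. r < u x}" using open_contains_ball by blast
    have "ball 0 (lam * e) \<subseteq> Ls"
    proof
      fix x :: 'a assume "x \<in> ball 0 (lam * e)"
      then have "\<beta> *\<^sub>R x \<in> ball 0 e" using lam by (simp add: \<beta>_def field_simps)
      then have "r < u (\<beta> *\<^sub>R x)" using e by blast
      then show "x \<in> Ls" using hom2[of x] by (simp add: Ls_def)
    qed
    then show ?thesis using that[of "lam * e"] e lam by simp
  qed
  obtain xm where xm: "xm \<in> Ls" "\<And>x. x \<in> Ls \<Longrightarrow> norm x \<le> norm xm"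
    using continuous_attains_sup[OF coLs _ continuous_on_norm[OF continuous_on_id]] zero by blast
  define m where "m = norm xm"
  have m: "m > 0"
  proof -
    obtain e :: 'a where e: "norm e = 1" using vector_choose_size[of 1] by auto
    then have "(\<epsilon> / 2) *\<^sub>R e \<in> Ls" using \<epsilon> by (intro subsetD[OF \<epsilon>(2)]) simp
    then have "norm ((\<epsilon> / 2) *\<^sub>R e) \<le> m" unfolding m_def by (rule xm(2))
    then show ?thesis using \<epsilon> e by simp
  qed
  have out: "u x < s" if "m < norm x" for x
    using xm(2)[of x] that by (force simp: m_def Ls_def not_le)
  have on: "u x \<le> s" if "norm x = m" for x
  proof -
    note tendsto_along_ray[of x "{1<..}"]
    moreover have "\<forall>\<^sub>F t in at_right 1. u (t *\<^sub>R x) \<le> s"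
      using eventually_at_right_less[of 1]
    proof eventually_elim
      case (elim t)
      then have "1 * m < t * m" using m by (intro mult_strict_right_mono) auto
      then show ?case using out[of "t *\<^sub>R x"] that elim by simp
    qed
    ultimately show ?thesis by (rule tendsto_upperbound) simp
  qed
  define E where "E = {x::'a. m < norm x}"
  have E: "open E" "E \<subseteq> - K" "0 \<notin> E"
    using m xm(2) KLs by (auto simp: E_def m_def intro!: open_Collect_less continuous_intros dest!: subsetD)
      (metis not_less)
  define C where "C = s * m powr decay"
  have C: "C > 0" using rs m by (simp add: C_def)
  have up: "u x \<le> radial C x" if "m < norm x" for x
    unfolding C_def by (rule upper_bound[OF m E(2)[unfolded E_def] _ on that]) (use rs in auto)
  define z where "z = \<beta> *\<^sub>R xm"
  have nz: "norm z = \<beta> * m" using \<beta> by (simp add: z_def m_def)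
  have zE: "m < norm z" using nz \<beta> m by simp
  have ruz: "r \<le> u z" using xm(1) hom2[of xm] by (simp add: Ls_def z_def)
  have vz: "radial C z = s * (1 / \<beta>) powr decay"
  proof -
    have "m / (\<beta> * m) = 1 / \<beta>" using m by simp
    moreover have "z \<noteq> 0" using zE m by auto
    ultimately show ?thesis
      using radial_power_ratio[OF m, of z s decay] nz by (simp add: C_def)
  qed
  define F where "F = closure (- Ls)"
  have "z \<notin> Ls" using out[OF zE] by (simp add: Ls_def)
  then have "- Ls \<noteq> {}" by blast
  then have Fne: "F \<noteq> {}" by (simp add: F_def)
  obtain y where y: "y \<in> F" "\<And>w. w \<in> F \<Longrightarrow> dist 0 y \<le> dist 0 w"
    using distance_attains_inf[of F 0] Fne by (auto simp: F_def)
  define m' where "m' = norm y"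
  have Fy: "m' \<le> norm w" if "w \<in> F" for w using y(2)[OF that] by (simp add: m'_def)
  have m': "m' > 0"
  proof -
    have "ball 0 \<epsilon> \<inter> - Ls = {}" using \<epsilon> by auto
    then have "ball 0 \<epsilon> \<inter> F = {}" by (simp add: F_def open_Int_closure_eq_empty)
    moreover have "(0::'a) \<in> ball 0 \<epsilon>" using \<epsilon> by simp
    ultimately have "y \<noteq> 0" using y(1) by blast
    then show ?thesis by (simp add: m'_def)
  qed
  have inn: "s \<le> u x" if "norm x = m'" for x
  proof -
    note tendsto_along_ray[of x "{..<1}"]
    moreover have "\<forall>\<^sub>F t in at_left 1. s \<le> u (t *\<^sub>R x)"
      using eventually_at_left_real[OF zero_less_one]
    proof eventually_elim
      case (elim t)
      then have "t * m' < 1 * m'" using m' by (intro mult_strict_right_mono) auto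
      then have "t *\<^sub>R x \<notin> F" using Fy[of "t *\<^sub>R x"] that elim by auto
      then have "t *\<^sub>R x \<in> Ls" using closure_subset[of "- Ls"] by (auto simp: F_def)
      then show ?case by (simp add: Ls_def)
    qed
    ultimately show ?thesis by (rule tendsto_lowerbound) simp
  qed
  have lowy: "s * (1 / \<beta>) powr decay \<le> r"
  proof -
    have "F \<subseteq> {x. u (\<beta> *\<^sub>R x) \<le> r}"
      unfolding F_def
    proof (rule closure_minimal)
      show "- Ls \<subseteq> {x. u (\<beta> *\<^sub>R x) \<le> r}"
      proof
        fix x assume "x \<in> - Ls"
        then have "\<not> s \<le> u x" by (simp add: Ls_def)
        then show "x \<in> {x. u (\<beta> *\<^sub>R x) \<le> r}" using hom2[of x] by auto
      qed
      have "continuous_on UNIV (\<lambda>x. u (\<beta> *\<^sub>R x))"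
        by (rule continuous_on_compose2[OF cont]) (auto intro!: continuous_intros)
      then show "closed {x. u (\<beta> *\<^sub>R x) \<le> r}" by (intro closed_Collect_le continuous_intros)
    qed
    then have ur: "u (\<beta> *\<^sub>R y) \<le> r" using y(1) by auto
    have n: "norm (\<beta> *\<^sub>R y) = \<beta> * m'" using \<beta> by (simp add: m'_def)
    then have lt: "m' < norm (\<beta> *\<^sub>R y)" using \<beta> m' by simp
    have "radial_power 0 (s * m' powr decay) decay (\<beta> *\<^sub>R y) \<le> u (\<beta> *\<^sub>R y)"
      by (rule lower_bound[OF m' _ _ inn lt]) (use rs in auto)
    moreover have "radial_power 0 (s * m' powr decay) decay (\<beta> *\<^sub>R y) = s * (m' / (\<beta> * m')) powr decay"
      using radial_power_ratio[OF m', of "\<beta> *\<^sub>R y" s decay] lt m' n by auto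
    moreover have "m' / (\<beta> * m') = 1 / \<beta>" using m' by simp
    ultimately show ?thesis using ur by simp
  qed
  have touch: "u z - radial C z = 0"
    using up[OF zE] ruz vz lowy by linarith
  have conn: "connected E"
  proof -
    have "E = - cball 0 m" by (auto simp: E_def)
    then show ?thesis using connected_complement_bounded_convex[of "cball (0::'a) m"] dim by simp
  qed
  have eq: "u x = radial C x" if "m < norm x" for x
  proof -
    have "u x - radial C x = 0"
      by (rule strong_maximum_principle[OF difference_data(1)[OF E C] E(3) p(1) difference_data(2)[OF E C] _ _ touch conn])
        (use up zE that in \<open>auto simp: E_def\<close>)
    then show ?thesis by simp
  qed
  have mC: "C powr (1 / decay) \<le> m"
  proof -
    have "C \<le> m powr decay" using rs by (simp add: C_def mult_left_le_one_le)
    then have "C powr (1 / decay) \<le> (m powr decay) powr (1 / decay)" using C decay_pos by (intro powr_mono2) auto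
    then show ?thesis using m decay_pos by (simp add: powr_powr)
  qed
  have "C powr (1 / decay) > 0" using C by simp
  then show ?thesis using sphere_subset[OF C mC eq] by blast
qed

end

section \<open>From the flux equation to the pointwise equation, and the characterization of balls\<close>

lemma C2_data_translate:
  assumes "C2_data S f g H"
  shows "C2_data {x. x + c \<in> S} (\<lambda>x. f (x + c)) (\<lambda>x. g (x + c)) (\<lambda>x. H (x + c))"
  unfolding C2_data_def
proof (intro conjI ballI allI)
  have S: "open S" using C2_data_open[OF assms] .
  have "open ((\<lambda>x. x + c) -` S)" by (rule open_vimage[OF S]) (intro continuous_intros)
  then show "open {x. x + c \<in> S}" by (simp add: vimage_def)
  fix x assume "x \<in> {x. x + c \<in> S}"
  then have x: "x + c \<in> S" by simp
  have t: "((\<lambda>x. x + c) has_derivative (\<lambda>h. h)) (at x)" by (auto intro!: derivative_eq_intros)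
  show "((\<lambda>x. f (x + c)) has_derivative (\<lambda>h. g (x + c) \<bullet> h)) (at x)"
    using has_derivative_compose[OF t C2_dataD(1)[OF assms x]] by simp
  show "((\<lambda>x. g (x + c)) has_derivative H (x + c)) (at x)"
    using has_derivative_compose[OF t C2_dataD(2)[OF assms x]] by simp
next
  fix h
  show "continuous_on {x. x + c \<in> S} (\<lambda>x. H (x + c) h)"
    by (rule continuous_on_compose2[OF C2_data_cont(3)[OF assms, of h]]) (auto intro!: continuous_intros)
qed

lemma C2_data_C2_on:
  fixes u :: "real ^ 'n \<Rightarrow> real"
  assumes "C2_on u S" "open S"
  shows "C2_data S u (gradient u) (\<lambda>x h. jacobian (gradient u) (at x) *v h)"
  unfolding C2_data_def
proof (intro conjI ballI allI assms(2))
  fix x assume "x \<in> S"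
  then have d: "u differentiable (at x)" "gradient u differentiable (at x)"
    using assms by (auto simp: C2_on_def)
  show "(u has_derivative (\<lambda>h. gradient u x \<bullet> h)) (at x)"
    using gradient_works[OF d(1)] unfolding gderiv_def by (simp add: inner_commute)
  show "(gradient u has_derivative (\<lambda>h. jacobian (gradient u) (at x) *v h)) (at x)"
    using jacobian_works d(2) by blast
next
  fix h
  have c: "continuous_on S (\<lambda>x. jacobian (gradient u) (at x))"
    using assms by (simp add: C2_on_def)
  have "linear (\<lambda>A :: real ^ 'n ^ 'n. A *v h)"
    by (intro linearI) (simp_all add: matrix_vector_mult_add_rdistrib scaleR_matrix_vector_assoc)
  then have "bounded_linear (\<lambda>A :: real ^ 'n ^ 'n. A *v h)"
    by (simp add: linear_conv_bounded_linear)
  then show "continuous_on S (\<lambda>x. jacobian (gradient u) (at x) *v h)"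
    by (rule bounded_linear.continuous_on[OF _ c])
qed

lemma trace_eq_tr: "trace A = tr (\<lambda>h. A *v (h :: real ^ 'n))"
proof -
  have B: "(Basis :: (real ^ 'n) set) = (\<lambda>i. axis i 1) ` UNIV"
    by (auto simp: Basis_vec_def)
  have I: "inj (\<lambda>i::'n. axis i (1::real))"
    by (simp add: inj_on_def axis_eq_axis)
  have "tr (\<lambda>h. A *v (h :: real ^ 'n)) = (\<Sum>i\<in>UNIV. axis i 1 \<bullet> (A *v axis i 1))"
    unfolding tr_def B by (subst sum.reindex[OF I]) simp
  also have "\<dots> = trace A"
    by (simp add: trace_def inner_axis' matrix_vector_mult_basis column_def)
  finally show ?thesis by simp
qed

text \<open>The chain rule for the field \<open>|\<xi>|\<^sup>p\<^sup>-\<^sup>2 \<xi>\<close>, which is smooth where \<open>\<xi>\<close> is not zero.\<close>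

lemma p_op_of_p_flux:
  fixes u :: "real ^ 'n \<Rightarrow> real"
  assumes D: "C2_data S u (gradient u) H" and x: "x \<in> S" and div: "divergence (p_flux p u) x = 0"
  shows "p_op p (gradient u x) (H x) = 0"
proof (cases "gradient u x = 0")
  case False
  define G where "G = gradient u"
  have G0: "G x \<noteq> 0" using False by (simp add: G_def)
  have dG: "(G has_derivative H x) (at x)" and lin: "linear (H x)"
    using C2_dataD[OF D x] by (simp_all add: G_def)
  have dq: "((\<lambda>y. G y \<bullet> G y) has_derivative (\<lambda>h. 2 * (G x \<bullet> H x h))) (at x)"
    using has_derivative_inner[OF dG dG] by (simp add: inner_commute)
  have pos: "G x \<bullet> G x > 0" using G0 by simp
  have dp: "((\<lambda>t. t powr ((p - 2) / 2)) has_real_derivative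
      (p - 2) / 2 * (G x \<bullet> G x) powr ((p - 2) / 2 - 1)) (at (G x \<bullet> G x))"
    by (rule has_real_derivative_powr[OF pos])
  define k where "k = (p - 2) * (G x \<bullet> G x) powr ((p - 2) / 2 - 1)"
  have "((\<lambda>y. (G y \<bullet> G y) powr ((p - 2) / 2)) has_derivative
      (\<lambda>h. k * (G x \<bullet> H x h))) (at x)"
    using has_derivative_compose[OF dq dp[unfolded has_field_derivative_def]] by (simp add: k_def mult_ac)
  from has_derivative_scaleR[OF this dG]
  have "((\<lambda>y. (G y \<bullet> G y) powr ((p - 2) / 2) *\<^sub>R G y) has_derivative
      (\<lambda>h. (G x \<bullet> G x) powr ((p - 2) / 2) *\<^sub>R H x h
         + (k * (G x \<bullet> H x h)) *\<^sub>R G x)) (at x)" .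
  moreover have "(\<lambda>y. (G y \<bullet> G y) powr ((p - 2) / 2) *\<^sub>R G y) = p_flux p u"
  proof
    fix y
    show "(G y \<bullet> G y) powr ((p - 2) / 2) *\<^sub>R G y = p_flux p u y"
    proof (cases "G y = 0")
      case False
      then have "G y \<bullet> G y = norm (G y) powr 2" by (simp add: dot_square_norm powr_numeral)
      then have "(G y \<bullet> G y) powr ((p - 2) / 2) = norm (G y) powr (2 * ((p - 2) / 2))"
        by (simp only: powr_powr)
      also have "2 * ((p - 2) / 2) = p - 2" by simp
      finally show ?thesis by (simp add: p_flux_def G_def)
    qed (simp add: p_flux_def G_def)
  qed
  ultimately have dF: "(p_flux p u has_derivative
      (\<lambda>h. (G x \<bullet> G x) powr ((p - 2) / 2) *\<^sub>R H x h
         + (k * (G x \<bullet> H x h)) *\<^sub>R G x)) (at x)"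
    by simp
  then have "(p_flux p u has_derivative (\<lambda>h. jacobian (p_flux p u) (at x) *v h)) (at x)"
    using jacobian_works differentiable_def by blast
  then have "(\<lambda>h. jacobian (p_flux p u) (at x) *v h) =
      (\<lambda>h. (G x \<bullet> G x) powr ((p - 2) / 2) *\<^sub>R H x h
         + (k * (G x \<bullet> H x h)) *\<^sub>R G x)"
    using dF has_derivative_unique by blast
  then have "tr (\<lambda>h. (G x \<bullet> G x) powr ((p - 2) / 2) *\<^sub>R H x h
         + (k * (G x \<bullet> H x h)) *\<^sub>R G x) = 0"
    using div by (simp add: divergence_def trace_eq_tr)
  moreover have "linear (\<lambda>h. k * (G x \<bullet> H x h))"
    using lin by (intro linearI) (simp_all add: linear_add linear_scale inner_add_right algebra_simps)
  ultimately have "(G x \<bullet> G x) powr ((p - 2) / 2) * tr (H x)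
      + k * (G x \<bullet> H x (G x)) = 0"
    by (simp only: tr_add tr_scale tr_linear_rank_one)
  moreover have "(G x \<bullet> G x) powr ((p - 2) / 2) = (G x \<bullet> G x) powr ((p - 2) / 2 - 1) * (G x \<bullet> G x)"
    using pos by (simp add: powr_diff)
  ultimately have "(G x \<bullet> G x) powr ((p - 2) / 2 - 1) * p_op p (G x) (H x) = 0"
    unfolding p_op_def k_def by (simp only: ring_distribs mult_ac)
  then show ?thesis using pos by (simp add: G_def)
qed (simp add: p_op_def)

text \<open>Compare the widths of \<open>A\<close> and \<open>B\<close> in one direction: the width of \<open>B\<close> is \<open>\<rho>\<close> times that of \<open>A\<close>, and it is
  strictly smaller because \<open>B\<close> lies in the interior.\<close>

lemma homothety_ratio_less_one:
  fixes A B :: "'a::euclidean_space set"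
  assumes A: "compact A" and B: "B \<noteq> {}" "B \<subseteq> interior A"
    and hom: "B = (\<lambda>x. \<rho> *\<^sub>R x + \<xi>) ` A"
  shows "\<rho> < 1"
proof -
  obtain e :: 'a where e: "norm e = 1" using vector_choose_size[of 1] by auto
  have ne: "A \<noteq> {}" using B hom by auto
  have ci: "continuous_on A (\<lambda>x. x \<bullet> e)" by (intro continuous_intros)
  obtain x1 where x1: "x1 \<in> A" "\<And>x. x \<in> A \<Longrightarrow> x \<bullet> e \<le> x1 \<bullet> e"
    using continuous_attains_sup[OF A ne ci] by blast
  obtain x2 where x2: "x2 \<in> A" "\<And>x. x \<in> A \<Longrightarrow> x2 \<bullet> e \<le> x \<bullet> e"
    using continuous_attains_inf[OF A ne ci] by blast
  have strict: "x2 \<bullet> e < y \<bullet> e \<and> y \<bullet> e < x1 \<bullet> e" if "y \<in> B" for y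
  proof -
    have "y \<in> interior A" using that B(2) by blast
    then obtain r where r: "r > 0" "cball y r \<subseteq> A"
      unfolding mem_interior_cball by blast
    have "y + r *\<^sub>R e \<in> A" "y - r *\<^sub>R e \<in> A"
      using r e by (auto intro!: subsetD[OF r(2)] simp: dist_norm)
    then have "(y + r *\<^sub>R e) \<bullet> e \<le> x1 \<bullet> e" "x2 \<bullet> e \<le> (y - r *\<^sub>R e) \<bullet> e"
      using x1 x2 by blast+
    moreover have "e \<bullet> e = 1" using e by (simp add: dot_square_norm)
    ultimately show ?thesis using r by (simp add: inner_add_left inner_diff_left)
  qed
  have "\<rho> *\<^sub>R x1 + \<xi> \<in> B" "\<rho> *\<^sub>R x2 + \<xi> \<in> B" using x1 x2 hom by auto
  then have "(\<rho> *\<^sub>R x1 + \<xi>) \<bullet> e < x1 \<bullet> e" "x2 \<bullet> e < (\<rho> *\<^sub>R x2 + \<xi>) \<bullet> e"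
    using strict by blast+
  then have "\<rho> * (x1 \<bullet> e - x2 \<bullet> e) < 1 * (x1 \<bullet> e - x2 \<bullet> e)"
    by (simp add: inner_add_left algebra_simps)
  moreover have "0 \<le> x1 \<bullet> e - x2 \<bullet> e" using x1(2)[OF x2(1)] by simp
  ultimately show ?thesis
    by (meson mult_right_mono not_less)
qed

lemma cball_subset_convex:
  fixes c :: "'a::euclidean_space"
  assumes "convex S" "sphere c R \<subseteq> S" "R > 0"
  shows "cball c R \<subseteq> S"
proof
  fix x assume x: "x \<in> cball c R"
  obtain d :: 'a where d: "norm d = 1" "\<exists>t. 0 \<le> t \<and> t \<le> R \<and> x = c + t *\<^sub>R d"
  proof (cases "x = c")
    case True
    obtain d :: 'a where "norm d = 1" using vector_choose_size[of 1] by auto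
    moreover have "\<exists>t. 0 \<le> t \<and> t \<le> R \<and> x = c + t *\<^sub>R d" for d
      using True assms(3) by (intro exI[of _ 0]) simp
    ultimately show ?thesis using that by blast
  next
    case False
    show ?thesis
      by (rule that[of "(x - c) /\<^sub>R norm (x - c)"])
        (use False x in \<open>auto intro!: exI[of _ "norm (x - c)"] simp: dist_norm norm_minus_commute\<close>)
  qed
  then obtain t where t: "0 \<le> t" "t \<le> R" "x = c + t *\<^sub>R d" by blast
  have s: "c + R *\<^sub>R d \<in> S" "c - R *\<^sub>R d \<in> S"
    using d assms by (auto intro!: subsetD[OF assms(2)] simp: dist_norm)
  define l where "l = (R + t) / (2 * R)"
  have l: "0 \<le> l" "l \<le> 1" using t assms(3) by (auto simp: l_def divide_le_eq)
  have "l *\<^sub>R (c + R *\<^sub>R d) + (1 - l) *\<^sub>R (c - R *\<^sub>R d) = c + ((2 * l - 1) * R) *\<^sub>R d"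
    by (simp add: algebra_simps) (simp flip: scaleR_add_left)
  also have "(2 * l - 1) * R = t" using assms(3) by (simp add: l_def field_simps)
  finally have "l *\<^sub>R (c + R *\<^sub>R d) + (1 - l) *\<^sub>R (c - R *\<^sub>R d) = x" using t by simp
  moreover have "l *\<^sub>R (c + R *\<^sub>R d) + (1 - l) *\<^sub>R (c - R *\<^sub>R d) \<in> S"
    using convexD[OF assms(1) s l(1), of "1 - l"] l by simp
  ultimately show "x \<in> S" by simp
qed

theorem theorem1p2:
  fixes \<Omega> :: "(real ^ 'n) set"
    and u :: "real ^ 'n \<Rightarrow> real"
    and p :: real
  assumes "CARD('n) \<ge> 3"
    and "1 < p" and "p < real CARD('n)"
    and "\<Omega> \<noteq> {}" and "bounded \<Omega>" and "open \<Omega>" and "convex \<Omega>"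
    and "p_capacitary_potential p \<Omega> u"
    and "\<exists>r s. 0 < r \<and> r < s \<and> s \<le> 1 \<and> homothetic (level_set u r) (level_set u s)"
  shows "\<exists>x0 R. R > 0 \<and> \<Omega> = ball x0 R"
proof -
  have pot: "continuous_on UNIV u" "C2_on u (- closure \<Omega>)"
      "\<And>x. x \<notin> closure \<Omega> \<Longrightarrow> divergence (p_flux p u) x = 0"
      "\<And>x. x \<in> closure \<Omega> \<Longrightarrow> u x = 1" "(u \<longlongrightarrow> 0) at_infinity"
    using assms(8) unfolding p_capacitary_potential_def by auto
  obtain r s where rs: "0 < r" "r < s" "s \<le> 1" and h: "homothetic (level_set u r) (level_set u s)"
    using assms(9) by blast
  obtain \<rho> \<xi> where \<rho>: "\<rho> > 0" and hom: "level_set u s = (\<lambda>x. \<rho> *\<^sub>R x + \<xi>) ` level_set u r"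
    using h unfolding homothetic_def by blast
  define H where "H = (\<lambda>x h. jacobian (gradient u) (at x) *v h)"
  have D: "C2_data (- closure \<Omega>) u (gradient u) H"
    unfolding H_def by (rule C2_data_C2_on[OF pot(2)]) auto
  have "\<rho> < 1"
  proof (rule homothety_ratio_less_one[OF _ _ _ hom])
    have "closed (level_set u r)"
      unfolding level_set_def using pot(1) by (intro closed_Collect_le continuous_intros)
    moreover have "bounded (level_set u r)"
    proof -
      have "\<forall>\<^sub>F x in at_infinity. u x < r" using rs by (intro order_tendstoD(2)[OF pot(5)]) auto
      then obtain B where "\<And>x. B \<le> norm x \<Longrightarrow> u x < r" unfolding eventually_at_infinity by blast
      then have "level_set u r \<subseteq> ball 0 B" by (force simp: level_set_def not_le[symmetric])
      then show ?thesis using bounded_subset bounded_ball by blast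
    qed
    ultimately show "compact (level_set u r)" using compact_eq_bounded_closed by blast
    show "level_set u s \<noteq> {}"
    proof -
      obtain w where "w \<in> \<Omega>" using assms(4) by auto
      then have "u w = 1" using pot(4) closure_subset[of \<Omega>] by blast
      then have "w \<in> level_set u s" using rs by (simp add: level_set_def)
      then show ?thesis by blast
    qed
    have "open {x. r < u x}" using pot(1) by (intro open_Collect_less continuous_intros)
    then show "level_set u s \<subseteq> interior (level_set u r)"
      using rs by (intro order_trans[OF _ interior_maximal[of "{x. r < u x}"]]) (auto simp: level_set_def)
  qed
  define c where "c = \<xi> /\<^sub>R (1 - \<rho>)"
  have c: "\<rho> *\<^sub>R c + \<xi> = c"
  proof -
    have "(1 - \<rho>) *\<^sub>R c = \<xi>" using \<open>\<rho> < 1\<close> by (simp add: c_def)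
    then show ?thesis by (simp add: algebra_simps)
  qed
  define K where "K = {x. x + c \<in> closure \<Omega>}"
  have K_eq: "K = (\<lambda>x. x - c) ` closure \<Omega>"
    by (force simp: K_def image_iff)
  interpret p_potential p K "\<lambda>x. u (x + c)" "\<lambda>x. gradient u (x + c)" "\<lambda>x. H (x + c)"
  proof
    show "2 \<le> DIM(real ^ 'n)" "1 < p" "p < real DIM(real ^ 'n)" using assms by auto
    show "compact K"
      unfolding K_eq using assms(5) by (intro compact_continuous_image continuous_intros) auto
    have "open {x. x + c \<in> \<Omega>}"
      using open_vimage[OF assms(6), of "\<lambda>x. x + c"] by (simp add: vimage_def continuous_intros)
    then have "{x. x + c \<in> \<Omega>} \<subseteq> interior K"
      using closure_subset[of \<Omega>] by (intro interior_maximal) (auto simp: K_def)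
    moreover obtain w where "w \<in> \<Omega>" using assms(4) by auto
    then have "w - c \<in> {x. x + c \<in> \<Omega>}" by simp
    ultimately show "interior K \<noteq> {}" by blast
    have "- K = {x. x + c \<in> - closure \<Omega>}" by (auto simp: K_def)
    then show "C2_data (- K) (\<lambda>x. u (x + c)) (\<lambda>x. gradient u (x + c)) (\<lambda>x. H (x + c))"
      using C2_data_translate[OF D, of c] by simp
    show "p_op p (gradient u (x + c)) (H (x + c)) = 0" if "x \<notin> K" for x
      by (rule p_op_of_p_flux[OF D]) (use that pot(3) in \<open>auto simp: K_def\<close>)
    show "continuous_on UNIV (\<lambda>x. u (x + c))"
      by (rule continuous_on_compose2[OF pot(1)]) (auto intro!: continuous_intros)
    show "u (x + c) = 1" if "x \<in> K" for x using that pot(4) by (simp add: K_def)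
    have "filterlim (\<lambda>x. x + c) at_infinity at_infinity"
      using tendsto_add_filterlim_at_infinity'[OF filterlim_ident tendsto_const] .
    then show "((\<lambda>x. u (x + c)) \<longlongrightarrow> 0) at_infinity"
      using filterlim_compose[OF pot(5)] by blast
  qed
  have "{x. s \<le> u (x + c)} = (\<lambda>x. \<rho> *\<^sub>R x) ` {x. r \<le> u (x + c)}"
  proof (intro set_eqI iffI)
    fix x assume "x \<in> {x. s \<le> u (x + c)}"
    then have "x + c \<in> level_set u s" by (simp add: level_set_def)
    then obtain y where y: "y \<in> level_set u r" "x + c = \<rho> *\<^sub>R y + \<xi>" using hom by auto
    have "(\<rho> *\<^sub>R y + \<xi>) - (\<rho> *\<^sub>R c + \<xi>) = \<rho> *\<^sub>R (y - c)"
      by (simp add: scaleR_diff_right)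
    then have "x = \<rho> *\<^sub>R (y - c)" unfolding c y(2)[symmetric] by simp
    then show "x \<in> (\<lambda>x. \<rho> *\<^sub>R x) ` {x. r \<le> u (x + c)}"
      using y(1) by (auto simp: level_set_def intro!: image_eqI[of _ _ "y - c"])
  next
    fix x assume "x \<in> (\<lambda>x. \<rho> *\<^sub>R x) ` {x. r \<le> u (x + c)}"
    then obtain y where y: "x = \<rho> *\<^sub>R y" "r \<le> u (y + c)" by auto
    have "\<rho> *\<^sub>R (y + c) + \<xi> = \<rho> *\<^sub>R y + (\<rho> *\<^sub>R c + \<xi>)"
      by (simp only: scaleR_add_right add.assoc)
    then have yc: "\<rho> *\<^sub>R (y + c) + \<xi> = x + c" unfolding c y(1) .
    then have "x + c \<in> level_set u s"
      using y(2) hom by (auto simp: level_set_def intro!: image_eqI[of _ _ "y + c"])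
    then show "x \<in> {x. s \<le> u (x + c)}" by (simp add: level_set_def)
  qed
  from homothetic_imp_sphere[OF rs \<rho> \<open>\<rho> < 1\<close> this]
  obtain R where R: "R > 0" "sphere 0 R \<subseteq> K" "K \<subseteq> cball 0 R" by blast
  have "sphere c R \<subseteq> closure \<Omega>"
  proof
    fix x assume "x \<in> sphere c R"
    then have "x - c \<in> sphere 0 R" by (simp add: dist_norm norm_minus_commute)
    then show "x \<in> closure \<Omega>" using R(2) by (auto simp: K_def)
  qed
  then have "cball c R \<subseteq> closure \<Omega>"
    using cball_subset_convex[OF convex_closure[OF assms(7)]] R by blast
  moreover have "closure \<Omega> \<subseteq> cball c R"
  proof
    fix x assume "x \<in> closure \<Omega>"
    then have "x - c \<in> K" by (simp add: K_def)
    then have "x - c \<in> cball 0 R" using R(3) by blast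
    then show "x \<in> cball c R" by (simp add: dist_norm norm_minus_commute)
  qed
  ultimately have "closure \<Omega> = cball c R" by blast
  then have "interior (closure \<Omega>) = ball c R" by simp
  moreover have "interior (closure \<Omega>) = \<Omega>"
    using convex_interior_closure[OF assms(7)] assms(6) by (simp add: interior_open)
  ultimately show ?thesis using R by blast
qed

end
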